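(* Let $\omega(k)=k^2$ and let $q$ be the solution of the linear Schr\"odinger initial-boundary value problem $iq_t+q_{xx}=0$ for $x>0$, $t\in(0,T]$, with $q(\cdot,0)=q_o$ and $q(0,\cdot)=g_0$, where $q_o,g_0$ satisfy the regularity assumptions listed in the context (no compatibility between $q_o(0)$ and $g_0(0)$ is required). Then, as $(x,t)\to(0,0)$ with $x>0$, $t>0$, $$q(x,t)=q_{\rm loc}(x,t)+\mathcal O\big(|x|^{1/2}+|t|^{1/4}\big),\qquad q_{\rm loc}(x,t)=-2g_0(0)\,I_{\omega,0,1}(x,t)+2q_o(0)\Big(I_{\omega,0,1}(x,t)+\tfrac12\Big),$$ where $q_o(0)$ and $g_0(0)$ denote the one-sided limits $q_o(0^+)$, $g_0(0^+)$.
   Context: Assumptions on the data: (i) $q_o\in L^2(\mathbb R^+)\cap L^1(\mathbb R^+,(1+|x|)^\ell)$ for some $\ell\ge 0$; (ii) there are $0=x_0<x_1<\dots<x_M<x_{M+1}=\infty$ such that $q_o\in H^1((x_i,x_{i+1}))$ for each $i=0,\dots,M$ and $q_o(x_i^+)\ne q_o(x_i^-)$ for $i=1,\dots,M$; (iii) there are $0=t_0<t_1<\dots<t_K<t_{K+1}=T$ such that $g_0\in H^1((t_i,t_{i+1}))$ for each $i=0,\dots,K$ ($g_0$ may or may not be discontinuous at each $t_i$, $i\ge 1$). Let $D^+=\{k\in\mathbb C: \mathrm{Im}\,k>0,\ \mathrm{Im}(k^2)\ge 0\}$ (the first quadrant). For a fixed $R>0$ let $D_1^+=D^+\setminus\{|k|<R\}$.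 Boundaries are oriented with the region on the left, so $\partial D_1^+$ runs from $i\infty$ to $+\infty$, avoiding the origin. Integrals over unbounded contours are limits, as $r\to\infty$, of the integrals over the part of the contour in $\{|k|<r\}$. The solution $q$ is the $L^2$ solution (weak solution in $\mathbb R^+\times(0,T)$, $q\in C^0([0,T];L^2(\mathbb R^+))$ with $q(\cdot,0)=q_o$ a.e., $q\in C^0([0,\infty);H^{1/4}(0,T))$ with $q(0,\cdot)=g_0$ a.e.), which for $x>0$, $t>0$ is given by $$q(x,t)=\frac1{2\pi}\int_{\mathbb R}e^{ikx-ik^2t}\hat q_o(k)\,dk+\frac1{2\pi}\int_{\partial D^+}e^{ikx-ik^2t}\big[2k\,\tilde g_0(-k^2,t)-\hat q_o(-k)\big]dk,$$ with $\hat q_o(k)=\int_0^\infty e^{-ikx}q_o(x)\,dx$ and $\tilde g_0(\kappa,t)=\int_0^te^{-i\kappa s}g_0(s)\,ds$. The special function is $$I_{\omega,0,1}(x,t)=\frac1{2\pi}\int_{\partial D_1^+}e^{ikx-i\omega(k)t}\frac{dk}{ik}.$$ *)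

theory Defs
  imports "HOL-Complex_Analysis.Complex_Analysis" "HOL-Library.Landau_Symbols"
begin

section \<open>Function spaces\<close>

text \<open>
  Elements of \<open>L\<^sup>2\<close>, \<open>H\<^sup>1\<close>, \<open>H\<^sup>s\<close> are represented by functions; every predicate below is invariant
  under changes on Lebesgue null sets.
\<close>

definition L2_on :: "real set \<Rightarrow> (real \<Rightarrow> complex) \<Rightarrow> bool" where
  "L2_on A f \<longleftrightarrow> set_borel_measurable lebesgue A f \<and>
     set_integrable lebesgue A (\<lambda>x. (norm (f x))\<^sup>2)"

definition L2_norm_sq :: "real set \<Rightarrow> (real \<Rightarrow> complex) \<Rightarrow> ennreal" where
  "L2_norm_sq A f = (\<integral>\<^sup>+x\<in>A. ennreal ((norm (f x))\<^sup>2) \<partial>lebesgue)"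

text \<open>\<open>C\<^sup>1\<close> functions with compact support in \<open>I\<close>; the second argument is the derivative.\<close>

definition C1c_test :: "real set \<Rightarrow> (real \<Rightarrow> complex) \<Rightarrow> (real \<Rightarrow> complex) \<Rightarrow> bool" where
  "C1c_test I \<phi> \<phi>' \<longleftrightarrow> (\<forall>x. (\<phi> has_vector_derivative \<phi>' x) (at x)) \<and> continuous_on UNIV \<phi>' \<and>
     (\<exists>C\<subseteq>I. compact C \<and> (\<forall>x. x \<notin> C \<longrightarrow> \<phi> x = 0))"

text \<open>
  The Sobolev space \<open>H\<^sup>1(I)\<close> of an open interval: square integrable functions with a square
  integrable weak derivative. As in Brezis' textbook the test functions are \<open>C\<^sup>1\<close> with compact
  support; by mollification this gives the same space as smooth test functions.
\<close>

definition H1_on :: "real set \<Rightarrow> (real \<Rightarrow> complex) \<Rightarrow> bool" where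
  "H1_on I f \<longleftrightarrow> L2_on I f \<and>
     (\<exists>g. L2_on I g \<and> (\<forall>\<phi> \<phi>'. C1c_test I \<phi> \<phi>' \<longrightarrow>
        (LINT x:I|lebesgue. f x * \<phi>' x) = - (LINT x:I|lebesgue. g x * \<phi> x)))"

text \<open>
  The (Sobolev-Slobodeckij) space \<open>H\<^sup>s\<close> on an open interval, for \<open>0 < s < 1\<close>.
\<close>

definition Hs_norm_sq :: "real \<Rightarrow> real set \<Rightarrow> (real \<Rightarrow> complex) \<Rightarrow> ennreal" where
  "Hs_norm_sq s A f = L2_norm_sq A f +
     (\<integral>\<^sup>+z\<in>A \<times> A. ennreal ((norm (f (fst z) - f (snd z)))\<^sup>2 / \<bar>fst z - snd z\<bar> powr (1 + 2 * s)) \<partial>lebesgue)"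

definition Hs_on :: "real \<Rightarrow> real set \<Rightarrow> (real \<Rightarrow> complex) \<Rightarrow> bool" where
  "Hs_on s A f \<longleftrightarrow> set_borel_measurable lebesgue A f \<and> Hs_norm_sq s A f < \<infinity>"

section \<open>One-sided limits\<close>

text \<open>
  One-sided limits \<open>f(a\<^sup>+)\<close>, \<open>f(a\<^sup>-)\<close> of a function known only almost everywhere: limits that
  disregard Lebesgue null sets. They agree with the ordinary one-sided limits whenever the latter
  exist (see below), and exist at both endpoints of a bounded open interval for any \<open>H\<^sup>1\<close> function.
\<close>

definition right_lim :: "(real \<Rightarrow> complex) \<Rightarrow> real \<Rightarrow> complex" where
  "right_lim f a = Lim (inf (at_right a) (ae_filter lebesgue)) f"

definition left_lim :: "(real \<Rightarrow> complex) \<Rightarrow> real \<Rightarrow> complex" where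
  "left_lim f a = Lim (inf (at_left a) (ae_filter lebesgue)) f"

lemma right_lim_filter_nontrivial: "inf (at_right (a::real)) (ae_filter lebesgue) \<noteq> bot"
proof
  assume "inf (at_right a) (ae_filter lebesgue) = bot"
  then have "eventually (\<lambda>x. False) (inf (at_right a) (ae_filter lebesgue))" by simp
  then obtain P Q where P: "eventually P (at_right a)" and Q: "eventually Q (ae_filter lebesgue)"
    and PQ: "\<And>x. P x \<and> Q x \<Longrightarrow> False" unfolding eventually_inf by blast
  obtain b where b: "b > a" "\<And>x. a < x \<Longrightarrow> x < b \<Longrightarrow> P x"
    using P unfolding eventually_at_right_field by blast
  obtain N where N: "negligible N" "{x. \<not> Q x} \<subseteq> N"
    using Q unfolding eventually_ae_filter_negligible by blast
  have "{a<..<b} \<subseteq> N" using b PQ N(2) by force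
  then have "negligible {a<..<b}" using N(1) negligible_subset by blast
  then show False using b(1) open_not_negligible[of "{a<..<b}"] by auto
qed

lemma left_lim_filter_nontrivial: "inf (at_left (a::real)) (ae_filter lebesgue) \<noteq> bot"
proof
  assume "inf (at_left a) (ae_filter lebesgue) = bot"
  then have "eventually (\<lambda>x. False) (inf (at_left a) (ae_filter lebesgue))" by simp
  then obtain P Q where P: "eventually P (at_left a)" and Q: "eventually Q (ae_filter lebesgue)"
    and PQ: "\<And>x. P x \<and> Q x \<Longrightarrow> False" unfolding eventually_inf by blast
  obtain b where b: "b < a" "\<And>x. b < x \<Longrightarrow> x < a \<Longrightarrow> P x"
    using P unfolding eventually_at_left_field by blast
  obtain N where N: "negligible N" "{x. \<not> Q x} \<subseteq> N"
    using Q unfolding eventually_ae_filter_negligible by blast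
  have "{b<..<a} \<subseteq> N" using b PQ N(2) by force
  then have "negligible {b<..<a}" using N(1) negligible_subset by blast
  then show False using b(1) open_not_negligible[of "{b<..<a}"] by auto
qed

lemma right_lim_eqI: "(f \<longlongrightarrow> l) (at_right a) \<Longrightarrow> right_lim f a = l"
  unfolding right_lim_def
  by (intro tendsto_Lim right_lim_filter_nontrivial) (rule tendsto_mono[OF inf_le1])

lemma left_lim_eqI: "(f \<longlongrightarrow> l) (at_left a) \<Longrightarrow> left_lim f a = l"
  unfolding left_lim_def
  by (intro tendsto_Lim left_lim_filter_nontrivial) (rule tendsto_mono[OF inf_le1])

section \<open>The data\<close>

definition admissible_initial :: "real \<Rightarrow> (real \<Rightarrow> complex) \<Rightarrow> bool" where
  "admissible_initial l qo \<longleftrightarrow>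
     L2_on {0<..} qo \<and>
     set_integrable lebesgue {0<..} (\<lambda>x. (1 + \<bar>x\<bar>) powr l *\<^sub>R qo x) \<and>
     (\<exists>(M::nat) xs::nat \<Rightarrow> real. xs 0 = 0 \<and> (\<forall>i<M. xs i < xs (Suc i)) \<and>
        (\<forall>i<M. H1_on {xs i<..<xs (Suc i)} qo) \<and> H1_on {xs M<..} qo \<and>
        (\<forall>i\<in>{1..M}. right_lim qo (xs i) \<noteq> left_lim qo (xs i)))"

definition admissible_boundary :: "real \<Rightarrow> (real \<Rightarrow> complex) \<Rightarrow> bool" where
  "admissible_boundary T g0 \<longleftrightarrow>
     (\<exists>(K::nat) ts::nat \<Rightarrow> real. ts 0 = 0 \<and> ts (Suc K) = T \<and> (\<forall>i\<le>K. ts i < ts (Suc i)) \<and>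
        (\<forall>i\<le>K. H1_on {ts i<..<ts (Suc i)} g0))"

section \<open>Weak and \<open>L\<^sup>2\<close> solutions\<close>

text \<open>
  A smooth, compactly supported test function on \<open>\<Omega>\<close> is given together with all of its partial
  derivatives: \<open>D i j\<close> is \<open>\<partial>\<^sub>x\<^sup>i \<partial>\<^sub>t\<^sup>j\<close> of the test function \<open>D 0 0\<close>.
\<close>

definition Cinf_test :: "(real \<times> real) set \<Rightarrow> (nat \<Rightarrow> nat \<Rightarrow> real \<Rightarrow> real \<Rightarrow> complex) \<Rightarrow> bool" where
  "Cinf_test \<Omega> D \<longleftrightarrow>
     (\<forall>i j. continuous_on UNIV (\<lambda>z. D i j (fst z) (snd z))) \<and>
     (\<forall>i j x t. ((\<lambda>y. D i j y t) has_vector_derivative D (Suc i) j x t) (at x)) \<and>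
     (\<forall>i j x t. ((\<lambda>s. D i j x s) has_vector_derivative D i (Suc j) x t) (at t)) \<and>
     (\<exists>C\<subseteq>\<Omega>. compact C \<and> (\<forall>x t. (x, t) \<notin> C \<longrightarrow> D 0 0 x t = 0))"

text \<open>Weak (distributional) solutions of \<open>i q\<^sub>t + q\<^sub>x\<^sub>x = 0\<close> in \<open>\<Omega>\<close>.\<close>

definition weak_solution :: "(real \<times> real) set \<Rightarrow> (real \<Rightarrow> real \<Rightarrow> complex) \<Rightarrow> bool" where
  "weak_solution \<Omega> q \<longleftrightarrow>
     set_borel_measurable lebesgue \<Omega> (\<lambda>z. q (fst z) (snd z)) \<and>
     (\<forall>C\<subseteq>\<Omega>. compact C \<longrightarrow> set_integrable lebesgue C (\<lambda>z. q (fst z) (snd z))) \<and>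
     (\<forall>D. Cinf_test \<Omega> D \<longrightarrow>
        (LINT z:\<Omega>|lebesgue. q (fst z) (snd z) *
           (- \<i> * D 0 1 (fst z) (snd z) + D 2 0 (fst z) (snd z))) = 0)"

definition L2_solution ::
    "real \<Rightarrow> (real \<Rightarrow> complex) \<Rightarrow> (real \<Rightarrow> complex) \<Rightarrow> (real \<Rightarrow> real \<Rightarrow> complex) \<Rightarrow> bool" where
  "L2_solution T qo g0 q \<longleftrightarrow>
     weak_solution ({0<..} \<times> {0<..<T}) q \<and>
     (\<forall>t\<in>{0..T}. L2_on {0<..} (\<lambda>x. q x t)) \<and>
     (\<forall>t\<^sub>0\<in>{0..T}. ((\<lambda>t. L2_norm_sq {0<..} (\<lambda>x. q x t - q x t\<^sub>0)) \<longlongrightarrow> 0) (at t\<^sub>0 within {0..T})) \<and>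
     (AE x in lebesgue. 0 < x \<longrightarrow> q x 0 = qo x) \<and>
     (\<forall>x\<in>{0..}. Hs_on (1/4) {0<..<T} (\<lambda>t. q x t)) \<and>
     (\<forall>x\<^sub>0\<in>{0..}. ((\<lambda>x. Hs_norm_sq (1/4) {0<..<T} (\<lambda>t. q x t - q x\<^sub>0 t)) \<longlongrightarrow> 0) (at x\<^sub>0 within {0..})) \<and>
     (AE t in lebesgue. 0 < t \<and> t < T \<longrightarrow> q 0 t = g0 t)"

section \<open>The solution formula and the special function\<close>

definition half_line_FT :: "(real \<Rightarrow> complex) \<Rightarrow> complex \<Rightarrow> complex" where
  "half_line_FT qo k = (LINT x:{0<..}|lebesgue. exp (- \<i> * k * of_real x) * qo x)"

definition time_transform :: "(real \<Rightarrow> complex) \<Rightarrow> complex \<Rightarrow> real \<Rightarrow> complex" where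
  "time_transform g0 \<kappa> t = (LINT s:{0<..<t}|lebesgue. exp (- \<i> * \<kappa> * of_real s) * g0 s)"

text \<open>
  The integral along the unbounded contour whose part in the disc of radius \<open>r\<close> is \<open>\<gamma> r\<close>.
\<close>

definition improper_contour_integral :: "(real \<Rightarrow> real \<Rightarrow> complex) \<Rightarrow> (complex \<Rightarrow> complex) \<Rightarrow> complex" where
  "improper_contour_integral \<gamma> f = Lim at_top (\<lambda>r. contour_integral (\<gamma> r) f)"

definition real_line :: "real \<Rightarrow> real \<Rightarrow> complex" where
  "real_line r = linepath (- of_real r) (of_real r)"

text \<open>
  For \<open>\<omega>(k) = k\<^sup>2\<close> the region \<open>D\<^sup>+\<close> is the first quadrant, and removing \<open>{|k| < R}\<close> replaces the
  corner of its boundary by a clockwise quarter circle from \<open>i R\<close> to \<open>R\<close>.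
\<close>

definition bdry_D :: "real \<Rightarrow> real \<Rightarrow> complex" where
  "bdry_D r = linepath (\<i> * of_real r) 0 +++ linepath 0 (of_real r)"

definition bdry_D1 :: "real \<Rightarrow> real \<Rightarrow> real \<Rightarrow> complex" where
  "bdry_D1 R r = linepath (\<i> * of_real r) (\<i> * of_real R) +++
     part_circlepath 0 R (pi / 2) 0 +++ linepath (of_real R) (of_real r)"

definition solution_formula ::
    "(real \<Rightarrow> complex) \<Rightarrow> (real \<Rightarrow> complex) \<Rightarrow> real \<Rightarrow> real \<Rightarrow> complex" where
  "solution_formula qo g0 x t =
     1 / (2 * of_real pi) * improper_contour_integral real_line
       (\<lambda>k. exp (\<i> * k * of_real x - \<i> * k\<^sup>2 * of_real t) * half_line_FT qo k) +
     1 / (2 * of_real pi) * improper_contour_integral bdry_D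
       (\<lambda>k. exp (\<i> * k * of_real x - \<i> * k\<^sup>2 * of_real t) *
          (2 * k * time_transform g0 (- k\<^sup>2) t - half_line_FT qo (- k)))"

text \<open>The function \<open>I\<^bsub>\<omega>,0,1\<^esub>\<close> for \<open>\<omega>(k) = k\<^sup>2\<close>.\<close>

definition I_special :: "real \<Rightarrow> real \<Rightarrow> real \<Rightarrow> complex" where
  "I_special R x t = 1 / (2 * of_real pi) * improper_contour_integral (bdry_D1 R)
     (\<lambda>k. exp (\<i> * k * of_real x - \<i> * k\<^sup>2 * of_real t) / (\<i> * k))"

definition q_loc ::
    "real \<Rightarrow> (real \<Rightarrow> complex) \<Rightarrow> (real \<Rightarrow> complex) \<Rightarrow> real \<Rightarrow> real \<Rightarrow> complex" where
  "q_loc R qo g0 x t =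
     - 2 * right_lim g0 0 * I_special R x t + 2 * right_lim qo 0 * (I_special R x t + 1 / 2)"

end

theory Submission
  imports Defs "HOL-Probability.Sinc_Integral" "HOL-Real_Asymp.Real_Asymp"
begin

text \<open>In physical space the solution formula is explicit, and the estimate becomes an integration by
  parts. Let \<open>K(t, z)\<close> be the free propagator of the equation (\<open>propagator\<close>) and \<open>\<Phi>(t, \<sqdot>)\<close> its
  primitive in space that vanishes at \<open>0\<close> (\<open>Phi\<close>); it is a Fresnel integral of \<open>a / (2 \<surd>t)\<close>. Three
  identities carry the proof.

  \<^item> The special function is \<open>I(x, t) = \<Phi>(t, x) - 1/2\<close> (\<open>I_special_eq\<close>).
  \<^item> The integrals that contain the initial datum combine to
    \<open>- \<integral> q\<^sub>o(y) (K(t, y + x) - K(t, y - x)) dy\<close>, and the kernel is the \<open>y\<close>-derivative of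
    \<open>S(y) = \<Phi>(t, y + x) - \<Phi>(t, y - x)\<close>.
  \<^item> The integral that contains the boundary datum is
    \<open>- 2 g\<^sub>0(0) I(x, t) - 2 \<integral> I(x, t - s) g\<^sub>0'(s) ds\<close> over \<open>0 < s < t\<close>; the last two are
    \<open>solution_formula_eq\<close>.

  Integrating by parts against \<open>S\<close> on every piece on which \<open>q\<^sub>o\<close> is in \<open>H\<^sup>1\<close> gives the boundary term
  \<open>q\<^sub>o(0) S(0) = 2 q\<^sub>o(0) \<Phi>(t, x) = 2 q\<^sub>o(0) (I + 1/2)\<close> at \<open>y = 0\<close>. Together with \<open>- 2 g\<^sub>0(0) I\<close> this is
  exactly \<open>q\<^sub>l\<^sub>o\<^sub>c\<close>. What remains is small. The function \<open>S\<close> is bounded, and \<open>S(y) = O(\<surd>t / (y - x))\<close> for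
  \<open>y > x\<close> because \<open>\<Phi>(t, \<sqdot>)\<close> approaches its limit at that rate. So the jumps at \<open>x\<^sub>j > 0\<close> contribute
  \<open>O(\<surd>t)\<close>, and \<open>\<parallel>S\<parallel>\<^sup>2 = O(x + \<surd>t)\<close> in \<open>L\<^sup>2\<close>, whence \<open>\<integral> q\<^sub>o' S = O((x + \<surd>t)\<^sup>1\<^sup>/\<^sup>2)\<close>
  (\<open>reflected_Phi_pairing\<close>); this is where the exponents \<open>1/2\<close> and \<open>1/4\<close> come from. The remaining time
  integral is \<open>O(\<surd>t)\<close> since \<open>I\<close> is bounded and \<open>g\<^sub>0'\<close> is square integrable.

  The improper contour integrals are limits of truncated ones. Completing the square expresses the
  latter by the Fresnel function \<open>F\<close>, and one asymptotic estimate of \<open>F\<close> in a closed quadrant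
  (\<open>fresnel_quadrant2\<close>) yields the limit for both contours as well as the domination needed
  to pass to the limit under the integrals over the data. The constant \<open>- 1/2\<close> comes from the Dirichlet
  integral. For the boundary datum the limit cannot be taken before an integration by parts in time, and
  it is justified by a bound for the truncated special function that is uniform down to time \<open>0\<close>
  (\<open>special_cutoff_bounded_in_time\<close>).\<close>

section \<open>The Fresnel function in a quadrant\<close>

definition fresnel :: "complex \<Rightarrow> complex" where
  "fresnel z = contour_integral (linepath 0 z) (\<lambda>u. exp (- \<i> * u\<^sup>2))"

lemma has_field_derivative_fresnel:
  "(fresnel has_field_derivative exp (- \<i> * z\<^sup>2)) (at z within S)"
proof -
  have "(\<lambda>u. exp (- \<i> * u\<^sup>2)) holomorphic_on UNIV" by (intro holomorphic_intros)
  then obtain g where g: "\<And>z. (g has_field_derivative exp (- \<i> * z\<^sup>2)) (at z)"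
    using holomorphic_convex_primitive'[of UNIV "\<lambda>u. exp (- \<i> * u\<^sup>2)"] by auto
  have "fresnel z = g z - g 0" for z
    unfolding fresnel_def
    using contour_integral_primitive[of UNIV g "\<lambda>u. exp (- \<i> * u\<^sup>2)" "linepath 0 z"] g
    by (intro contour_integral_unique) auto
  then have "fresnel = (\<lambda>z. g z - g 0)" by auto
  moreover have "((\<lambda>z. g z - g 0) has_field_derivative exp (- \<i> * z\<^sup>2)) (at z)"
    using DERIV_diff[OF g DERIV_const] by simp
  ultimately show ?thesis by (simp add: DERIV_subset[of _ _ _ UNIV])
qed

lemma fresnel_0 [simp]: "fresnel 0 = 0"
  by (simp add: fresnel_def)

lemma continuous_on_fresnel [continuous_intros]:
  "continuous_on S f \<Longrightarrow> continuous_on S (\<lambda>x. fresnel (f x))"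
proof -
  have "continuous_on UNIV fresnel"
    by (meson DERIV_continuous continuous_on_eq_continuous_within has_field_derivative_fresnel)
  then show "continuous_on S f \<Longrightarrow> continuous_on S (\<lambda>x. fresnel (f x))"
    by (rule continuous_on_compose2) auto
qed

lemma fresnel_minus: "fresnel (- z) = - fresnel z"
proof -
  have "((\<lambda>z. fresnel (- z) + fresnel z) has_field_derivative 0) (at z within UNIV)" for z
    by (auto intro!: derivative_eq_intros DERIV_chain'[where g=fresnel] has_field_derivative_fresnel)
  then obtain c where "\<And>z. fresnel (- z) + fresnel z = c"
    using has_field_derivative_zero_constant[of UNIV "\<lambda>z. fresnel (- z) + fresnel z"] by auto
  from this[of z] this[of 0] show ?thesis by (simp add: add_eq_0_iff2)
qed

text \<open>After completing the square, the end points of the truncated contours lie in this closed quadrant or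
  in its reflection at the origin. There \<open>exp (-i z\<^sup>2)\<close> is bounded by \<open>1\<close>, because the real part of
  \<open>-i z\<^sup>2\<close> is \<open>2 Re z Im z\<close>.\<close>

definition quadrant2 :: "complex set" where
  "quadrant2 = {z. Re z \<le> 0 \<and> Im z \<ge> 0}"

lemma norm_exp_quadrant2: "z \<in> quadrant2 \<Longrightarrow> norm (exp (- \<i> * z\<^sup>2)) \<le> 1"
  by (auto simp: quadrant2_def norm_exp_eq_Re power2_eq_square mult_le_0_iff mult_nonpos_nonneg mult_nonneg_nonpos)

lemma convex_quadrant2: "convex quadrant2"
  by (auto simp: quadrant2_def convex_def add_nonpos_nonpos mult_nonneg_nonpos)

text \<open>Subtracting the leading term of the expansion at infinity leaves a function whose derivative is
  \<open>O(1 / |z|\<^sup>2)\<close> in the quadrant, hence integrable at infinity.\<close>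

definition fresnel_reg :: "complex \<Rightarrow> complex" where
  "fresnel_reg z = fresnel z - \<i> / (2 * z) * exp (- \<i> * z\<^sup>2)"

lemma has_field_derivative_fresnel_reg:
  assumes "z \<noteq> 0"
  shows "(fresnel_reg has_field_derivative \<i> / (2 * z\<^sup>2) * exp (- \<i> * z\<^sup>2)) (at z within S)"
  unfolding fresnel_reg_def [abs_def]
  using assms
  by (auto intro!: derivative_eq_intros has_field_derivative_fresnel simp: field_simps power2_eq_square)

lemma norm_fresnel_reg_deriv:
  assumes "z \<in> quadrant2" "z \<noteq> 0"
  shows "norm (\<i> / (2 * z\<^sup>2) * exp (- \<i> * z\<^sup>2)) \<le> 1 / (2 * (norm z)\<^sup>2)"
proof -
  have "norm (\<i> / (2 * z\<^sup>2) * exp (- \<i> * z\<^sup>2)) = 1 / (2 * (norm z)\<^sup>2) * norm (exp (- \<i> * z\<^sup>2))"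
    by (simp only: norm_mult norm_divide norm_power) simp
  also have "\<dots> \<le> 1 / (2 * (norm z)\<^sup>2) * 1"
    by (intro mult_left_mono norm_exp_quadrant2 assms) auto
  finally show ?thesis by simp
qed

text \<open>The extreme case is the chord of a quarter circle, whose midpoint has squared norm \<open>s\<^sup>2 / 2\<close>.\<close>

lemma norm_chord_ge:
  fixes z w :: complex
  assumes "norm z = s" "norm w = s" "z \<bullet> w \<ge> 0" "k \<in> closed_segment z w"
  shows "(norm k)\<^sup>2 \<ge> s\<^sup>2 / 2"
proof -
  obtain u where u: "k = (1 - u) *\<^sub>R z + u *\<^sub>R w" "0 \<le> u" "u \<le> 1"
    using assms(4) by (auto simp: in_segment)
  have "(norm k)\<^sup>2 = (1 - u)\<^sup>2 * (z \<bullet> z) + u\<^sup>2 * (w \<bullet> w) + 2 * (u * (1 - u)) * (z \<bullet> w)"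
    unfolding u(1) power2_norm_eq_inner
    by (simp add: inner_add_left inner_add_right power2_eq_square algebra_simps inner_commute)
  moreover have "z \<bullet> z = s\<^sup>2" "w \<bullet> w = s\<^sup>2" using assms by (auto simp: power2_norm_eq_inner[symmetric])
  moreover have "2 * (u * (1 - u)) * (z \<bullet> w) \<ge> 0" using u assms by auto
  moreover have "((1 - u)\<^sup>2 + u\<^sup>2) * s\<^sup>2 \<ge> 1/2 * s\<^sup>2"
    by (intro mult_right_mono) (use zero_le_power2[of "2*u-1"] in \<open>auto simp: power2_eq_square algebra_simps\<close>)
  ultimately show ?thesis by (simp add: algebra_simps)
qed

lemma fresnel_reg_chord:
  assumes "z \<in> quadrant2" "z \<noteq> 0"
  shows "norm (fresnel_reg z - fresnel_reg (- of_real (norm z))) \<le> 2 / norm z"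
proof -
  let ?s = "norm z" and ?w = "- of_real (norm z) :: complex"
  have s: "?s > 0" using assms by auto
  have w: "?w \<in> quadrant2" by (auto simp: quadrant2_def)
  have in2: "k \<in> quadrant2" if "k \<in> closed_segment ?w z" for k
    using closed_segment_subset[OF w assms(1) convex_quadrant2] that by auto
  have ge: "(norm k)\<^sup>2 \<ge> ?s\<^sup>2 / 2" if "k \<in> closed_segment ?w z" for k
    using that assms by (intro norm_chord_ge[of ?w _ z]) (auto simp: inner_complex_def quadrant2_def mult_nonneg_nonpos mult_nonneg_nonneg mult_le_0_iff)
  have nz: "k \<noteq> 0" if "k \<in> closed_segment ?w z" for k
    using ge[OF that] s by auto
  have "norm (fresnel_reg z - fresnel_reg ?w) \<le> 1 / ?s\<^sup>2 * norm (z - ?w)"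
  proof (rule field_differentiable_bound[where S = "closed_segment ?w z"])
    fix k assume k: "k \<in> closed_segment ?w z"
    show "(fresnel_reg has_field_derivative \<i> / (2 * k\<^sup>2) * exp (- \<i> * k\<^sup>2)) (at k within closed_segment ?w z)"
      by (rule has_field_derivative_fresnel_reg[OF nz[OF k]])
    have "norm (\<i> / (2 * k\<^sup>2) * exp (- \<i> * k\<^sup>2)) \<le> 1 / (2 * (norm k)\<^sup>2)"
      by (rule norm_fresnel_reg_deriv[OF in2[OF k] nz[OF k]])
    also have "\<dots> \<le> 1 / ?s\<^sup>2"
      using ge[OF k] s nz[OF k] by (intro divide_left_mono) auto
    finally show "norm (\<i> / (2 * k\<^sup>2) * exp (- \<i> * k\<^sup>2)) \<le> 1 / ?s\<^sup>2" .
  qed auto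
  also have "norm (z - ?w) \<le> 2 * ?s" using norm_triangle_ineq4[of z ?w] by simp
  then have "1 / ?s\<^sup>2 * norm (z - ?w) \<le> 1 / ?s\<^sup>2 * (2 * ?s)" by (intro mult_left_mono) auto
  also have "\<dots> = 2 / ?s" using s by (simp add: power2_eq_square)
  finally show ?thesis .
qed

lemma fresnel_reg_ray:
  fixes u v :: real
  assumes "0 < u" "u \<le> v"
  shows "norm (fresnel_reg (- of_real v) - fresnel_reg (- of_real u)) \<le> 1 / (2 * u)"
proof (cases "u = v")
  case False
  then have uv: "u < v" using assms by auto
  let ?f' = "\<lambda>s::real. - (\<i> / (2 * (- of_real s)\<^sup>2) * exp (- \<i> * (- of_real s)\<^sup>2))"
  have d: "((\<lambda>s. fresnel_reg (- of_real s)) has_vector_derivative ?f' s) (at s)" if "s > 0" for s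
  proof (rule has_vector_derivative_real_field)
    show "((\<lambda>a. fresnel_reg (- a)) has_field_derivative ?f' s) (at (of_real s))"
      using DERIV_chain'[OF DERIV_minus[OF DERIV_ident] has_field_derivative_fresnel_reg[of "- of_real s"]] that
      by simp
  qed
  have "norm (fresnel_reg (- of_real v) - fresnel_reg (- of_real u)) \<le> (- 1 / (2 * v)) - (- 1 / (2 * u))"
  proof (rule differentiable_bound_general[OF uv, where f' = ?f' and \<phi> = "\<lambda>s. - 1 / (2 * s)" and \<phi>' = "\<lambda>s. 1 / (2 * s\<^sup>2)"])
    show "continuous_on {u..v} (\<lambda>s. fresnel_reg (- of_real s))"
      by (intro continuous_at_imp_continuous_on ballI has_vector_derivative_continuous[OF d]) (use assms in auto)
    show "continuous_on {u..v} (\<lambda>s. - 1 / (2 * s))"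
      using assms by (intro continuous_intros) auto
    fix s assume s: "u < s" "s < v"
    then have s0: "s > 0" using assms by auto
    show "((\<lambda>s. fresnel_reg (- of_real s)) has_vector_derivative ?f' s) (at s)" by (rule d[OF s0])
    show "((\<lambda>s. - 1 / (2 * s)) has_vector_derivative 1 / (2 * s\<^sup>2)) (at s)"
      unfolding has_real_derivative_iff_has_vector_derivative[symmetric]
      using s0 by (auto intro!: derivative_eq_intros simp: field_simps power2_eq_square)
    show "norm (?f' s) \<le> 1 / (2 * s\<^sup>2)"
      using norm_fresnel_reg_deriv[of "- of_real s"] s0 by (simp add: quadrant2_def)
  qed
  also have "\<dots> \<le> 1 / (2 * u)" using assms by simp
  finally show ?thesis .
qed (use assms in auto)

text \<open>Along the negative real axis the regularised function is Cauchy, and a chord inside the quadrant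
  carries the limit to all other directions at a cost of \<open>2 / |z|\<close>. The point is that a single constant
  serves the real and the imaginary axis: it makes the two contours of the solution formula produce the
  same propagator.\<close>

lemma fresnel_limit_exists: "\<exists>L. \<forall>z\<in>quadrant2 - {0}. norm (fresnel z + L) \<le> 3 / norm z"
proof -
  define X where "X n = fresnel_reg (- of_real (real (Suc n)))" for n
  have "Cauchy X"
  proof (rule CauchyI')
    fix e :: real assume "e > 0"
    then obtain N where N: "inverse (real (Suc N)) < e" using reals_Archimedean by blast
    have "norm (X m - X n) < e" if "m \<ge> N" "n > m" for m n
    proof -
      have "norm (X n - X m) \<le> 1 / (2 * real (Suc m))"
        unfolding X_def using that by (intro fresnel_reg_ray) auto
      also have "\<dots> \<le> inverse (real (Suc N))" using that by (simp add: field_simps)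
      finally show ?thesis using N by (simp add: norm_minus_commute)
    qed
    then show "\<exists>M. \<forall>m\<ge>M. \<forall>n>m. dist (X m) (X n) < e" by (auto simp: dist_norm)
  qed
  then obtain L where L: "X \<longlonglongrightarrow> L" using Cauchy_convergent convergentD by blast
  have ray: "norm (fresnel_reg (- of_real s) - L) \<le> 1 / (2 * s)" if s: "s > 0" for s :: real
  proof -
    have "(\<lambda>n. norm (X n - fresnel_reg (- of_real s))) \<longlonglongrightarrow> norm (L - fresnel_reg (- of_real s))"
      by (intro tendsto_intros L)
    moreover have "\<forall>\<^sub>F n in sequentially. norm (X n - fresnel_reg (- of_real s)) \<le> 1 / (2 * s)"
      using eventually_ge_at_top[of "nat \<lceil>s\<rceil>"]
    proof eventually_elim
      case (elim n)
      then have "s \<le> real (Suc n)" by linarith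
      then show ?case unfolding X_def using s by (intro fresnel_reg_ray)
    qed
    ultimately have "norm (L - fresnel_reg (- of_real s)) \<le> 1 / (2 * s)"
      using tendsto_upperbound sequentially_bot by blast
    then show ?thesis by (simp add: norm_minus_commute)
  qed
  have "norm (fresnel z + - L) \<le> 3 / norm z" if z: "z \<in> quadrant2" "z \<noteq> 0" for z
  proof -
    have n: "norm z > 0" using z by auto
    have eq: "fresnel z + - L = (fresnel_reg z - fresnel_reg (- of_real (norm z)))
        + (fresnel_reg (- of_real (norm z)) - L) + \<i> / (2 * z) * exp (- \<i> * z\<^sup>2)"
      by (simp add: fresnel_reg_def[of z])
    have "norm (\<i> / (2 * z) * exp (- \<i> * z\<^sup>2)) \<le> 1 / (2 * norm z) * 1"
      unfolding norm_mult norm_divide using norm_exp_quadrant2[OF z(1)] n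
      by (intro mult_mono) auto
    then have "norm (fresnel z + - L) \<le> 2 / norm z + 1 / (2 * norm z) + 1 / (2 * norm z) * 1"
      unfolding eq by (intro norm_triangle_mono fresnel_reg_chord[OF z] ray n)
    also have "\<dots> = 3 / norm z" using n by (simp add: field_simps)
    finally show ?thesis .
  qed
  then show ?thesis by blast
qed

definition fresnel_limit :: complex where
  "fresnel_limit = (SOME L. \<forall>z\<in>quadrant2 - {0}. norm (fresnel z + L) \<le> 3 / norm z)"

lemma fresnel_quadrant2:
  "z \<in> quadrant2 \<Longrightarrow> z \<noteq> 0 \<Longrightarrow> norm (fresnel z + fresnel_limit) \<le> 3 / norm z"
  using someI_ex[OF fresnel_limit_exists] unfolding fresnel_limit_def by blast

lemma fresnel_pos:
  fixes u :: real
  assumes "u > 0"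
  shows "norm (fresnel (of_real u) - fresnel_limit) \<le> 3 / u"
proof -
  have "norm (- (fresnel (of_real u) - fresnel_limit)) \<le> 3 / u"
    using fresnel_quadrant2[of "- of_real u"] assms by (simp add: quadrant2_def fresnel_minus)
  then show ?thesis by (simp only: norm_minus_cancel)
qed

lemma fresnel_bounded:
  obtains C where "C > 0" "\<And>z. z \<in> quadrant2 \<Longrightarrow> norm (fresnel z) \<le> C"
    "\<And>u::real. norm (fresnel (of_real u)) \<le> C" "norm fresnel_limit \<le> C"
proof -
  have "compact (fresnel ` cball 0 1)"
    by (intro compact_continuous_image continuous_on_fresnel continuous_on_id compact_cball)
  then obtain B where B: "\<And>z. norm z \<le> 1 \<Longrightarrow> norm (fresnel z) \<le> B"
    by (meson bounded_iff compact_imp_bounded imageI mem_cball_0)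
  define C where "C = \<bar>B\<bar> + norm fresnel_limit + 4"
  have 1: "norm (fresnel z) \<le> C" if z: "z \<in> quadrant2" for z
  proof (cases "norm z \<le> 1")
    case True
    then have "norm (fresnel z) \<le> B" by (rule B)
    then show ?thesis unfolding C_def using norm_ge_zero[of fresnel_limit] by linarith
  next
    case False
    then have "norm (fresnel z + fresnel_limit) \<le> 3 / norm z" using z by (intro fresnel_quadrant2) auto
    also have "\<dots> \<le> 3" using False by (intro divide_left_mono[of 1 "norm z" 3, simplified]) auto
    finally have "norm (fresnel z) \<le> 3 + norm fresnel_limit"
      using norm_triangle_ineq4[of "fresnel z + fresnel_limit" fresnel_limit] by simp
    then show ?thesis unfolding C_def by simp
  qed
  have 2: "norm (fresnel (of_real u)) \<le> C" for u :: real
  proof (cases "u \<le> 0")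
    case False
    then show ?thesis using 1[of "- of_real u"] by (simp add: quadrant2_def fresnel_minus)
  qed (auto intro: 1 simp: quadrant2_def)
  show ?thesis by (rule that[of C]) (use 1 2 in \<open>auto simp: C_def add_nonneg_pos\<close>)
qed

section \<open>The free propagator as a limit of contour integrals\<close>

abbreviation wave :: "real \<Rightarrow> real \<Rightarrow> complex \<Rightarrow> complex" where
  "wave x t k \<equiv> exp (\<i> * k * of_real x - \<i> * k\<^sup>2 * of_real t)"

text \<open>Completing the square: \<open>i k z - i k\<^sup>2 t = i z\<^sup>2 / (4 t) - i (\<surd>t k - z / (2 \<surd>t))\<^sup>2\<close>.\<close>

definition exp_quadratic_primitive :: "real \<Rightarrow> real \<Rightarrow> complex \<Rightarrow> complex" where
  "exp_quadratic_primitive z t k = exp (\<i> * of_real (z\<^sup>2 / (4 * t))) / of_real (sqrt t) *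
     fresnel (of_real (sqrt t) * k - of_real (z / (2 * sqrt t)))"

lemma has_field_derivative_exp_quadratic_primitive:
  assumes "t > 0"
  shows "(exp_quadratic_primitive z t has_field_derivative
    wave z t k) (at k within S)"
proof -
  define c where "c = complex_of_real (sqrt t)"
  define a where "a = complex_of_real (z / (2 * sqrt t))"
  define A where "A = exp (\<i> * of_real (z\<^sup>2 / (4 * t))) / c"
  have c0: "c \<noteq> 0" using assms by (simp add: c_def)
  have c2: "c\<^sup>2 = of_real t" unfolding c_def using assms by (simp flip: of_real_power)
  have ca: "2 * c * a = of_real z" unfolding c_def a_def using assms by simp
  have a2: "a\<^sup>2 = of_real (z\<^sup>2 / (4 * t))" unfolding a_def using assms
    by (simp add: power_divide power_mult_distrib flip: of_real_power)
  have P: "exp_quadratic_primitive z t = (\<lambda>k. A * fresnel (c * k - a))"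
    unfolding exp_quadratic_primitive_def [abs_def] A_def a_def c_def ..
  have "((\<lambda>k. A * fresnel (c * k - a)) has_field_derivative
      A * (exp (- \<i> * (c * k - a)\<^sup>2) * c)) (at k within S)"
  proof (rule DERIV_cmult)
    have "((\<lambda>k. c * k - a) has_field_derivative c) (at k within S)" by (auto intro!: derivative_eq_intros)
    from DERIV_chain'[OF this has_field_derivative_fresnel[of "c * k - a"]]
    show "((\<lambda>k. fresnel (c * k - a)) has_field_derivative exp (- \<i> * (c * k - a)\<^sup>2) * c) (at k within S)"
      by (simp only: mult.commute)
  qed
  moreover have "A * (exp (- \<i> * (c * k - a)\<^sup>2) * c) = wave z t k"
  proof -
    have "A * (exp (- \<i> * (c * k - a)\<^sup>2) * c) = exp (\<i> * a\<^sup>2) * exp (- \<i> * (c * k - a)\<^sup>2)"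
      using c0 by (simp add: A_def a2)
    also have "\<dots> = exp (\<i> * k * (2 * c * a) - \<i> * k\<^sup>2 * c\<^sup>2)"
      by (simp add: power2_eq_square algebra_simps flip: exp_add)
    finally show ?thesis unfolding ca c2 .
  qed
  ultimately show ?thesis unfolding P by simp
qed

lemma has_contour_integral_exp_quadratic:
  fixes z t :: real
  assumes "t > 0" "valid_path g"
  shows "((\<lambda>k. wave z t k) has_contour_integral
     (exp (\<i> * of_real (z\<^sup>2 / (4 * t))) / of_real (sqrt t) *
      (fresnel (of_real (sqrt t) * pathfinish g - of_real (z / (2 * sqrt t)))
       - fresnel (of_real (sqrt t) * pathstart g - of_real (z / (2 * sqrt t)))))) g"
  using contour_integral_primitive[OF has_field_derivative_exp_quadratic_primitive[OF assms(1), where S = UNIV] assms(2)]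
  by (simp add: exp_quadratic_primitive_def right_diff_distrib)

text \<open>The fundamental solution \<open>exp (i z\<^sup>2 / (4 t)) / \<surd>(4 \<pi> i t)\<close> of \<open>i q\<^sub>t + q\<^sub>x\<^sub>x = 0\<close>.\<close>

definition propagator :: "real \<Rightarrow> real \<Rightarrow> complex" where
  "propagator t z = fresnel_limit / of_real (pi * sqrt t) * exp (\<i> * of_real (z\<^sup>2 / (4 * t)))"

lemma valid_path_bdry_D [simp]: "valid_path (bdry_D r)"
  by (simp add: bdry_D_def valid_path_join)

lemma bdry_D_ends [simp]: "pathstart (bdry_D r) = \<i> * of_real r" "pathfinish (bdry_D r) = of_real r"
  by (simp_all add: bdry_D_def)

text \<open>The error is explicit because it must be uniform in \<open>z\<close> on bounded intervals: below, the approximation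
  is integrated in \<open>z\<close>.\<close>

lemma bdry_D_integral_approx:
  assumes "t > 0" "0 \<le> z" "z < 2 * t * r"
  shows "norm (contour_integral (bdry_D r) (\<lambda>k. wave z t k)
      - 2 * of_real pi * propagator t z) \<le> 6 / (t * r - z / 2)"
proof -
  let ?s = "sqrt t" and ?a = "z / (2 * sqrt t)"
  have s: "?s > 0" "?s * ?s = t" using assms by auto
  have r: "r > 0" using assms by (smt (verit) mult_less_0_iff mult_nonneg_nonpos)
  have "?s * (?s * r - ?a) = t * r - z / 2" using s by (simp add: right_diff_distrib mult.assoc[symmetric])
  then have "?s * (?s * r - ?a) > 0" using assms by simp
  then have pos: "?s * r - ?a > 0" using s by (simp add: zero_less_mult_iff)
  have a: "?a \<ge> 0" using assms by auto
  let ?X = "of_real ?s * of_real r - of_real ?a :: complex"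
  let ?Y = "of_real ?s * (\<i> * of_real r) - of_real ?a :: complex"
  have eX: "?X = of_real (?s * r - ?a)" by simp
  have "norm (fresnel ?X - fresnel_limit) \<le> 3 / (?s * r - ?a)"
    unfolding eX by (intro fresnel_pos pos)
  moreover have "norm (fresnel ?Y + fresnel_limit) \<le> 3 / (?s * r - ?a)"
  proof -
    have Y: "?Y \<in> quadrant2" using a s r by (auto simp: quadrant2_def)
    have "\<bar>Im ?Y\<bar> \<le> norm ?Y" by (rule abs_Im_le_cmod)
    then have n: "?s * r - ?a \<le> norm ?Y" using a s r by simp
    then have "?Y \<noteq> 0" using pos by fastforce
    from fresnel_quadrant2[OF Y this] show ?thesis
      using n pos by (smt (verit) frac_le)
  qed
  ultimately have *: "norm (fresnel ?X - fresnel ?Y - 2 * fresnel_limit) \<le> 3 / (?s * r - ?a) + 3 / (?s * r - ?a)"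
    using norm_triangle_ineq4[of "fresnel ?X - fresnel_limit" "fresnel ?Y + fresnel_limit"]
    by (simp add: algebra_simps)
  let ?A = "exp (\<i> * of_real (z\<^sup>2 / (4 * t))) / of_real ?s"
  have "contour_integral (bdry_D r) (\<lambda>k. wave z t k)
      = ?A * (fresnel ?X - fresnel ?Y)"
    using contour_integral_unique[OF has_contour_integral_exp_quadratic[OF assms(1) valid_path_bdry_D]] by simp
  moreover have "2 * of_real pi * propagator t z = ?A * (2 * fresnel_limit)"
    by (simp add: propagator_def)
  ultimately have "contour_integral (bdry_D r) (\<lambda>k. wave z t k)
      - 2 * of_real pi * propagator t z = ?A * (fresnel ?X - fresnel ?Y - 2 * fresnel_limit)"
    by (simp only: right_diff_distrib)
  moreover have "norm ?A = 1 / ?s"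
    unfolding norm_divide norm_exp_i_times using s by simp
  ultimately have "norm (contour_integral (bdry_D r) (\<lambda>k. wave z t k)
      - 2 * of_real pi * propagator t z) \<le> 1 / ?s * (3 / (?s * r - ?a) + 3 / (?s * r - ?a))"
    unfolding norm_mult[of ?A] using * s by (simp only: norm_mult[of ?A]) (intro mult_left_mono, auto)
  also have "\<dots> = 6 / (?s * (?s * r - ?a))" by simp
  also have "?s * (?s * r - ?a) = t * r - z / 2" using s by (simp add: field_simps)
  finally show ?thesis .
qed

lemma bdry_D_integral_tendsto:
  assumes "t > 0" "0 \<le> z"
  shows "((\<lambda>r. contour_integral (bdry_D r) (\<lambda>k. wave z t k))
      \<longlongrightarrow> 2 * of_real pi * propagator t z) at_top"
proof (rule Lim_null[THEN iffD2], rule Lim_null_comparison)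
  show "\<forall>\<^sub>F r in at_top. norm (contour_integral (bdry_D r) (\<lambda>k. wave z t k)
      - 2 * of_real pi * propagator t z) \<le> 6 / (t * r - z / 2)"
    using eventually_gt_at_top[of "z / (2 * t)"]
    by eventually_elim (rule bdry_D_integral_approx, use assms in \<open>auto simp: field_simps\<close>)
  show "((\<lambda>r. 6 / (t * r - z / 2)) \<longlongrightarrow> 0) at_top"
    using assms by real_asymp
qed

lemma real_line_ends [simp]: "pathstart (real_line r) = - of_real r" "pathfinish (real_line r) = of_real r"
  "valid_path (real_line r)"
  by (simp_all add: real_line_def)

lemma real_line_integral_tendsto:
  assumes "t > 0"
  shows "((\<lambda>r. contour_integral (real_line r) (\<lambda>k. wave z t k))
      \<longlongrightarrow> 2 * of_real pi * propagator t z) at_top"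
proof -
  let ?s = "sqrt t" and ?a = "z / (2 * sqrt t)"
  have s: "?s > 0" using assms by auto
  have lim: "((\<lambda>u::real. fresnel (of_real u)) \<longlongrightarrow> fresnel_limit) at_top"
  proof (rule Lim_null[THEN iffD2], rule Lim_null_comparison)
    show "\<forall>\<^sub>F u::real in at_top. norm (fresnel (of_real u) - fresnel_limit) \<le> 3 / u"
      using eventually_gt_at_top[of 0] by eventually_elim (rule fresnel_pos)
    show "((\<lambda>u::real. 3 / u) \<longlongrightarrow> 0) at_top" by real_asymp
  qed
  have 1: "filterlim (\<lambda>r. ?s * r - ?a) at_top at_top" using s by real_asymp
  have 2: "filterlim (\<lambda>r. ?s * r + ?a) at_top at_top" using s by real_asymp
  have eq: "contour_integral (real_line r) (\<lambda>k. wave z t k)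
     = exp (\<i> * of_real (z\<^sup>2 / (4 * t))) / of_real ?s *
       (fresnel (of_real (?s * r - ?a)) + fresnel (of_real (?s * r + ?a)))" for r
  proof -
    have "complex_of_real ?s * - of_real r - of_real ?a = - of_real (?s * r + ?a)" by simp
    then have "fresnel (of_real ?s * - of_real r - of_real ?a) = - fresnel (of_real (?s * r + ?a))"
      by (simp only: fresnel_minus)
    then show ?thesis
      using contour_integral_unique[OF has_contour_integral_exp_quadratic[OF assms, of "real_line r" z]] by simp
  qed
  have "((\<lambda>r. contour_integral (real_line r) (\<lambda>k. wave z t k))
      \<longlongrightarrow> exp (\<i> * of_real (z\<^sup>2 / (4 * t))) / of_real ?s * (fresnel_limit + fresnel_limit)) at_top"
    unfolding eq by (intro tendsto_intros filterlim_compose[OF lim 1] filterlim_compose[OF lim 2])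
  also have "exp (\<i> * of_real (z\<^sup>2 / (4 * t))) / of_real ?s * (fresnel_limit + fresnel_limit) = 2 * of_real pi * propagator t z"
    by (simp add: propagator_def)
  finally show ?thesis .
qed

text \<open>A bound independent of the truncation, for dominated convergence in the integrals over the data.\<close>

lemma exp_quadratic_integral_bounded:
  assumes "t > 0"
  obtains B where "\<And>r z. norm (contour_integral (real_line r) (\<lambda>k. wave z t k)) \<le> B"
    "\<And>r z. 0 \<le> r \<Longrightarrow> 0 \<le> z \<Longrightarrow> norm (contour_integral (bdry_D r) (\<lambda>k. wave z t k)) \<le> B"
proof -
  obtain C where C: "C > 0" "\<And>z. z \<in> quadrant2 \<Longrightarrow> norm (fresnel z) \<le> C"
    "\<And>u::real. norm (fresnel (of_real u)) \<le> C" using fresnel_bounded by metis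
  let ?s = "sqrt t"
  have s: "?s > 0" using assms by auto
  have nA: "norm (exp (\<i> * of_real (z\<^sup>2 / (4 * t))) / of_real ?s * (v - w)) \<le> 1 / ?s * (C + C)"
    if "norm v \<le> C" "norm w \<le> C" for v w and z :: real
  proof -
    have "norm (v - w) \<le> C + C" using that norm_triangle_ineq4[of v w] by linarith
    moreover have "norm (exp (\<i> * of_real (z\<^sup>2 / (4 * t))) / of_real ?s) = 1 / ?s"
      unfolding norm_divide norm_exp_i_times using s by simp
    ultimately show ?thesis unfolding norm_mult using s by (intro mult_mono) auto
  qed
  show ?thesis
  proof (rule that)
    fix r z :: real
    have e: "complex_of_real ?s * of_real r - of_real (z / (2 * ?s)) = of_real (?s * r - z / (2 * ?s))"
      "complex_of_real ?s * - of_real r - of_real (z / (2 * ?s)) = of_real (?s * (- r) - z / (2 * ?s))"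
      by simp_all
    show "norm (contour_integral (real_line r) (\<lambda>k. wave z t k)) \<le> 1 / ?s * (C + C)"
      unfolding contour_integral_unique[OF has_contour_integral_exp_quadratic[OF assms real_line_ends(3)]] real_line_ends e
      by (intro nA C)
    assume rz: "0 \<le> r" "0 \<le> z"
    show "norm (contour_integral (bdry_D r) (\<lambda>k. wave z t k)) \<le> 1 / ?s * (C + C)"
      unfolding contour_integral_unique[OF has_contour_integral_exp_quadratic[OF assms valid_path_bdry_D]] bdry_D_ends e(1)
      by (intro nA C) (use rz s in \<open>auto simp: quadrant2_def\<close>)
  qed
qed

text \<open>The primitive of \<open>propagator t\<close> with value \<open>0\<close> at \<open>0\<close>; the conjugate turns \<open>exp (-i u\<^sup>2)\<close> into
  \<open>exp (i u\<^sup>2)\<close>.\<close>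

definition Phi :: "real \<Rightarrow> real \<Rightarrow> complex" where
  "Phi t a = 2 * fresnel_limit / of_real pi * cnj (fresnel (of_real (a / (2 * sqrt t))))"

lemma has_vector_derivative_Phi:
  assumes "t > 0"
  shows "(Phi t has_vector_derivative propagator t a) (at a within S)"
proof -
  have s: "sqrt t > 0" "sqrt t * sqrt t = t" using assms by auto
  define c where "c = 1 / (2 * sqrt t)"
  have "((\<lambda>a::complex. fresnel (a * of_real c)) has_field_derivative exp (- \<i> * (of_real a * of_real c)\<^sup>2) * of_real c) (at (of_real a) )"
    using DERIV_chain'[OF DERIV_cmult_right[OF DERIV_ident] has_field_derivative_fresnel, of "of_real c" "of_real a" UNIV]
    by (simp add: mult.commute)
  then have "((\<lambda>a::real. fresnel (of_real a * of_real c)) has_vector_derivative exp (- \<i> * (of_real a * of_real c)\<^sup>2) * of_real c) (at a within S)"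
    by (rule has_vector_derivative_at_within[OF has_vector_derivative_real_field])
  then have "((\<lambda>a::real. cnj (fresnel (of_real a * of_real c))) has_vector_derivative cnj (exp (- \<i> * (of_real a * of_real c)\<^sup>2) * of_real c)) (at a within S)"
    by (rule has_vector_derivative_cnj)
  then have "((\<lambda>a::real. 2 * fresnel_limit / of_real pi * cnj (fresnel (of_real a * of_real c))) has_vector_derivative
      2 * fresnel_limit / of_real pi * cnj (exp (- \<i> * (of_real a * of_real c)\<^sup>2) * of_real c)) (at a within S)"
    by (rule has_vector_derivative_mult_right)
  moreover have "(\<lambda>a::real. 2 * fresnel_limit / of_real pi * cnj (fresnel (of_real a * of_real c))) = Phi t"
    by (auto simp: Phi_def c_def)
  moreover have "(of_real a * of_real c :: complex)\<^sup>2 = of_real (a\<^sup>2 / (4 * t))"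
    unfolding c_def using s by (simp add: power2_eq_square power_mult_distrib power_divide flip: of_real_power of_real_mult)
  then have "2 * fresnel_limit / of_real pi * cnj (exp (- \<i> * (of_real a * of_real c)\<^sup>2) * of_real c) = propagator t a"
    by (simp add: propagator_def c_def exp_cnj)
  ultimately show ?thesis by simp
qed

lemma Phi_minus: "Phi t (- a) = - Phi t a"
  by (simp add: Phi_def fresnel_minus)

lemma Phi_0 [simp]: "Phi t 0 = 0"
  by (simp add: Phi_def)

text \<open>Since \<open>Phi t a\<close> depends on \<open>a / (2 * sqrt t)\<close> only, the decay of order \<open>1 / u\<close> of the Fresnel function
  turns into \<open>sqrt t / a\<close>.\<close>

lemma Phi_bounds:
  obtains C L where "C > 0" "\<And>t a. norm (Phi t a) \<le> C"
    "\<And>t a. 0 < t \<Longrightarrow> 0 < a \<Longrightarrow> norm (Phi t a - L) \<le> C * sqrt t / a"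
proof -
  obtain B where B: "B > 0" "\<And>u::real. norm (fresnel (of_real u)) \<le> B" using fresnel_bounded by metis
  define A where "A = norm (2 * fresnel_limit / of_real pi)"
  define C where "C = A * B + 6 * A + 1"
  have A: "A \<ge> 0" by (simp add: A_def)
  have 0: "A * B \<ge> 0" using A B by simp
  show ?thesis
  proof (rule that[of C "2 * fresnel_limit / of_real pi * cnj fresnel_limit"])
    show "C > 0" using 0 A by (simp add: C_def)
    show "norm (Phi t a) \<le> C" for t a
    proof -
      have "norm (Phi t a) \<le> A * B"
        unfolding Phi_def norm_mult[of _ "cnj _"] complex_mod_cnj A_def by (intro mult_left_mono B) auto
      then show ?thesis using A by (simp add: C_def)
    qed
    fix t a :: real assume ta: "0 < t" "0 < a"
    have "norm (Phi t a - 2 * fresnel_limit / of_real pi * cnj fresnel_limit)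
        = A * norm (fresnel (of_real (a / (2 * sqrt t))) - fresnel_limit)"
      unfolding Phi_def right_diff_distrib[symmetric] A_def complex_cnj_diff[symmetric] norm_mult[of _ "cnj _"] complex_mod_cnj ..
    also have "\<dots> \<le> A * (3 / (a / (2 * sqrt t)))"
      using ta A by (intro mult_left_mono fresnel_pos) auto
    also have "\<dots> = 6 * A * (sqrt t / a)" by simp
    also have "\<dots> \<le> C * (sqrt t / a)"
      using ta 0 by (intro mult_right_mono) (auto simp: C_def)
    finally show "norm (Phi t a - 2 * fresnel_limit / of_real pi * cnj fresnel_limit) \<le> C * sqrt t / a" by simp
  qed
qed

section \<open>The truncated special function\<close>

lemma contour_integral_entire_eq:
  assumes "f holomorphic_on UNIV" "valid_path g" "valid_path h"
    "pathstart g = pathstart h" "pathfinish g = pathfinish h"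
  shows "contour_integral g f = contour_integral h f"
proof -
  obtain P where P: "\<And>k. (P has_field_derivative f k) (at k within UNIV)"
    using holomorphic_convex_primitive'[OF _ _ assms(1)] by auto
  show ?thesis
    using contour_integral_unique[OF contour_integral_primitive[OF P assms(2)]]
      contour_integral_unique[OF contour_integral_primitive[OF P assms(3)]] assms(4,5) by simp
qed

lemma has_vector_derivative_contour_integral_linepath:
  fixes f f' :: "real \<Rightarrow> complex \<Rightarrow> complex"
  assumes d: "\<And>s k. k \<in> closed_segment a b \<Longrightarrow> ((\<lambda>s. f s k) has_vector_derivative f' s k) (at s)"
    and cf: "\<And>s. continuous_on (closed_segment a b) (f s)"
    and c: "continuous_on (UNIV \<times> closed_segment a b) (\<lambda>(s, k). f' s k)"
  shows "((\<lambda>s. contour_integral (linepath a b) (f s)) has_vector_derivative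
      contour_integral (linepath a b) (f' s)) (at s)"
proof -
  have eq: "contour_integral (linepath a b) g = integral (cbox 0 1) (\<lambda>u. g (linepath a b u) * (b - a))"
    if "continuous_on (closed_segment a b) g" for g
    using integral_unique[OF has_contour_integral_integral[OF contour_integrable_continuous_linepath[OF that],
        unfolded has_contour_integral_linepath]] by simp
  have lp: "linepath a b u \<in> closed_segment a b" if "u \<in> cbox 0 1" for u
    using that by (metis box_real(2) imageI linepath_image_01)
  have cf': "continuous_on (closed_segment a b) (f' s)" for s
  proof -
    have "continuous_on (closed_segment a b) (\<lambda>k. (\<lambda>(s, k). f' s k) (s, k))"
      by (rule continuous_on_compose2[OF c]) (auto intro!: continuous_on_Pair)
    then show ?thesis by simp
  qed
  have "((\<lambda>s. integral (cbox 0 1) (\<lambda>u. f s (linepath a b u) * (b - a))) has_vector_derivative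
      integral (cbox 0 1) (\<lambda>u. f' s (linepath a b u) * (b - a))) (at s within UNIV)"
  proof (rule leibniz_rule_vector_derivative)
    show "((\<lambda>s. f s (linepath a b u) * (b - a)) has_vector_derivative f' s (linepath a b u) * (b - a)) (at s within UNIV)"
      if "u \<in> cbox 0 1" for s and u :: real
      using d[OF lp[OF that]] by (intro has_vector_derivative_mult_left) auto
    show "(\<lambda>u. f s (linepath a b u) * (b - a)) integrable_on cbox 0 1" for s
      by (intro integrable_continuous continuous_intros continuous_on_compose2[OF cf[of s]]) (use lp in auto)
    show "continuous_on (UNIV \<times> cbox 0 1) (\<lambda>(s, u). f' s (linepath a b u) * (b - a))"
    proof -
      have "continuous_on (UNIV \<times> cbox 0 1) (\<lambda>z. (\<lambda>(s, k). f' s k) (fst z, linepath a b (snd z)))"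
        by (rule continuous_on_compose2[OF c])
           (use lp in \<open>auto intro!: continuous_intros simp: linepath_def\<close>)
      then have "continuous_on (UNIV \<times> cbox 0 1) (\<lambda>z. f' (fst z) (linepath a b (snd z)) * (b - a))"
        by (intro continuous_intros) simp
      then show ?thesis by (simp add: case_prod_beta)
    qed
  qed auto
  then show ?thesis by (simp only: eq[OF cf] eq[OF cf'])
qed

definition special_kernel :: "real \<Rightarrow> real \<Rightarrow> complex \<Rightarrow> complex" where
  "special_kernel x s k = wave x s k / (\<i> * k)"

text \<open>A convex open set that contains all the truncated contours and on which the kernel is holomorphic;
  there the contour integral depends on the end points only.\<close>

definition upper_right :: "complex set" where
  "upper_right = {k. 0 < Re k + Im k}"

text \<open>The integral of the kernel from \<open>i r\<close> to \<open>r\<close>, along the straight segment. It does not involve the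
  radius \<open>R\<close> of the arc, and differentiation under the integral is elementary on a segment.\<close>

definition special_cutoff :: "real \<Rightarrow> real \<Rightarrow> real \<Rightarrow> complex" where
  "special_cutoff r x s = contour_integral (linepath (\<i> * of_real r) (of_real r)) (special_kernel x s)"

lemma convex_upper_right: "convex upper_right"
proof -
  have "upper_right = {k. 0 < inner (Complex 1 1) k}"
    by (auto simp: upper_right_def inner_complex_def)
  then show ?thesis using convex_halfspace_gt[of 0 "Complex 1 1"] by simp
qed

lemma open_upper_right: "open upper_right"
  unfolding upper_right_def by (intro open_Collect_less continuous_intros)

lemma special_kernel_primitive:
  obtains P where "\<And>k. k \<in> upper_right \<Longrightarrow> (P has_field_derivative special_kernel x s k) (at k)"
proof -
  have "special_kernel x s holomorphic_on upper_right"
    unfolding special_kernel_def by (intro holomorphic_intros) (auto simp: upper_right_def)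
  then obtain P where P: "\<And>k. k \<in> upper_right \<Longrightarrow> (P has_field_derivative special_kernel x s k) (at k within upper_right)"
    using holomorphic_convex_primitive'[OF convex_upper_right open_upper_right] by metis
  show ?thesis
    by (rule that[of P]) (use P at_within_open[OF _ open_upper_right] in metis)
qed

lemma segment_upper_right:
  assumes "r > 0"
  shows "closed_segment (\<i> * of_real r) (of_real r) \<subseteq> upper_right"
  using assms by (intro closed_segment_subset convex_upper_right) (auto simp: upper_right_def)

lemma special_cutoff_primitive:
  assumes P: "\<And>k. k \<in> upper_right \<Longrightarrow> (P has_field_derivative special_kernel x s k) (at k)" and "r > 0"
  shows "special_cutoff r x s = P (of_real r) - P (\<i> * of_real r)"
  unfolding special_cutoff_def
  using contour_integral_unique[OF contour_integral_primitive[of upper_right P "special_kernel x s" "linepath (\<i> * of_real r) (of_real r)"]]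
    segment_upper_right[OF assms(2)] P has_field_derivative_at_within by fastforce

lemma polar_in_upper_right:
  assumes "a > 0" "0 \<le> \<theta>" "\<theta> \<le> pi / 2"
  shows "of_real a * cis \<theta> \<in> upper_right"
proof -
  have c: "cos \<theta> \<ge> 0" using assms by (intro cos_ge_zero) auto
  have s: "sin \<theta> \<ge> 0" using assms by (intro sin_ge_zero) auto
  have "(sin \<theta>)\<^sup>2 + (cos \<theta>)\<^sup>2 = 1" by simp
  then have "sin \<theta> \<noteq> 0 \<or> cos \<theta> \<noteq> 0" by (metis power_zero_numeral add_0 zero_neq_one)
  then have "a * (cos \<theta> + sin \<theta>) > 0" using c s assms by (intro mult_pos_pos) linarith+
  then show ?thesis by (simp add: upper_right_def distrib_left)
qed

lemma contour_integral_bdry_D1: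
  assumes "R > 0" "r > 0"
  shows "contour_integral (bdry_D1 R r) (special_kernel x s) = special_cutoff r x s"
proof -
  obtain P where P: "\<And>k. k \<in> upper_right \<Longrightarrow> (P has_field_derivative special_kernel x s k) (at k)"
    using special_kernel_primitive by metis
  have arc: "path_image (part_circlepath 0 R (pi / 2) 0) \<subseteq> upper_right"
  proof
    fix k assume "k \<in> path_image (part_circlepath 0 R (pi / 2) 0)"
    then obtain \<theta> where \<theta>: "k = of_real R * cis \<theta>" "0 \<le> \<theta>" "\<theta> \<le> pi / 2"
      unfolding path_image_part_circlepath' closed_segment_commute[of "pi / 2"] by (fastforce simp: closed_segment_eq_real_ivl)
    then show "k \<in> upper_right" using polar_in_upper_right[OF assms(1)] by simp
  qed
  have e: "pathstart (part_circlepath 0 R (pi / 2) 0) = \<i> * of_real R"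
    "pathfinish (part_circlepath 0 R (pi / 2) 0) = of_real R"
    by (simp_all add: pathstart_part_circlepath pathfinish_part_circlepath exp_eq_polar)
  have v: "valid_path (bdry_D1 R r)"
    unfolding bdry_D1_def using e by (intro valid_path_join) auto
  have seg: "closed_segment u v \<subseteq> upper_right" if "u \<in> upper_right" "v \<in> upper_right" for u v
    using that by (intro closed_segment_subset convex_upper_right)
  have ends: "\<i> * of_real r \<in> upper_right" "\<i> * of_real R \<in> upper_right" "of_real r \<in> upper_right" "of_real R \<in> upper_right"
    using assms by (auto simp: upper_right_def)
  have i: "path_image (bdry_D1 R r) \<subseteq> upper_right"
    unfolding bdry_D1_def by (intro subset_path_image_join arc; simp only: path_image_linepath seg ends)
  have "contour_integral (bdry_D1 R r) (special_kernel x s) = P (pathfinish (bdry_D1 R r)) - P (pathstart (bdry_D1 R r))"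
    by (intro contour_integral_unique contour_integral_primitive[OF _ v i]) (rule has_field_derivative_at_within[OF P])
  also have "\<dots> = special_cutoff r x s" by (simp add: special_cutoff_primitive[OF P assms(2)] bdry_D1_def)
  finally show ?thesis .
qed

lemma special_kernel_nz: "r > 0 \<Longrightarrow> k \<in> closed_segment (\<i> * of_real r) (of_real r) \<Longrightarrow> k \<noteq> 0"
  using segment_upper_right[of r] by (auto simp: upper_right_def)

lemma continuous_on_special_kernel:
  "r > 0 \<Longrightarrow> continuous_on (closed_segment (\<i> * of_real r) (of_real r)) (special_kernel x s)"
  unfolding special_kernel_def using special_kernel_nz by (intro continuous_intros) auto

lemma has_vector_derivative_special_cutoff_x:
  assumes "r > 0"
  shows "((\<lambda>x. special_cutoff r x s) has_vector_derivative
     contour_integral (bdry_D r) (\<lambda>k. wave x s k)) (at x)"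
proof -
  have "((\<lambda>x. special_cutoff r x s) has_vector_derivative contour_integral (linepath (\<i> * of_real r) (of_real r))
     (\<lambda>k. wave x s k)) (at x)"
    unfolding special_cutoff_def
  proof (rule has_vector_derivative_contour_integral_linepath)
    fix x k assume "k \<in> closed_segment (\<i> * of_real r) (complex_of_real r)"
    then have "k \<noteq> 0" using special_kernel_nz assms by auto
    then show "((\<lambda>x. special_kernel x s k) has_vector_derivative wave x s k) (at x)"
      unfolding special_kernel_def
      by (intro has_vector_derivative_real_field) (auto intro!: derivative_eq_intros)
  qed (auto intro!: continuous_on_special_kernel assms continuous_intros simp: case_prod_beta)
  also have "contour_integral (linepath (\<i> * of_real r) (of_real r)) (\<lambda>k. wave x s k)
     = contour_integral (bdry_D r) (\<lambda>k. wave x s k)"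
    by (rule contour_integral_entire_eq) (auto intro!: holomorphic_intros)
  finally show ?thesis .
qed

lemma has_vector_derivative_special_cutoff_t:
  assumes "r > 0"
  shows "((\<lambda>s. special_cutoff r x s) has_vector_derivative
     - contour_integral (bdry_D r) (\<lambda>k. k * wave x s k)) (at s)"
proof -
  have "((\<lambda>s. special_cutoff r x s) has_vector_derivative contour_integral (linepath (\<i> * of_real r) (of_real r))
     (\<lambda>k. - (k * wave x s k))) (at s)"
    unfolding special_cutoff_def
  proof (rule has_vector_derivative_contour_integral_linepath)
    fix s k assume "k \<in> closed_segment (\<i> * of_real r) (complex_of_real r)"
    then have "k \<noteq> 0" using special_kernel_nz assms by auto
    then show "((\<lambda>s. special_kernel x s k) has_vector_derivative - (k * wave x s k)) (at s)"
      unfolding special_kernel_def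
      by (intro has_vector_derivative_real_field) (auto intro!: derivative_eq_intros simp: power2_eq_square)
  qed (auto intro!: continuous_on_special_kernel assms continuous_intros simp: case_prod_beta)
  also have "contour_integral (linepath (\<i> * of_real r) (of_real r)) (\<lambda>k. - (k * wave x s k))
     = contour_integral (bdry_D r) (\<lambda>k. - (k * wave x s k))"
    by (rule contour_integral_entire_eq) (auto intro!: holomorphic_intros)
  also have "\<dots> = - contour_integral (bdry_D r) (\<lambda>k. k * wave x s k)"
    by (rule contour_integral_neg)
  finally show ?thesis .
qed

text \<open>The time derivative of the left-hand side has an elementary primitive in \<open>k\<close> and equals
  \<open>- r\<^sup>2 sinc (r\<^sup>2 s)\<close>; at \<open>s = 0\<close> the kernel is \<open>1 / (i k)\<close>, which picks up a quarter turn of the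
  logarithm.\<close>

lemma special_cutoff_0:
  assumes "r > 0"
  shows "special_cutoff r 0 s = - of_real (pi / 2 + Si (r\<^sup>2 * s))"
proof -
  have J00: "special_cutoff r 0 0 = - of_real (pi / 2)"
  proof -
    have "special_cutoff r 0 0 = - \<i> * Ln (of_real r) - (- \<i> * Ln (\<i> * of_real r))"
    proof (rule special_cutoff_primitive[OF _ assms])
      fix k assume "k \<in> upper_right"
      then have "k \<notin> \<real>\<^sub>\<le>\<^sub>0" by (auto simp: upper_right_def complex_nonpos_Reals_iff)
      then have "k \<noteq> 0" by auto
      with \<open>k \<notin> \<real>\<^sub>\<le>\<^sub>0\<close> show "((\<lambda>k. - \<i> * Ln k) has_field_derivative special_kernel 0 0 k) (at k)"
        by (auto intro!: derivative_eq_intros simp: special_kernel_def field_simps)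
    qed
    also have "Ln (\<i> * of_real r) = of_real (ln r) + \<i> * of_real pi / 2"
      using Ln_times_of_real[of r \<i>] assms by (simp only: mult.commute[of \<i> "of_real r"] Ln_ii) (simp add: Ln_of_real)
    also have "Ln (of_real r) = of_real (ln r)" using assms by (rule Ln_of_real)
    also have "- \<i> * of_real (ln r) - (- \<i> * (of_real (ln r) + \<i> * of_real pi / 2)) = - complex_of_real (pi / 2)"
      by (simp add: complex_eq_iff)
    finally show ?thesis .
  qed
  have d: "((\<lambda>s. special_cutoff r 0 s + of_real (Si (r\<^sup>2 * s))) has_vector_derivative 0) (at s within UNIV)" for s
  proof -
    have c: "contour_integral (bdry_D r) (\<lambda>k. k * wave 0 s k)
       = of_real (r\<^sup>2 * sinc (r\<^sup>2 * s))"
    proof (cases "s = 0")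
      case True
      have "((\<lambda>k. k\<^sup>2 / 2) has_field_derivative k) (at k within UNIV)" for k :: complex
        by (auto intro!: derivative_eq_intros)
      from contour_integral_unique[OF contour_integral_primitive[OF this valid_path_bdry_D[of r]]]
      show ?thesis using True by (simp add: power_mult_distrib)
    next
      case False
      define S where "S = complex_of_real s"
      have S: "S \<noteq> 0" using False by (simp add: S_def)
      have "((\<lambda>k. \<i> / (2 * S) * exp (- \<i> * k\<^sup>2 * S)) has_field_derivative k * exp (\<i> * k * of_real 0 - \<i> * k\<^sup>2 * S)) (at k within UNIV)" for k
        using S by (auto intro!: derivative_eq_intros simp: field_simps power2_eq_square)
      from contour_integral_unique[OF contour_integral_primitive[OF this valid_path_bdry_D[of r]]]
      have "contour_integral (bdry_D r) (\<lambda>k. k * exp (\<i> * k * of_real 0 - \<i> * k\<^sup>2 * S))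
        = \<i> / (2 * S) * (exp (- \<i> * of_real (r\<^sup>2 * s)) - exp (\<i> * of_real (r\<^sup>2 * s)))"
        by (simp add: power_mult_distrib right_diff_distrib S_def mult.assoc)
      also have "exp (- \<i> * of_real (r\<^sup>2 * s)) - exp (\<i> * of_real (r\<^sup>2 * s)) = - 2 * \<i> * of_real (sin (r\<^sup>2 * s))"
      proof -
        have 1: "exp (\<i> * of_real (r\<^sup>2 * s)) = cis (r\<^sup>2 * s)" by (rule cis_conv_exp[symmetric])
        have 2: "exp (- \<i> * of_real (r\<^sup>2 * s)) = cis (- (r\<^sup>2 * s))" unfolding cis_conv_exp by simp
        show ?thesis unfolding 1 2 by (simp add: complex_eq_iff)
      qed
      finally show ?thesis using False assms by (simp add: S_def field_simps)
    qed
    have "((\<lambda>s. Si (r\<^sup>2 * s)) has_real_derivative sinc (r\<^sup>2 * s) * r\<^sup>2) (at s)"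
      by (rule DERIV_chain'[OF DERIV_cmult_Id DERIV_Si])
    then have "((\<lambda>s. complex_of_real (Si (r\<^sup>2 * s))) has_vector_derivative of_real (r\<^sup>2 * sinc (r\<^sup>2 * s))) (at s)"
      unfolding mult.commute[of "r\<^sup>2"] by (rule has_vector_derivative_of_real)
    from has_vector_derivative_add[OF has_vector_derivative_special_cutoff_t[OF assms, of 0] this]
    show ?thesis unfolding c by simp
  qed
  have "special_cutoff r 0 s + of_real (Si (r\<^sup>2 * s)) = special_cutoff r 0 0 + of_real (Si (r\<^sup>2 * 0))"
    using has_vector_derivative_zero_constant[OF convex_UNIV d] by (metis UNIV_I)
  moreover have "Si 0 = 0" using Si_neg[of 0] by simp
  ultimately have "special_cutoff r 0 s + of_real (Si (r\<^sup>2 * s)) = - of_real (pi / 2)" using J00 by simp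
  then have "special_cutoff r 0 s = - of_real (pi / 2) - of_real (Si (r\<^sup>2 * s))" by (simp only: eq_diff_eq)
  then show ?thesis by simp
qed

text \<open>The space derivative tends to \<open>2 \<pi> K(t, \<sqdot>)\<close> uniformly on \<open>[0, x]\<close>, which gives the increment
  \<open>2 \<pi> \<Phi>(t, x)\<close>; the value at \<open>x = 0\<close> tends to \<open>- \<pi>\<close> by the Dirichlet integral.\<close>

lemma special_cutoff_tendsto:
  assumes "t > 0" "x \<ge> 0"
  shows "((\<lambda>r. special_cutoff r x t) \<longlongrightarrow> of_real (2 * pi) * (Phi t x - 1 / 2)) at_top"
proof -
  have "((\<lambda>r. (special_cutoff r x t - special_cutoff r 0 t) - 2 * of_real pi * Phi t x) \<longlongrightarrow> 0) at_top"
  proof (rule Lim_null_comparison)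
    show "\<forall>\<^sub>F r in at_top. norm ((special_cutoff r x t - special_cutoff r 0 t) - 2 * of_real pi * Phi t x) \<le> 6 / (t * r - x / 2) * x"
      using eventually_gt_at_top[of "x / (2 * t)"] eventually_gt_at_top[of 0]
    proof eventually_elim
      case (elim r)
      have r: "x < 2 * t * r" using elim assms by (simp add: field_simps)
      show ?case
      proof (cases "x = 0")
        case False
        then have x: "x > 0" using assms by simp
        let ?B = "6 / (t * r - x / 2)"
        let ?h = "\<lambda>z. special_cutoff r z t - 2 * of_real pi * Phi t z"
        let ?h' = "\<lambda>z. contour_integral (bdry_D r) (\<lambda>k. wave z t k)
           - 2 * of_real pi * propagator t z"
        have d: "(?h has_vector_derivative ?h' z) (at z)" for z
          by (intro has_vector_derivative_diff has_vector_derivative_special_cutoff_x elim has_vector_derivative_mult_right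
              has_vector_derivative_Phi assms)
        have "norm (?h x - ?h 0) \<le> ?B * x - ?B * 0"
        proof (rule differentiable_bound_general[OF x, where \<phi>' = "\<lambda>_. ?B"])
          show "continuous_on {0..x} ?h"
            by (intro continuous_at_imp_continuous_on ballI has_vector_derivative_continuous[OF d])
          fix z assume z: "0 < z" "z < x"
          show "(?h has_vector_derivative ?h' z) (at z)" by (rule d)
          show "((\<lambda>z. ?B * z) has_vector_derivative ?B) (at z)"
            unfolding has_real_derivative_iff_has_vector_derivative[symmetric] by (rule DERIV_cmult_Id)
          have "norm (?h' z) \<le> 6 / (t * r - z / 2)"
            using z r by (intro bdry_D_integral_approx assms) auto
          also have "\<dots> \<le> ?B" using z r by (intro divide_left_mono) (auto intro!: mult_pos_pos)
          finally show "norm (?h' z) \<le> ?B" .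
        qed (intro continuous_intros)
        then show ?thesis by (simp add: algebra_simps)
      qed simp
    qed
    show "((\<lambda>r. 6 / (t * r - x / 2) * x) \<longlongrightarrow> 0) at_top" using assms by real_asymp
  qed
  moreover have "((\<lambda>r. - of_real (pi / 2 + Si (r\<^sup>2 * t)) :: complex) \<longlongrightarrow> - of_real (pi / 2 + pi / 2)) at_top"
  proof -
    have "filterlim (\<lambda>r::real. r\<^sup>2 * t) at_top at_top" using assms by real_asymp
    from filterlim_compose[OF Si_at_top this] show ?thesis by (intro tendsto_intros)
  qed
  then have "((\<lambda>r. special_cutoff r 0 t) \<longlongrightarrow> - of_real (pi / 2 + pi / 2)) at_top"
  proof (rule Lim_transform_eventually)
    show "\<forall>\<^sub>F r in at_top. - of_real (pi / 2 + Si (r\<^sup>2 * t)) = special_cutoff r 0 t"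
      using eventually_gt_at_top[of 0] by eventually_elim (simp only: special_cutoff_0)
  qed
  ultimately have "((\<lambda>r. ((special_cutoff r x t - special_cutoff r 0 t) - 2 * of_real pi * Phi t x) + special_cutoff r 0 t + 2 * of_real pi * Phi t x)
     \<longlongrightarrow> 0 + - of_real (pi / 2 + pi / 2) + 2 * of_real pi * Phi t x) at_top"
    by (intro tendsto_add tendsto_const)
  moreover have "0 + - of_real (pi / 2 + pi / 2) + 2 * of_real pi * Phi t x = of_real (2 * pi) * (Phi t x - 1 / 2)"
    by (simp add: right_diff_distrib)
  ultimately show ?thesis by simp
qed

lemma I_special_eq:
  assumes "R > 0" "t > 0" "x \<ge> 0"
  shows "I_special R x t = Phi t x - 1 / 2"
proof -
  have ev: "\<forall>\<^sub>F r in at_top. contour_integral (bdry_D1 R r) (special_kernel x t) = special_cutoff r x t"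
    using eventually_gt_at_top[of 0] by eventually_elim (rule contour_integral_bdry_D1[OF assms(1)])
  have "((\<lambda>r. contour_integral (bdry_D1 R r) (special_kernel x t)) \<longlongrightarrow> of_real (2 * pi) * (Phi t x - 1 / 2)) at_top"
  proof (rule Lim_transform_eventually[OF special_cutoff_tendsto[OF assms(2,3)]])
    show "\<forall>\<^sub>F r in at_top. special_cutoff r x t = contour_integral (bdry_D1 R r) (special_kernel x t)"
      using ev by eventually_elim simp
  qed
  then have "improper_contour_integral (bdry_D1 R) (special_kernel x t) = of_real (2 * pi) * (Phi t x - 1 / 2)"
    unfolding improper_contour_integral_def by (intro tendsto_Lim) auto
  then show ?thesis unfolding I_special_def special_kernel_def[abs_def] by simp
qed

text \<open>At time \<open>0\<close> the kernel is \<open>exp (i k x) / (i k)\<close>; one integration by parts along the segment gains a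
  factor \<open>1 / (r x)\<close>.\<close>

lemma special_cutoff_time_0:
  assumes "x > 0"
  shows "((\<lambda>r. special_cutoff r x 0) \<longlongrightarrow> 0) at_top"
proof (rule Lim_null_comparison)
  show "\<forall>\<^sub>F r in at_top. norm (special_cutoff r x 0) \<le> 6 / (r * x)"
    using eventually_gt_at_top[of 0]
  proof eventually_elim
    case (elim r)
    obtain P where P: "\<And>k. k \<in> upper_right \<Longrightarrow> (P has_field_derivative special_kernel x 0 k) (at k)"
      using special_kernel_primitive by metis
    \<comment> \<open>\<open>- V\<close> is the first term of the expansion of \<open>P\<close> at infinity.\<close>
    let ?V = "\<lambda>k. exp (\<i> * k * of_real x) / (k * of_real x)"
    let ?seg = "closed_segment (\<i> * of_real r) (complex_of_real r)"
    have e: "norm (exp (\<i> * k * of_real x)) \<le> 1" if "Im k \<ge> 0" for k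
      using that assms by (simp add: norm_exp_eq_Re)
    have V: "norm (?V k) \<le> 1 / (r * x)" if "Im k \<ge> 0" "norm k = r" for k
      using e[OF that(1)] that(2) elim assms by (simp add: norm_divide norm_mult divide_right_mono)
    have "norm ((P (of_real r) + ?V (of_real r)) - (P (\<i> * of_real r) + ?V (\<i> * of_real r))) \<le> 2 / (r\<^sup>2 * x) * norm (of_real r - \<i> * of_real r)"
    proof (rule field_differentiable_bound[where S = ?seg and f' = "\<lambda>k. - exp (\<i> * k * of_real x) / (k\<^sup>2 * of_real x)"])
      fix k assume k: "k \<in> ?seg"
      have kn: "k \<noteq> 0" using k special_kernel_nz elim by auto
      have ku: "k \<in> upper_right" using k segment_upper_right elim by auto
      have "((\<lambda>k. P k + ?V k) has_field_derivative - exp (\<i> * k * of_real x) / (k\<^sup>2 * of_real x)) (at k)"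
      proof -
        have "(?V has_field_derivative (exp (\<i> * k * of_real x) * (\<i> * of_real x) * (k * of_real x)
            - exp (\<i> * k * of_real x) * of_real x) / (k * of_real x * (k * of_real x))) (at k)"
          using kn assms by (auto intro!: derivative_eq_intros)
        from DERIV_add[OF P[OF ku] this]
        have "((\<lambda>k. P k + ?V k) has_field_derivative special_kernel x 0 k + (exp (\<i> * k * of_real x) * (\<i> * of_real x) * (k * of_real x)
            - exp (\<i> * k * of_real x) * of_real x) / (k * of_real x * (k * of_real x))) (at k)" .
        moreover have "special_kernel x 0 k + (exp (\<i> * k * of_real x) * (\<i> * of_real x) * (k * of_real x)
            - exp (\<i> * k * of_real x) * of_real x) / (k * of_real x * (k * of_real x)) = - exp (\<i> * k * of_real x) / (k\<^sup>2 * of_real x)"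
        proof -
          define E X where "E = exp (\<i> * k * of_real x)" and "X = complex_of_real x"
          have X: "X \<noteq> 0" using assms by (simp add: X_def)
          have "E / (\<i> * k) + (E * (\<i> * X) * (k * X) - E * X) / (k * X * (k * X)) = - E / (k\<^sup>2 * X)"
            using X kn by (simp add: field_simps power2_eq_square)
          then show ?thesis by (simp add: special_kernel_def E_def X_def)
        qed
        ultimately show ?thesis by simp
      qed
      then show "((\<lambda>k. P k + ?V k) has_field_derivative - exp (\<i> * k * of_real x) / (k\<^sup>2 * of_real x)) (at k within ?seg)"
        by (rule has_field_derivative_at_within)
      have "closed_segment (\<i> * of_real r) (of_real r) \<subseteq> {k. Im k \<ge> 0}"
        using elim by (intro closed_segment_subset convex_halfspace_Im_ge) auto
      then have ik: "Im k \<ge> 0" using k by auto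
      have nk: "(norm k)\<^sup>2 \<ge> r\<^sup>2 / 2"
        using k elim by (intro norm_chord_ge[where z = "\<i> * of_real r" and w = "of_real r"]) (auto simp: norm_mult inner_complex_def)
      have "norm (- exp (\<i> * k * of_real x) / (k\<^sup>2 * of_real x)) = norm (exp (\<i> * k * of_real x)) / ((norm k)\<^sup>2 * x)"
        using assms by (simp add: norm_divide norm_mult norm_power)
      also have "\<dots> \<le> 1 / (r\<^sup>2 / 2 * x)"
        using e[OF ik] nk assms elim by (intro frac_le mult_right_mono) auto
      finally show "norm (- exp (\<i> * k * of_real x) / (k\<^sup>2 * of_real x)) \<le> 2 / (r\<^sup>2 * x)" by simp
    qed auto
    also have "\<dots> \<le> 2 / (r\<^sup>2 * x) * (2 * r)"
      using norm_triangle_ineq4[of "of_real r" "\<i> * of_real r :: complex"] elim assms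
      by (intro mult_left_mono) (auto simp: norm_mult)
    also have "\<dots> = 4 / (r * x)" using elim by (simp add: power2_eq_square)
    finally have "norm (special_cutoff r x 0 + ?V (of_real r) - ?V (\<i> * of_real r)) \<le> 4 / (r * x)"
      by (simp add: special_cutoff_primitive[OF P elim] algebra_simps)
    moreover have "norm (?V (of_real r)) \<le> 1 / (r * x)" "norm (?V (\<i> * of_real r)) \<le> 1 / (r * x)"
      using elim by (intro V; simp add: norm_mult)+
    moreover have "norm (special_cutoff r x 0) \<le> norm (special_cutoff r x 0 + ?V (of_real r) - ?V (\<i> * of_real r)) + norm (?V (of_real r)) + norm (?V (\<i> * of_real r))"
    proof -
      have "norm a \<le> norm (a + b - c) + norm b + norm c" for a b c :: complex
        using norm_triangle_ineq[of "a + b - c" "c - b"] norm_triangle_ineq4[of c b] by simp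
      then show ?thesis .
    qed
    moreover have "6 / (r * x) = 4 / (r * x) + 1 / (r * x) + 1 / (r * x)" by simp
    ultimately show ?case by linarith
  qed
  show "((\<lambda>r. 6 / (r * x)) \<longlongrightarrow> 0) at_top" using assms by real_asymp
qed

text \<open>The bound has to be uniform both in the truncation and in the time down to \<open>0\<close>. The path is chosen
  according to the point \<open>\<rho> = x / (2 s)\<close>, since the exponential has modulus
  \<open>exp (- Im k (x - 2 s Re k))\<close>. On an arc of radius at most \<open>\<rho>\<close> this is at most \<open>1\<close>, and the arc
  contributes at most \<open>\<pi> / 2\<close>. Beyond \<open>\<rho>\<close>, the imaginary axis contributes an exponentially decaying
  integral, and the real axis an oscillatory one which is integrated by parts against the Fresnel
  function: its bound \<open>C / \<surd>s\<close> is compensated by the factor \<open>1 / \<rho>\<close>.\<close>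

lemma special_cutoff_bounded_in_time:
  assumes "x > 0" "T > 0"
  obtains B where "\<And>r s. 0 < r \<Longrightarrow> 0 < s \<Longrightarrow> s \<le> T \<Longrightarrow> norm (special_cutoff r x s) \<le> B"
proof -
  obtain C where C: "C > 0" "\<And>u::real. norm (fresnel (of_real u)) \<le> C" using fresnel_bounded by metis
  have "norm (special_cutoff r x s) \<le> pi / 2 + (2 * s / x\<^sup>2 + 4 * C * sqrt s / x)" if r: "0 < r" and s: "0 < s" for r s
  proof -
    obtain P where P: "\<And>k. k \<in> upper_right \<Longrightarrow> (P has_field_derivative special_kernel x s k) (at k)"
      using special_kernel_primitive by metis
    have nk: "norm (special_kernel x s k) = exp (- Im k * (x - 2 * s * Re k)) / norm k" for k
      by (simp add: special_kernel_def norm_divide norm_mult norm_exp_eq_Re power2_eq_square algebra_simps)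
    define \<rho> where "\<rho> = x / (2 * s)"
    have \<rho>: "\<rho> > 0" using assms s by (simp add: \<rho>_def)
    have arc: "norm (P (of_real a) - P (\<i> * of_real a)) \<le> pi / 2" if a: "0 < a" "a \<le> \<rho>" for a
    proof -
      have d: "((\<lambda>\<theta>. P (of_real a * exp (\<i> * of_real \<theta>))) has_vector_derivative
          special_kernel x s (of_real a * exp (\<i> * of_real \<theta>)) * (of_real a * exp (\<i> * of_real \<theta>) * \<i>)) (at \<theta>)"
        if \<theta>: "0 \<le> \<theta>" "\<theta> \<le> pi / 2" for \<theta>
      proof (rule has_vector_derivative_real_field)
        have u: "of_real a * exp (\<i> * of_real \<theta>) \<in> upper_right"
          using polar_in_upper_right[OF a(1) \<theta>] by (simp add: cis_conv_exp)
        have "((\<lambda>\<theta>. of_real a * exp (\<i> * \<theta>)) has_field_derivative of_real a * exp (\<i> * of_real \<theta>) * \<i>) (at (of_real \<theta>))"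
          by (auto intro!: derivative_eq_intros)
        from DERIV_chain'[OF this P[OF u]]
        show "((\<lambda>\<theta>. P (of_real a * exp (\<i> * \<theta>))) has_field_derivative
          special_kernel x s (of_real a * exp (\<i> * of_real \<theta>)) * (of_real a * exp (\<i> * of_real \<theta>) * \<i>)) (at (of_real \<theta>))" .
      qed
      have "norm (P (of_real a * exp (\<i> * of_real (pi / 2))) - P (of_real a * exp (\<i> * of_real 0))) \<le> pi / 2 - 0"
      proof (rule differentiable_bound_general[where f = "\<lambda>\<theta>. P (of_real a * exp (\<i> * of_real \<theta>))" and \<phi> = "\<lambda>\<theta>. \<theta>" and \<phi>' = "\<lambda>_. 1"])
        show "continuous_on {0..pi / 2} (\<lambda>\<theta>. P (of_real a * exp (\<i> * of_real \<theta>)))"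
          by (intro continuous_at_imp_continuous_on ballI has_vector_derivative_continuous[OF d]) auto
        fix \<theta> assume \<theta>: "0 < \<theta>" "\<theta> < pi / 2"
        show "((\<lambda>\<theta>. P (of_real a * exp (\<i> * of_real \<theta>))) has_vector_derivative
          special_kernel x s (of_real a * exp (\<i> * of_real \<theta>)) * (of_real a * exp (\<i> * of_real \<theta>) * \<i>)) (at \<theta>)"
          using \<theta> by (intro d) auto
        have sn: "sin \<theta> \<ge> 0" using \<theta> by (intro sin_ge_zero) auto
        have "cos \<theta> \<ge> 0" using \<theta> by (intro cos_ge_zero) auto
        then have "2 * s * (a * cos \<theta>) \<le> 2 * s * (\<rho> * 1)"
          using a s \<rho> by (intro mult_left_mono mult_mono) auto
        also have "\<dots> = x" using s by (simp add: \<rho>_def)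
        finally have "0 \<le> (a * sin \<theta>) * (x - 2 * s * (a * cos \<theta>))" using a sn by simp
        then show "norm (special_kernel x s (of_real a * exp (\<i> * of_real \<theta>)) * (of_real a * exp (\<i> * of_real \<theta>) * \<i>)) \<le> 1"
          using a by (simp add: norm_mult nk cis_conv_exp[symmetric])
      qed (auto intro!: continuous_intros derivative_eq_intros)
      moreover have "exp (\<i> * of_real (pi / 2)) = \<i>" by (simp only: cis_conv_exp[symmetric] cis_pi_half)
      ultimately show ?thesis by (simp add: mult.commute norm_minus_commute)
    qed
    have sp: "0 < 2 * s / x\<^sup>2 + 4 * C * sqrt s / x" using s assms C by (intro add_pos_pos) auto
    show ?thesis
    proof (cases "r \<le> \<rho>")
      case True
      then show ?thesis using arc[OF r True] sp by (simp add: special_cutoff_primitive[OF P r])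
    next
      case False
      then have r\<rho>: "\<rho> < r" by simp
      have im: "norm (P (\<i> * of_real r) - P (\<i> * of_real \<rho>)) \<le> 2 * s / x\<^sup>2"
      proof -
        have d: "((\<lambda>b. P (\<i> * of_real b)) has_vector_derivative special_kernel x s (\<i> * of_real b) * \<i>) (at b)" if "b > 0" for b
        proof (rule has_vector_derivative_real_field)
          have u: "\<i> * of_real b \<in> upper_right" using that by (simp add: upper_right_def)
          show "((\<lambda>b. P (\<i> * b)) has_field_derivative special_kernel x s (\<i> * of_real b) * \<i>) (at (of_real b))"
            by (rule DERIV_chain'[OF DERIV_cmult_Id P[OF u]])
        qed
        have "norm (P (\<i> * of_real r) - P (\<i> * of_real \<rho>)) \<le> (- exp (- (x * r)) / (\<rho> * x)) - (- exp (- (x * \<rho>)) / (\<rho> * x))"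
        proof (rule differentiable_bound_general[OF r\<rho>, where \<phi>' = "\<lambda>b. exp (- (x * b)) / \<rho>"])
          show "continuous_on {\<rho>..r} (\<lambda>b. P (\<i> * of_real b))"
            using \<rho> by (intro continuous_at_imp_continuous_on ballI has_vector_derivative_continuous[OF d]) auto
          show "continuous_on {\<rho>..r} (\<lambda>b. - exp (- (x * b)) / (\<rho> * x))" using \<rho> assms by (intro continuous_intros) auto
          fix b assume b: "\<rho> < b" "b < r"
          show "((\<lambda>b. P (\<i> * of_real b)) has_vector_derivative special_kernel x s (\<i> * of_real b) * \<i>) (at b)"
            using b \<rho> by (intro d) auto
          show "((\<lambda>b. - exp (- (x * b)) / (\<rho> * x)) has_vector_derivative exp (- (x * b)) / \<rho>) (at b)"
            unfolding has_real_derivative_iff_has_vector_derivative[symmetric]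
            using \<rho> assms by (auto intro!: derivative_eq_intros)
          show "norm (special_kernel x s (\<i> * of_real b) * \<i>) \<le> exp (- (x * b)) / \<rho>"
            using b \<rho> by (simp add: norm_mult nk mult.commute frac_le)
        qed
        also have "\<dots> \<le> 1 / (\<rho> * x)"
        proof -
          have "0 \<le> exp (- (x * r)) / (\<rho> * x)" "exp (- (x * \<rho>)) / (\<rho> * x) \<le> 1 / (\<rho> * x)"
            using \<rho> assms by (auto intro!: divide_right_mono)
          then show ?thesis by simp
        qed
        also have "\<dots> = 2 * s / x\<^sup>2" by (simp add: \<rho>_def power2_eq_square)
        finally show ?thesis .
      qed
      have re: "norm (P (of_real r) - P (of_real \<rho>)) \<le> 4 * C * sqrt s / x"
      proof -
        let ?Q = "exp_quadratic_primitive x s"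
        have Q: "norm (?Q (of_real u)) \<le> C / sqrt s" for u :: real
        proof -
          have "complex_of_real (sqrt s) * of_real u - of_real (x / (2 * sqrt s)) = of_real (sqrt s * u - x / (2 * sqrt s))" by simp
          then have "norm (?Q (of_real u)) = norm (fresnel (of_real (sqrt s * u - x / (2 * sqrt s)))) / sqrt s"
            unfolding exp_quadratic_primitive_def norm_mult norm_divide norm_exp_i_times using s by simp
          also have "\<dots> \<le> C / sqrt s" using s by (intro divide_right_mono C) auto
          finally show ?thesis .
        qed
        \<comment> \<open>Integration by parts: the difference has the absolutely integrable derivative \<open>Q / (i k\<^sup>2)\<close>.\<close>
        let ?G = "\<lambda>k. P k - ?Q k / (\<i> * k)"
        have d: "((\<lambda>u. ?G (of_real u)) has_vector_derivative ?Q (of_real u) / (\<i> * (of_real u)\<^sup>2)) (at u)" if "u > 0" for u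
        proof (rule has_vector_derivative_real_field)
          define k where "k = complex_of_real u"
          have k: "k \<noteq> 0" "k \<in> upper_right" using that by (auto simp: k_def upper_right_def)
          have "((\<lambda>k. ?Q k / (\<i> * k)) has_field_derivative
             (wave x s k * (\<i> * k) - ?Q k * \<i>) / ((\<i> * k) * (\<i> * k))) (at k)"
            using k by (intro DERIV_divide has_field_derivative_exp_quadratic_primitive s DERIV_cmult_Id) auto
          from DERIV_diff[OF P[OF k(2)] this]
          have "(?G has_field_derivative special_kernel x s k -
             (wave x s k * (\<i> * k) - ?Q k * \<i>) / ((\<i> * k) * (\<i> * k))) (at k)" .
          moreover have "E / (\<i> * k) - (E * (\<i> * k) - Q * \<i>) / ((\<i> * k) * (\<i> * k)) = Q / (\<i> * k\<^sup>2)" for E Q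
            using k by (simp add: field_simps power2_eq_square)
          ultimately show "(?G has_field_derivative ?Q (of_real u) / (\<i> * (of_real u)\<^sup>2)) (at (of_real u))"
            unfolding special_kernel_def k_def by simp
        qed
        have "norm (?G (of_real r) - ?G (of_real \<rho>)) \<le> (- (C / sqrt s) / r) - (- (C / sqrt s) / \<rho>)"
        proof (rule differentiable_bound_general[OF r\<rho>, where f = "\<lambda>u. ?G (of_real u)" and \<phi>' = "\<lambda>u. C / sqrt s / u\<^sup>2"])
          show "continuous_on {\<rho>..r} (\<lambda>u. ?G (of_real u))"
            using \<rho> by (intro continuous_at_imp_continuous_on ballI has_vector_derivative_continuous[OF d]) auto
          show "continuous_on {\<rho>..r} (\<lambda>u. - (C / sqrt s) / u)" using \<rho> by (intro continuous_intros) auto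
          fix u assume u: "\<rho> < u" "u < r"
          then have u0: "u > 0" using \<rho> by simp
          show "((\<lambda>u. ?G (of_real u)) has_vector_derivative ?Q (of_real u) / (\<i> * (of_real u)\<^sup>2)) (at u)"
            by (rule d[OF u0])
          show "((\<lambda>u. - (C / sqrt s) / u) has_vector_derivative C / sqrt s / u\<^sup>2) (at u)"
            unfolding has_real_derivative_iff_has_vector_derivative[symmetric]
            using u0 s by (auto intro!: derivative_eq_intros simp: field_simps power2_eq_square)
          show "norm (?Q (of_real u) / (\<i> * (of_real u)\<^sup>2)) \<le> C / sqrt s / u\<^sup>2"
          proof -
            have "norm (?Q (of_real u) / (\<i> * (of_real u)\<^sup>2)) = norm (?Q (of_real u)) / u\<^sup>2"
              using u0 by (simp add: norm_divide norm_mult norm_power)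
            also have "\<dots> \<le> C / sqrt s / u\<^sup>2" by (intro divide_right_mono Q) auto
            finally show ?thesis .
          qed
        qed
        moreover have "norm (?Q (of_real u) / (\<i> * of_real u)) \<le> C / sqrt s / u" if "u > 0" for u :: real
        proof -
          have "norm (?Q (of_real u) / (\<i> * of_real u)) = norm (?Q (of_real u)) / u"
            using that by (simp add: norm_divide norm_mult)
          also have "\<dots> \<le> C / sqrt s / u" using that by (intro divide_right_mono Q) auto
          finally show ?thesis .
        qed
        then have "norm (?Q (of_real r) / (\<i> * of_real r)) \<le> C / sqrt s / r" "norm (?Q (of_real \<rho>) / (\<i> * of_real \<rho>)) \<le> C / sqrt s / \<rho>"
          using r \<rho> by blast+
        moreover have "norm (a - b) \<le> norm ((a - c) - (b - d)) + norm c + norm d" for a b c d :: complex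
          using norm_triangle_ineq[of "(a - c) - (b - d)" "c - d"] norm_triangle_ineq4[of c d] by simp
        note this[of "P (of_real r)" "P (of_real \<rho>)" "?Q (of_real r) / (\<i> * of_real r)" "?Q (of_real \<rho>) / (\<i> * of_real \<rho>)"]
        ultimately have "norm (P (of_real r) - P (of_real \<rho>)) \<le> 2 * (C / sqrt s / \<rho>)"
          by linarith
        also have "\<dots> = 4 * C * (s / sqrt s) / x" by (simp add: \<rho>_def)
        also have "s / sqrt s = sqrt s" using s by (simp add: real_div_sqrt)
        finally show ?thesis .
      qed
      have "norm (special_cutoff r x s) \<le> norm (P (of_real \<rho>) - P (\<i> * of_real \<rho>)) + norm (P (\<i> * of_real r) - P (\<i> * of_real \<rho>)) + norm (P (of_real r) - P (of_real \<rho>))"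
      proof -
        have "norm (a - b) \<le> norm (c - d) + norm (b - d) + norm (a - c)" for a b c d :: complex
          using norm_triangle_ineq[of "c - d" "d - b"] norm_triangle_ineq[of "a - c" "c - b"] by (simp add: norm_minus_commute)
        from this[where a = "P (of_real r)" and b = "P (\<i> * of_real r)" and c = "P (of_real \<rho>)" and d = "P (\<i> * of_real \<rho>)"]
        show ?thesis by (simp only: special_cutoff_primitive[OF P r])
      qed
      then show ?thesis using arc[OF \<rho> order_refl] im re by simp
    qed
  qed note * = this
  show ?thesis
  proof (rule that)
    fix r s :: real assume a: "0 < r" "0 < s" "s \<le> T"
    have "norm (special_cutoff r x s) \<le> pi / 2 + (2 * s / x\<^sup>2 + 4 * C * sqrt s / x)" by (rule *[OF a(1,2)])
    also have "\<dots> \<le> pi / 2 + (2 * T / x\<^sup>2 + 4 * C * sqrt T / x)"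
      using a assms C by (intro add_mono divide_right_mono mult_left_mono real_sqrt_le_mono) auto
    finally show "norm (special_cutoff r x s) \<le> pi / 2 + (2 * T / x\<^sup>2 + 4 * C * sqrt T / x)" .
  qed
qed

section \<open>The du Bois-Reymond lemma\<close>

text \<open>Continuous approximations of the indicator function of \<open>{u<..<v}\<close>. Continuity suffices because they
  serve as derivatives of \<open>C\<^sup>1\<close> test functions.\<close>

definition trapez :: "real \<Rightarrow> real \<Rightarrow> nat \<Rightarrow> real \<Rightarrow> real" where
  "trapez u v n x = max 0 (min 1 (min (real (Suc n) * (x - u)) (real (Suc n) * (v - x))))"

lemma trapez_bounds: "0 \<le> trapez u v n x" "trapez u v n x \<le> 1"
  by (auto simp: trapez_def)

lemma trapez_outside: "x \<notin> {u<..<v} \<Longrightarrow> trapez u v n x = 0"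
proof -
  assume "x \<notin> {u<..<v}"
  then have "real (Suc n) * (x - u) \<le> 0 \<or> real (Suc n) * (v - x) \<le> 0"
    by (auto simp: not_less intro!: mult_nonneg_nonpos)
  then show ?thesis by (auto simp: trapez_def)
qed

lemma continuous_on_trapez [continuous_intros]: "continuous_on S (trapez u v n)"
  unfolding trapez_def by (intro continuous_intros)

lemma trapez_tendsto: "(\<lambda>n. trapez u v n x) \<longlonglongrightarrow> indicator {u<..<v} x"
proof (cases "x \<in> {u<..<v}")
  case False
  then show ?thesis by (simp add: trapez_outside)
next
  case True
  define m where "m = min (x - u) (v - x)"
  have m: "m > 0" using True by (auto simp: m_def)
  obtain N where N: "inverse (real (Suc N)) < m" using reals_Archimedean[OF m] by blast
  have "trapez u v n x = 1" if "n \<ge> N" for n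
  proof -
    have "inverse (real (Suc n)) \<le> inverse (real (Suc N))" using that by simp
    then have "inverse (real (Suc n)) \<le> m" using N by linarith
    then have "1 \<le> real (Suc n) * m" by (simp add: field_simps)
    moreover have "real (Suc n) * m \<le> real (Suc n) * (x - u)" "real (Suc n) * m \<le> real (Suc n) * (v - x)"
      by (auto simp: m_def intro!: mult_left_mono)
    ultimately have "1 \<le> real (Suc n) * (x - u)" "1 \<le> real (Suc n) * (v - x)" by linarith+
    moreover have "max 0 (min 1 (min A B)) = (1::real)" if "1 \<le> A" "1 \<le> B" for A B
      using that by auto
    ultimately show ?thesis unfolding trapez_def by blast
  qed
  then have "\<forall>\<^sub>F n in sequentially. trapez u v n x = indicator {u<..<v} x"
    using True by (auto intro!: eventually_sequentiallyI[of N])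
  then show ?thesis by (simp add: tendsto_eventually)
qed

text \<open>At a Lebesgue point the value of the function is a limit of averages over intervals.\<close>

lemma AE_zero_of_interval_integrals_zero:
  fixes h :: "real \<Rightarrow> complex"
  assumes "a < b" and int: "set_integrable lebesgue {a<..<b} h"
    and zero: "\<And>u v. a < u \<Longrightarrow> u < v \<Longrightarrow> v < b \<Longrightarrow> (LINT x:{u<..<v}|lebesgue. h x) = 0"
  shows "AE x in lebesgue. x \<in> {a<..<b} \<longrightarrow> h x = 0"
proof -
  define f where "f x = indicator {a<..<b} x *\<^sub>R h x" for x
  have f_int: "integrable lebesgue f" using int by (simp add: set_integrable_def f_def [abs_def])
  have fi: "f integrable_on cbox u v" for u v
  proof -
    have "set_integrable lebesgue (cbox u v) f"
      unfolding set_integrable_def using f_int by (intro integrable_mult_indicator) auto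
    then show ?thesis by (rule set_lebesgue_integral_eq_integral(1))
  qed
  from integrable_ccontinuous_explicit[OF this] obtain N where N: "negligible N"
    "\<And>x e. \<lbrakk>x \<notin> N; 0 < e\<rbrakk> \<Longrightarrow> \<exists>d>0. \<forall>h. 0 < h \<and> h < d \<longrightarrow>
        norm (integral (cbox x (x + h *\<^sub>R One)) f /\<^sub>R h ^ DIM(real) - f x) < e" by metis
  have "h x = 0" if x: "x \<notin> N" "a < x" "x < b" for x
  proof (rule ccontr)
    assume "h x \<noteq> 0"
    then have "norm (f x) > 0" using x by (simp add: f_def)
    from N(2)[OF x(1) this] obtain d where d: "d > 0"
      "\<And>h. 0 < h \<Longrightarrow> h < d \<Longrightarrow> norm (integral {x..x + h} f /\<^sub>R h - f x) < norm (f x)" by auto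
    define k where "k = min (d / 2) ((b - x) / 2)"
    have k: "0 < k" "k < d" "x + k < b" using d x by (auto simp: k_def min_def field_simps)
    have "integral {x..x + k} f = (LINT y:{x..x + k}|lebesgue. f y)"
      using set_lebesgue_integral_eq_integral(2)[of "{x..x+k}" f] f_int
      by (simp add: set_integrable_def integrable_mult_indicator)
    also have "\<dots> = (LINT y:{x<..<x + k}|lebesgue. f y)"
    proof (rule set_integral_cong_set)
      show "set_borel_measurable lebesgue {x..x + k} f" "set_borel_measurable lebesgue {x<..<x + k} f"
        unfolding set_borel_measurable_def using f_int by (auto intro!: borel_measurable_integrable integrable_mult_indicator)
      have "negligible {x, x + k}" by simp
      then have "AE y in lebesgue. y \<notin> {x, x + k}"
        unfolding eventually_ae_filter_negligible by (intro exI[of _ "{x, x + k}"]) auto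
      then show "AE y in lebesgue. (y \<in> {x<..<x + k}) = (y \<in> {x..x + k})"
        by eventually_elim auto
    qed
    also have "\<dots> = (LINT y:{x<..<x + k}|lebesgue. h y)"
      using x k by (intro set_lebesgue_integral_cong) (auto simp: f_def)
    also have "\<dots> = 0" using zero[OF x(2) _ k(3)] k by simp
    finally show False using d(2)[OF k(1,2)] by simp
  qed
  then have "{x. \<not> (x \<in> {a<..<b} \<longrightarrow> h x = 0)} \<subseteq> N" by auto
  then show ?thesis unfolding eventually_ae_filter_negligible using N(1) by blast
qed

lemma set_integrable_L2_interval:
  assumes "L2_on {a<..<b} f"
  shows "set_integrable lebesgue {a<..<b} f"
proof (rule set_integrable_bound)
  have "set_integrable lebesgue {a<..<b} (\<lambda>x::real. 1::real)"
    by (rule absolutely_integrable_on_const) simp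
  then show "set_integrable lebesgue {a<..<b} (\<lambda>x. 1 + (norm (f x))\<^sup>2)"
    using assms by (intro set_integral_add) (auto simp: L2_on_def)
  show "set_borel_measurable lebesgue {a<..<b} f" using assms by (simp add: L2_on_def)
  have "norm (f x) \<le> 1 + (norm (f x))\<^sup>2" for x
    using zero_le_power2[of "norm (f x) - 1"] by (simp add: power2_eq_square algebra_simps) (smt (verit) norm_ge_zero zero_le_mult_iff mult_le_0_iff)
  then show "AE x in lebesgue. x \<in> {a<..<b} \<longrightarrow> norm (f x) \<le> norm (1 + (norm (f x))\<^sup>2)"
    by (simp add: abs_of_nonneg)
qed

text \<open>The vanishing mean is what makes the primitive vanish to the right of the support.\<close>

lemma C1c_test_integral:
  fixes \<psi> :: "real \<Rightarrow> complex"
  assumes cont: "continuous_on UNIV \<psi>" and out: "\<And>x. x \<notin> {u..v} \<Longrightarrow> \<psi> x = 0"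
    and uv: "u < v" and zero: "integral {u..v} \<psi> = 0" and I: "{u..v} \<subseteq> I"
  shows "C1c_test I (\<lambda>x. if x < u then 0 else integral {u..x} \<psi>) \<psi>"
proof -
  have ii: "\<psi> integrable_on {p..q}" for p q
    by (intro integrable_continuous_real continuous_on_subset[OF cont]) auto
  define G where "G x = integral {u - 1..x} \<psi>" for x
  have z0: "integral {p..q} \<psi> = 0" if "q \<le> u \<or> v \<le> p" for p q
  proof -
    have "integral {p..q} \<psi> = integral {p..q} (\<lambda>_. 0)"
    proof (rule integral_spike[of "{u, v}"])
      show "0 = \<psi> x" if "x \<in> {p..q} - {u, v}" for x
        using out[of x] that \<open>q \<le> u \<or> v \<le> p\<close> by auto
    qed auto
    then show ?thesis by simp
  qed
  have G: "(if x < u then 0 else integral {u..x} \<psi>) = G x" for x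
  proof (cases "x < u")
    case True
    then show ?thesis using z0[of x "u - 1"] by (simp add: G_def)
  next
    case False
    then have "integral {u - 1..u} \<psi> + integral {u..x} \<psi> = G x"
      unfolding G_def by (intro Henstock_Kurzweil_Integration.integral_combine ii) auto
    then show ?thesis using False z0[of u "u - 1"] by simp
  qed
  have Gd: "(G has_vector_derivative \<psi> x) (at x)" for x
  proof (cases "x > u - 1")
    case True
    have "((\<lambda>y. integral {u - 1..y} \<psi>) has_vector_derivative \<psi> x) (at x within {u - 1..x + 1})"
      using True by (intro integral_has_vector_derivative continuous_on_subset[OF cont]) auto
    moreover have "at x within {u - 1..x + 1} = at x" using True by (intro at_within_interior) auto
    ultimately show ?thesis by (simp add: G_def [abs_def])
  next
    case False
    have "((\<lambda>_. 0) has_vector_derivative \<psi> x) (at x)" using out[of x] False uv by simp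
    then show ?thesis
    proof (rule has_vector_derivative_transform_within_open[where S = "{..<u}"])
      show "0 = G y" if "y \<in> {..<u}" for y using G[of y] that by simp
    qed (use False in auto)
  qed
  have Gout: "G x = 0" if "x \<notin> {u..v}" for x
  proof (cases "x < u")
    case False
    then have x: "v < x" using that by auto
    have "integral {u..v} \<psi> + integral {v..x} \<psi> = integral {u..x} \<psi>"
      using x uv by (intro Henstock_Kurzweil_Integration.integral_combine ii) auto
    then show ?thesis using G[of x] False z0[of x v] zero by simp
  qed (use G[of x] in simp)
  show ?thesis
    unfolding C1c_test_def G[abs_def] using Gd cont Gout I by (metis compact_Icc)
qed

text \<open>The primitive of \<open>A T - B T'\<close> is a test function if \<open>T\<close> and \<open>T'\<close> are trapezoids with masses \<open>B\<close> and
  \<open>A\<close>. In the limit this shows that all averages of \<open>h\<close> over intervals agree.\<close>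

lemma du_Bois_Reymond:
  fixes h :: "real \<Rightarrow> complex"
  assumes ab: "a < b" and int: "set_integrable lebesgue {a<..<b} h"
    and weak: "\<And>\<phi> \<phi>'. C1c_test {a<..<b} \<phi> \<phi>' \<Longrightarrow> (LINT x:{a<..<b}|lebesgue. h x * \<phi>' x) = 0"
  obtains c where "AE x in lebesgue. x \<in> {a<..<b} \<longrightarrow> h x = c"
proof -
  \<comment> \<open>A fixed interval of reference, compactly contained in \<open>(a, b)\<close>.\<close>
  define p q where "p = (2 * a + b) / 3" and "q = (a + 2 * b) / 3"
  have pq: "a < p" "p < q" "q < b" using ab by (auto simp: p_def q_def field_simps)
  let ?I = "\<lambda>u v n. integral UNIV (trapez u v n)"
  let ?H = "\<lambda>u v n. (LINT x:{a<..<b}|lebesgue. h x * of_real (trapez u v n x))"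
  have hint: "set_integrable lebesgue {a<..<b} (\<lambda>x. h x * of_real (trapez u v n x))" for u v n
  proof (rule set_integrable_bound[OF int])
    have "(\<lambda>x. of_real (trapez u v n x) :: complex) \<in> borel_measurable borel"
      by (intro borel_measurable_continuous_onI continuous_intros)
    then have m: "(\<lambda>x. of_real (trapez u v n x) :: complex) \<in> borel_measurable lebesgue"
      by (simp add: borel_measurable_if_I measurable_completion)
    show "set_borel_measurable lebesgue {a<..<b} (\<lambda>x. h x * of_real (trapez u v n x))"
      using borel_measurable_times[OF _ m, of "\<lambda>x. indicator {a<..<b} x *\<^sub>R h x"] int
      unfolding set_borel_measurable_def set_integrable_def by (simp add: borel_measurable_integrable)
    show "AE x in lebesgue. x \<in> {a<..<b} \<longrightarrow> norm (h x * of_real (trapez u v n x)) \<le> norm (h x)"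
      using trapez_bounds by (auto simp: norm_mult mult_left_le abs_of_nonneg)
  qed
  have Hlim: "(\<lambda>n. ?H u v n) \<longlonglongrightarrow> (LINT x:{u<..<v}|lebesgue. h x)" if uv: "a < u" "v < b" for u v
  proof -
    have "(\<lambda>n. ?H u v n) \<longlonglongrightarrow> (LINT x:{a<..<b}|lebesgue. h x * of_real (indicator {u<..<v} x))"
      unfolding set_lebesgue_integral_def
    proof (rule integral_dominated_convergence)
      show "integrable lebesgue (\<lambda>x. norm (indicator {a<..<b} x *\<^sub>R h x))"
        by (rule integrable_norm[OF int[unfolded set_integrable_def]])
      show "(\<lambda>x. indicator {a<..<b} x *\<^sub>R (h x * of_real (trapez u v n x))) \<in> borel_measurable lebesgue" for n
        using hint[of u v n] by (simp add: set_integrable_def borel_measurable_integrable)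
      show "AE x in lebesgue. (\<lambda>n. indicator {a<..<b} x *\<^sub>R (h x * of_real (trapez u v n x)))
          \<longlonglongrightarrow> indicator {a<..<b} x *\<^sub>R (h x * of_real (indicator {u<..<v} x))"
        by (intro AE_I2 tendsto_intros trapez_tendsto)
      show "AE x in lebesgue. norm (indicator {a<..<b} x *\<^sub>R (h x * of_real (trapez u v n x))) \<le> norm (indicator {a<..<b} x *\<^sub>R h x)" for n
        using trapez_bounds by (auto simp: norm_mult mult_left_le abs_of_nonneg indicator_def)
      show "(\<lambda>x. indicator {a<..<b} x *\<^sub>R (h x * of_real (indicator {u<..<v} x))) \<in> borel_measurable lebesgue"
      proof -
        have "(\<lambda>x. of_real (indicator {u<..<v} x) :: complex) \<in> borel_measurable borel" by measurable
        then have "(\<lambda>x. of_real (indicator {u<..<v} x) :: complex) \<in> borel_measurable lebesgue"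
          by (simp add: measurable_completion)
        from borel_measurable_times[OF _ this, of "\<lambda>x. indicator {a<..<b} x *\<^sub>R h x"] int
        show ?thesis unfolding set_integrable_def by (simp add: borel_measurable_integrable)
      qed
    qed
    also have "(LINT x:{a<..<b}|lebesgue. h x * of_real (indicator {u<..<v} x)) = (LINT x:{u<..<v}|lebesgue. h x)"
      unfolding set_lebesgue_integral_def
      using uv by (intro Bochner_Integration.integral_cong) (auto simp: indicator_def)
    finally show ?thesis .
  qed
  have tint: "trapez u v n integrable_on {s..t}" for u v n s t
    by (intro integrable_continuous_real continuous_intros)
  have Ilim: "(\<lambda>n. integral {a..b} (trapez u v n)) \<longlonglongrightarrow> v - u" if uv: "a \<le> u" "u < v" "v \<le> b" for u v
  proof -
    have "(\<lambda>n. integral {a..b} (trapez u v n)) \<longlonglongrightarrow> integral {a..b} (indicator {u<..<v})"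
      using trapez_bounds by (intro dominated_convergence(2)[OF tint, of "\<lambda>_. 1"] trapez_tendsto) (auto simp: abs_of_nonneg)
    moreover have "(indicator {u<..<v} has_integral (v - u)) {a..b}"
    proof -
      have "((\<lambda>x. 1::real) has_integral (v - u)) {u..v}" using has_integral_const_real[of "1::real" u v] uv by simp
      then have "((\<lambda>x. if x \<in> {u..v} then 1::real else 0) has_integral (v - u)) {a..b}"
        using uv by (subst has_integral_restrict) auto
      then show ?thesis
        by (rule has_integral_spike[of "{u, v}", rotated -1]) (auto simp: indicator_def)
    qed
    ultimately show ?thesis by (simp add: integral_unique)
  qed
  have key: "?H u v n * of_real (integral {a..b} (trapez p q n)) = ?H p q n * of_real (integral {a..b} (trapez u v n))"
    if uv: "a < u" "u < v" "v < b" for u v n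
  proof -
    define A where "A = integral {a..b} (trapez p q n)"
    define B where "B = integral {a..b} (trapez u v n)"
    define s where "s = min u p"
    define t where "t = max v q"
    have st: "a < s" "s < t" "t < b" using uv pq by (auto simp: s_def t_def)
    define \<psi> where "\<psi> x = complex_of_real (A * trapez u v n x - B * trapez p q n x)" for x
    have int_st: "integral {s..t} (trapez u' v' n) = integral {a..b} (trapez u' v' n)" if "s \<le> u'" "v' \<le> t" for u' v'
    proof (rule integral_spike_set)
      have z: "trapez u' v' n x = 0" if "x \<notin> {s..t}" for x
        using that \<open>s \<le> u'\<close> \<open>v' \<le> t\<close> by (intro trapez_outside) auto
      have "{x \<in> {s..t} - {a..b}. trapez u' v' n x \<noteq> 0} = {}" "{x \<in> {a..b} - {s..t}. trapez u' v' n x \<noteq> 0} = {}"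
        using st z by auto
      then show "negligible {x \<in> {s..t} - {a..b}. trapez u' v' n x \<noteq> 0}" "negligible {x \<in> {a..b} - {s..t}. trapez u' v' n x \<noteq> 0}"
        by (simp_all only: negligible_empty)
    qed
    have "C1c_test {a<..<b} (\<lambda>x. if x < s then 0 else integral {s..x} \<psi>) \<psi>"
    proof (rule C1c_test_integral)
      show "continuous_on UNIV \<psi>" unfolding \<psi>_def by (intro continuous_intros)
      show "\<psi> x = 0" if "x \<notin> {s..t}" for x
      proof -
        have "x \<notin> {u<..<v}" "x \<notin> {p<..<q}" using that by (auto simp: s_def t_def)
        then show ?thesis by (simp add: \<psi>_def trapez_outside del: greaterThanLessThan_iff)
      qed
      have "integral {s..t} \<psi> = complex_of_real (integral {s..t} (\<lambda>x. A * trapez u v n x - B * trapez p q n x))"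
      proof -
        have "(\<lambda>x. A * trapez u v n x - B * trapez p q n x) integrable_on {s..t}"
          by (intro integrable_diff integrable_on_mult_right tint)
        from integral_linear[OF this bounded_linear_of_real[where 'a = complex]]
        show ?thesis by (simp only: o_def \<psi>_def [abs_def])
      qed
      also have "integral {s..t} (\<lambda>x. A * trapez u v n x - B * trapez p q n x) = A * integral {s..t} (trapez u v n) - B * integral {s..t} (trapez p q n)"
        by (subst Henstock_Kurzweil_Integration.integral_diff) (auto intro!: integrable_on_mult_right tint)
      also have "\<dots> = 0"
      proof -
        have "s \<le> u" "v \<le> t" "s \<le> p" "q \<le> t" by (auto simp: s_def t_def)
        then show ?thesis using int_st[of u v] int_st[of p q] by (simp add: A_def B_def)
      qed
      finally show "integral {s..t} \<psi> = 0" by simp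
    qed (use st in auto)
    from weak[OF this] have "0 = (LINT x:{a<..<b}|lebesgue. h x * \<psi> x)" by simp
    also have "\<dots> = (LINT x:{a<..<b}|lebesgue. of_real A * (h x * of_real (trapez u v n x)) - of_real B * (h x * of_real (trapez p q n x)))"
      by (simp add: \<psi>_def algebra_simps)
    also have "\<dots> = of_real A * ?H u v n - of_real B * ?H p q n"
      by (subst set_integral_diff) (auto intro!: set_integrable_mult_right hint)
    finally show ?thesis by (simp add: A_def B_def algebra_simps)
  qed
  define c where "c = (LINT x:{p<..<q}|lebesgue. h x) / of_real (q - p)"
  have eq: "(LINT x:{u<..<v}|lebesgue. h x) = of_real (v - u) * c" if uv: "a < u" "u < v" "v < b" for u v
  proof -
    have "(\<lambda>n. ?H u v n * of_real (integral {a..b} (trapez p q n))) \<longlonglongrightarrow> (LINT x:{u<..<v}|lebesgue. h x) * of_real (q - p)"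
      using uv pq by (intro tendsto_intros Hlim Ilim) auto
    moreover have "(\<lambda>n. ?H p q n * of_real (integral {a..b} (trapez u v n))) \<longlonglongrightarrow> (LINT x:{p<..<q}|lebesgue. h x) * of_real (v - u)"
      using uv pq by (intro tendsto_intros Hlim Ilim) auto
    ultimately have "(LINT x:{u<..<v}|lebesgue. h x) * of_real (q - p) = (LINT x:{p<..<q}|lebesgue. h x) * of_real (v - u)"
      using key[OF uv] LIMSEQ_unique by (simp only: )
    then show ?thesis using pq by (simp add: c_def field_simps)
  qed
  have "AE x in lebesgue. x \<in> {a<..<b} \<longrightarrow> h x - c = 0"
  proof (rule AE_zero_of_interval_integrals_zero[OF ab])
    have ci: "set_integrable lebesgue {u<..<v} (\<lambda>x. c)" for u v :: real
      by (rule absolutely_integrable_on_const) simp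
    show "set_integrable lebesgue {a<..<b} (\<lambda>x. h x - c)" by (intro set_integral_diff int ci)
    fix u v assume uv: "a < u" "u < v" "v < b"
    have "(LINT x:{u<..<v}|lebesgue. h x - c) = (LINT x:{u<..<v}|lebesgue. h x) - (LINT x:{u<..<v}|lebesgue. c)"
      using uv by (intro set_integral_diff ci set_integrable_subset[OF int]) auto
    also have "(LINT x:{u<..<v}|lebesgue. c) = of_real (v - u) * c"
      using uv by (simp add: set_lebesgue_integral_def scaleR_conv_of_real)
    finally show "(LINT x:{u<..<v}|lebesgue. h x - c) = 0" using eq[OF uv] by simp
  qed
  then have "AE x in lebesgue. x \<in> {a<..<b} \<longrightarrow> h x = c" by simp
  then show ?thesis by (rule that)
qed

section \<open>Exchange of integrals and integration by parts\<close>

lemma set_integrable_mult_bounded: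
  fixes u v :: "real \<Rightarrow> complex"
  assumes u: "set_integrable lebesgue A u" and v: "set_borel_measurable lebesgue A v"
    and K: "\<And>y. y \<in> A \<Longrightarrow> norm (v y) \<le> K"
  shows "set_integrable lebesgue A (\<lambda>y. u y * v y)"
proof (rule set_integrable_bound)
  show "set_integrable lebesgue A (\<lambda>y. of_real K * u y)" using u by (rule set_integrable_mult_right)
  have "(\<lambda>y. (indicator A y *\<^sub>R u y) * (indicator A y *\<^sub>R v y)) \<in> borel_measurable lebesgue"
    by (rule borel_measurable_times[OF borel_measurable_integrable[OF u[unfolded set_integrable_def]] v[unfolded set_borel_measurable_def]])
  also have "(\<lambda>y. (indicator A y *\<^sub>R u y) * (indicator A y *\<^sub>R v y)) = (\<lambda>y. indicator A y *\<^sub>R (u y * v y))"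
    by (auto simp: indicator_def)
  finally show "set_borel_measurable lebesgue A (\<lambda>y. u y * v y)" unfolding set_borel_measurable_def .
  have "norm (u y * v y) \<le> norm (of_real K * u y)" if "y \<in> A" for y
  proof -
    have "norm (v y) \<le> \<bar>K\<bar>" using K[OF that] by auto
    then show ?thesis by (simp add: norm_mult mult.commute[of "\<bar>K\<bar>"] mult_left_mono)
  qed
  then show "AE y in lebesgue. y \<in> A \<longrightarrow> norm (u y * v y) \<le> norm (of_real K * u y)" by simp
qed

lemma set_integrable_mult_continuous:
  fixes u v :: "real \<Rightarrow> complex"
  assumes u: "set_integrable lebesgue {a<..<b} u" and v: "continuous_on {a..b} v"
  shows "set_integrable lebesgue {a<..<b} (\<lambda>y. u y * v y)"
proof -
  obtain K where K: "\<And>y. y \<in> {a..b} \<Longrightarrow> norm (v y) \<le> K"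
    using compact_imp_bounded[OF compact_continuous_image[OF v compact_Icc]] by (metis bounded_iff imageI)
  have "set_integrable lebesgue {a<..<b} v"
    by (rule set_integrable_subset[OF absolutely_integrable_continuous_real[OF v]]) auto
  then have "set_borel_measurable lebesgue {a<..<b} v"
    unfolding set_integrable_def set_borel_measurable_def by (rule borel_measurable_integrable)
  from set_integrable_mult_bounded[OF u this, of K] K show ?thesis by auto
qed

lemma sigma_finite_lebesgue: "sigma_finite_measure (lebesgue :: real measure)"
proof
  obtain A :: "real set set" where A: "countable A" "A \<subseteq> sets lborel" "\<Union>A = space lborel" "\<forall>a\<in>A. emeasure lborel a \<noteq> \<infinity>"
    using lborel.sigma_finite_countable by blast
  show "\<exists>A. countable A \<and> A \<subseteq> sets (lebesgue :: real measure) \<and> \<Union>A = space lebesgue \<and> (\<forall>a\<in>A. emeasure lebesgue a \<noteq> \<infinity>)"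
    using A by (intro exI[of _ A]) auto
qed

interpretation lebesgue_pair: pair_sigma_finite "lebesgue :: real measure" "lebesgue :: real measure"
  by (intro pair_sigma_finite.intro sigma_finite_lebesgue)

text \<open>Both the exchange of contour integrals with integrals over the data and integration by parts for
  primitives of integrable functions are instances.\<close>

lemma Fubini_bounded_kernel:
  fixes h k :: "real \<Rightarrow> complex" and E :: "real \<Rightarrow> real \<Rightarrow> complex"
  assumes h: "integrable lebesgue h" and k: "integrable lebesgue k"
    and E: "(\<lambda>z. E (fst z) (snd z)) \<in> borel_measurable (borel \<Otimes>\<^sub>M borel)"
    and B: "\<And>x y. k x \<noteq> 0 \<Longrightarrow> h y \<noteq> 0 \<Longrightarrow> norm (E x y) \<le> B"
  shows "(LINT y|lebesgue. (LINT x|lebesgue. E x y * k x) * h y) = (LINT x|lebesgue. (LINT y|lebesgue. E x y * h y) * k x)"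
    and "integrable lebesgue (\<lambda>x. (LINT y|lebesgue. E x y * h y) * k x)"
    and "integrable lebesgue (\<lambda>y. (LINT x|lebesgue. E x y * k x) * h y)"
proof -
  let ?f = "\<lambda>x y. E x y * k x * h y"
  have m: "(\<lambda>z. E (fst z) (snd z)) \<in> borel_measurable (lebesgue \<Otimes>\<^sub>M lebesgue)"
  proof -
    have i: "(\<lambda>x::real. x) \<in> borel_measurable lebesgue"
      using id_borel_measurable_lebesgue by (simp add: id_def)
    have 1: "(\<lambda>z. (fst z, snd z)) \<in> (lebesgue \<Otimes>\<^sub>M lebesgue) \<rightarrow>\<^sub>M ((borel :: real measure) \<Otimes>\<^sub>M (borel :: real measure))"
      by (rule measurable_Pair[OF measurable_compose[OF measurable_fst i] measurable_compose[OF measurable_snd i]])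
    from measurable_compose[OF 1 E] show ?thesis by simp
  qed
  have mk: "k \<in> borel_measurable lebesgue" and mh: "h \<in> borel_measurable lebesgue"
    using h k by (auto intro: borel_measurable_integrable)
  have mf: "case_prod ?f \<in> borel_measurable (lebesgue \<Otimes>\<^sub>M lebesgue)"
    using borel_measurable_times[OF borel_measurable_times[OF m measurable_compose[OF measurable_fst mk]] measurable_compose[OF measurable_snd mh]]
    by (simp add: case_prod_beta)
  have bd: "norm (?f x y) \<le> B * norm (k x) * norm (h y)" for x y
  proof (cases "k x = 0 \<or> h y = 0")
    case False
    then show ?thesis unfolding norm_mult by (intro mult_right_mono B) auto
  qed auto
  have B': "norm (?f x y) \<le> \<bar>B\<bar> * norm (k x) * norm (h y)" for x y
    using bd[of x y] by (smt (verit) mult_right_mono norm_ge_zero)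
  have inner: "integrable lebesgue (\<lambda>y. ?f x y)" for x
  proof (rule Bochner_Integration.integrable_bound)
    show "integrable lebesgue (\<lambda>y. \<bar>B\<bar> * norm (k x) * norm (h y))"
      by (intro integrable_mult_right integrable_norm h)
    show "(\<lambda>y. ?f x y) \<in> borel_measurable lebesgue"
      using measurable_compose[OF measurable_Pair1' mf, of x] by simp
    show "AE y in lebesgue. norm (?f x y) \<le> norm (\<bar>B\<bar> * norm (k x) * norm (h y))"
      using B'[of x] by (intro AE_I2) (smt (verit) norm_ge_zero real_norm_def)
  qed
  have f: "integrable (lebesgue \<Otimes>\<^sub>M lebesgue) (case_prod ?f)"
  proof (rule lebesgue_pair.Fubini_integrable)
    show "case_prod ?f \<in> borel_measurable (lebesgue \<Otimes>\<^sub>M lebesgue)" by (rule mf)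
    show "AE x in lebesgue. integrable lebesgue (\<lambda>y. case_prod ?f (x, y))" using inner by simp
    show "integrable lebesgue (\<lambda>x. LINT y|lebesgue. norm (case_prod ?f (x, y)))"
    proof (rule Bochner_Integration.integrable_bound)
      show "integrable lebesgue (\<lambda>x. \<bar>B\<bar> * norm (k x) * (LINT y|lebesgue. norm (h y)))"
        by (intro integrable_mult_left integrable_mult_right integrable_norm k)
      show "(\<lambda>x. LINT y|lebesgue. norm (case_prod ?f (x, y))) \<in> borel_measurable lebesgue"
        using measurable_compose[OF mf borel_measurable_norm]
        by (intro sigma_finite_measure.borel_measurable_lebesgue_integral[OF sigma_finite_lebesgue]) (simp add: case_prod_beta')
      show "AE x in lebesgue. norm (LINT y|lebesgue. norm (case_prod ?f (x, y))) \<le> norm (\<bar>B\<bar> * norm (k x) * (LINT y|lebesgue. norm (h y)))"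
      proof (intro AE_I2)
        fix x
        have "(LINT y|lebesgue. norm (?f x y)) \<le> (LINT y|lebesgue. \<bar>B\<bar> * norm (k x) * norm (h y))"
          by (intro integral_mono integrable_norm inner integrable_mult_right h B')
        moreover have "0 \<le> (LINT y|lebesgue. norm (?f x y))" by simp
        ultimately show "norm (LINT y|lebesgue. norm (case_prod ?f (x, y))) \<le> norm (\<bar>B\<bar> * norm (k x) * (LINT y|lebesgue. norm (h y)))"
          by simp
      qed
    qed
  qed
  have 1: "(LINT x|lebesgue. ?f x y) = (LINT x|lebesgue. E x y * k x) * h y" for y by simp
  have 2: "(LINT y|lebesgue. ?f x y) = (LINT y|lebesgue. E x y * h y) * k x" for x
  proof -
    have "(LINT y|lebesgue. ?f x y) = (LINT y|lebesgue. (E x y * h y) * k x)" by (simp add: mult_ac)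
    then show ?thesis by simp
  qed
  show "(LINT y|lebesgue. (LINT x|lebesgue. E x y * k x) * h y) = (LINT x|lebesgue. (LINT y|lebesgue. E x y * h y) * k x)"
    using lebesgue_pair.Fubini_integral[OF f] by (simp only: 1 2)
  show "integrable lebesgue (\<lambda>x. (LINT y|lebesgue. E x y * h y) * k x)"
    using lebesgue_pair.integrable_fst[OF f] by (simp only: 2)
  show "integrable lebesgue (\<lambda>y. (LINT x|lebesgue. E x y * k x) * h y)"
    using lebesgue_pair.integrable_snd[OF f] by (simp only: 1)
qed

lemma contour_integral_set_integral_swap:
  fixes h :: "real \<Rightarrow> complex" and e :: "complex \<Rightarrow> real \<Rightarrow> complex"
  assumes h: "set_integrable lebesgue A h"
    and e: "continuous_on UNIV (\<lambda>z. e (fst z) (snd z))"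
    and B: "\<And>k y. k \<in> closed_segment a b \<Longrightarrow> y \<in> A \<Longrightarrow> norm (e k y) \<le> B"
  shows "((\<lambda>k. LINT y:A|lebesgue. e k y * h y) has_contour_integral
      (LINT y:A|lebesgue. contour_integral (linepath a b) (\<lambda>k. e k y) * h y)) (linepath a b)"
    and "set_integrable lebesgue A (\<lambda>y. contour_integral (linepath a b) (\<lambda>k. e k y) * h y)"
proof -
  let ?h = "\<lambda>y. indicator A y *\<^sub>R h y"
  let ?k = "\<lambda>u. indicator {0..1} u *\<^sub>R (b - a)"
  let ?E = "\<lambda>u y. e (linepath a b u) y"
  have lp: "linepath a b u \<in> closed_segment a b" if "u \<in> {0..1}" for u
    using that by (metis imageI linepath_image_01)
  have k: "set_integrable lebesgue {0..1::real} (\<lambda>_. b - a)" by (rule absolutely_integrable_on_const) simp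
  have E: "(\<lambda>z. ?E (fst z) (snd z)) \<in> borel_measurable (borel \<Otimes>\<^sub>M borel)"
  proof -
    have "continuous_on UNIV (\<lambda>z. (\<lambda>z. e (fst z) (snd z)) (linepath a b (fst z), snd z))"
      by (rule continuous_on_compose2[OF e]) (auto intro!: continuous_intros simp: linepath_def)
    then show ?thesis unfolding borel_prod by (intro borel_measurable_continuous_onI) simp
  qed
  note F = Fubini_bounded_kernel[OF h[unfolded set_integrable_def] k[unfolded set_integrable_def] E, of B]
  have B': "norm (?E u y) \<le> B" if "?k u \<noteq> 0" "?h y \<noteq> 0" for u y
    using that by (intro B lp) (auto simp: indicator_def split: if_splits)
  have inner: "(LINT u|lebesgue. ?E u y * ?k u) = contour_integral (linepath a b) (\<lambda>k. e k y)" for y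
  proof -
    have c: "continuous_on {0..1} (\<lambda>u. ?E u y * (b - a))"
    proof (intro continuous_intros)
      have "continuous_on {0..1} (\<lambda>u. (\<lambda>z. e (fst z) (snd z)) (linepath a b u, y))"
        by (rule continuous_on_compose2[OF e]) (auto intro!: continuous_intros simp: linepath_def)
      then show "continuous_on {0..1} (\<lambda>u. ?E u y)" by simp
    qed
    have "(LINT u|lebesgue. ?E u y * ?k u) = (LINT u:{0..1}|lebesgue. ?E u y * (b - a))"
      unfolding set_lebesgue_integral_def by simp
    also have "\<dots> = integral {0..1} (\<lambda>u. ?E u y * (b - a))"
      by (rule set_lebesgue_integral_eq_integral(2)) (rule absolutely_integrable_continuous_real[OF c])
    finally show ?thesis by (simp add: contour_integral_integral vector_derivative_linepath_within)
  qed
  have "((\<lambda>u. (LINT y:A|lebesgue. e (linepath a b u) y * h y) * (b - a)) has_integral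
      (LINT y:A|lebesgue. contour_integral (linepath a b) (\<lambda>k. e k y) * h y)) {0..1}"
  proof -
    have i: "set_integrable lebesgue {0..1} (\<lambda>u. (LINT y:A|lebesgue. e (linepath a b u) y * h y) * (b - a))"
      using F(2)[OF B'] unfolding set_integrable_def set_lebesgue_integral_def by simp
    have "(LINT u:{0..1}|lebesgue. (LINT y:A|lebesgue. e (linepath a b u) y * h y) * (b - a))
       = (LINT u|lebesgue. (LINT y|lebesgue. ?E u y * ?h y) * ?k u)"
      unfolding set_lebesgue_integral_def by simp
    also have "\<dots> = (LINT y|lebesgue. (LINT u|lebesgue. ?E u y * ?k u) * ?h y)" using F(1)[OF B'] by simp
    also have "\<dots> = (LINT y:A|lebesgue. contour_integral (linepath a b) (\<lambda>k. e k y) * h y)"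
      unfolding inner set_lebesgue_integral_def by simp
    finally show ?thesis
      using has_integral_set_lebesgue[OF i] by simp
  qed
  then show "((\<lambda>k. LINT y:A|lebesgue. e k y * h y) has_contour_integral
      (LINT y:A|lebesgue. contour_integral (linepath a b) (\<lambda>k. e k y) * h y)) (linepath a b)"
    by (simp add: has_contour_integral_linepath)
  show "set_integrable lebesgue A (\<lambda>y. contour_integral (linepath a b) (\<lambda>k. e k y) * h y)"
    using F(3)[OF B'] unfolding inner set_integrable_def by simp
qed

lemma contour_integral_set_integral_swap_join:
  fixes h :: "real \<Rightarrow> complex" and e :: "complex \<Rightarrow> real \<Rightarrow> complex"
  assumes h: "set_integrable lebesgue A h"
    and e: "continuous_on UNIV (\<lambda>z. e (fst z) (snd z))"
    and B: "\<And>k y. k \<in> closed_segment a b \<union> closed_segment b c \<Longrightarrow> y \<in> A \<Longrightarrow> norm (e k y) \<le> B"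
  defines "g \<equiv> linepath a b +++ linepath b c"
  shows "((\<lambda>k. LINT y:A|lebesgue. e k y * h y) has_contour_integral
      (LINT y:A|lebesgue. contour_integral g (\<lambda>k. e k y) * h y)) g"
    and "set_integrable lebesgue A (\<lambda>y. contour_integral g (\<lambda>k. e k y) * h y)"
proof -
  have B1: "norm (e k y) \<le> B" if "k \<in> closed_segment a b" "y \<in> A" for k y using B that by auto
  have B2: "norm (e k y) \<le> B" if "k \<in> closed_segment b c" "y \<in> A" for k y using B that by auto
  note 1 = contour_integral_set_integral_swap[OF h e B1]
  note 2 = contour_integral_set_integral_swap[OF h e B2]
  have ec: "continuous_on S (\<lambda>k. e k y)" for S y
  proof -
    have "continuous_on S (\<lambda>k. (\<lambda>z. e (fst z) (snd z)) (k, y))"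
      by (rule continuous_on_compose2[OF e]) (auto intro!: continuous_intros)
    then show ?thesis by simp
  qed
  have g: "contour_integral g (\<lambda>k. e k y) * h y
     = contour_integral (linepath a b) (\<lambda>k. e k y) * h y + contour_integral (linepath b c) (\<lambda>k. e k y) * h y" for y
    unfolding g_def
    by (simp add: contour_integrable_continuous_linepath ec distrib_right)
  show "set_integrable lebesgue A (\<lambda>y. contour_integral g (\<lambda>k. e k y) * h y)"
    unfolding g using 1(2) 2(2) by (rule set_integral_add(1))
  show "((\<lambda>k. LINT y:A|lebesgue. e k y * h y) has_contour_integral
      (LINT y:A|lebesgue. contour_integral g (\<lambda>k. e k y) * h y)) g"
  proof -
    have "(LINT y:A|lebesgue. contour_integral g (\<lambda>k. e k y) * h y)
      = (LINT y:A|lebesgue. contour_integral (linepath a b) (\<lambda>k. e k y) * h y)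
      + (LINT y:A|lebesgue. contour_integral (linepath b c) (\<lambda>k. e k y) * h y)"
      unfolding g using 1(2) 2(2) by (rule set_integral_add(2))
    moreover have "((\<lambda>k. LINT y:A|lebesgue. e k y * h y) has_contour_integral
        (LINT y:A|lebesgue. contour_integral (linepath a b) (\<lambda>k. e k y) * h y)
      + (LINT y:A|lebesgue. contour_integral (linepath b c) (\<lambda>k. e k y) * h y)) g"
      unfolding g_def by (intro has_contour_integral_join 1(1) 2(1)) auto
    ultimately show ?thesis by simp
  qed
qed

lemma set_integral_FTC:
  fixes S S' :: "real \<Rightarrow> complex"
  assumes "a \<le> b" and d: "\<And>x. x \<in> {a..b} \<Longrightarrow> (S has_vector_derivative S' x) (at x within {a..b})"
    and c: "continuous_on {a..b} S'"
  shows "(LINT x:{a<..<b}|lebesgue. S' x) = S b - S a"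
proof -
  have i: "set_integrable lebesgue {a<..<b} S'"
    by (rule set_integrable_subset[OF absolutely_integrable_continuous_real[OF c]]) auto
  have "(LINT x:{a<..<b}|lebesgue. S' x) = integral {a<..<b} S'"
    by (rule set_lebesgue_integral_eq_integral(2)[OF i])
  also have "\<dots> = integral {a..b} S'" by (simp add: integral_open_interval_real)
  also have "\<dots> = S b - S a"
    by (rule integral_unique[OF fundamental_theorem_of_calculus[OF assms(1) d]])
  finally show ?thesis .
qed

text \<open>Fubini on the triangle \<open>y < x\<close>, so that no derivative of the primitive of \<open>g\<close> enters.\<close>

lemma set_integral_by_parts:
  fixes g S S' :: "real \<Rightarrow> complex"
  assumes ab: "a < b" and g: "set_integrable lebesgue {a<..<b} g"
    and d: "\<And>x. x \<in> {a..b} \<Longrightarrow> (S has_vector_derivative S' x) (at x within {a..b})"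
    and c: "continuous_on {a..b} S'"
  shows "(LINT x:{a<..<b}|lebesgue. (LINT y:{a<..<x}|lebesgue. g y) * S' x)
      = (LINT y:{a<..<b}|lebesgue. g y) * S b - (LINT y:{a<..<b}|lebesgue. g y * S y)"
    and "set_integrable lebesgue {a<..<b} (\<lambda>x. (LINT y:{a<..<x}|lebesgue. g y) * S' x)"
    and "set_integrable lebesgue {a<..<b} (\<lambda>y. g y * S y)"
proof -
  let ?h = "\<lambda>y. indicator {a<..<b} y *\<^sub>R g y"
  let ?k = "\<lambda>x. indicator {a<..<b} x *\<^sub>R S' x"
  let ?E = "\<lambda>x y. indicator {z :: real \<times> real. snd z < fst z} (x, y) :: complex"
  have kc: "set_integrable lebesgue {a<..<b} S'"
    by (rule set_integrable_subset[OF absolutely_integrable_continuous_real[OF c]]) auto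
  have "open {z :: real \<times> real. snd z < fst z}" by (intro open_Collect_less continuous_intros)
  then have "(indicator {z :: real \<times> real. snd z < fst z} :: _ \<Rightarrow> complex) \<in> borel_measurable borel"
    by (intro borel_measurable_indicator borel_open)
  then have E: "(\<lambda>z. ?E (fst z) (snd z)) \<in> borel_measurable (borel \<Otimes>\<^sub>M borel)"
    by (simp only: borel_prod prod.collapse)
  note F = Fubini_bounded_kernel[OF g[unfolded set_integrable_def] kc[unfolded set_integrable_def] E, of 1]
  have B: "norm (?E x y) \<le> 1" for x y by (simp add: indicator_def)
  have in1: "(LINT y|lebesgue. ?E x y * ?h y) * ?k x = indicator {a<..<b} x *\<^sub>R ((LINT y:{a<..<x}|lebesgue. g y) * S' x)" for x
  proof (cases "x \<in> {a<..<b}")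
    case True
    have "(LINT y|lebesgue. ?E x y * ?h y) = (LINT y:{a<..<x}|lebesgue. g y)"
      unfolding set_lebesgue_integral_def
      using True by (intro Bochner_Integration.integral_cong) (auto simp: indicator_def)
    then show ?thesis using True by simp
  qed simp
  have in2: "(LINT x|lebesgue. ?E x y * ?k x) * ?h y = indicator {a<..<b} y *\<^sub>R ((S b - S y) * g y)" for y
  proof (cases "y \<in> {a<..<b}")
    case True
    have "(LINT x|lebesgue. ?E x y * ?k x) = (LINT x:{y<..<b}|lebesgue. S' x)"
      unfolding set_lebesgue_integral_def
      using True by (intro Bochner_Integration.integral_cong) (auto simp: indicator_def)
    also have "\<dots> = S b - S y"
    proof (rule set_integral_FTC)
      show "(S has_vector_derivative S' x) (at x within {y..b})" if "x \<in> {y..b}" for x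
        using that True by (intro has_vector_derivative_within_subset[OF d]) auto
      show "continuous_on {y..b} S'" using True by (intro continuous_on_subset[OF c]) auto
    qed (use True in auto)
    finally show ?thesis using True by simp
  qed simp
  show "set_integrable lebesgue {a<..<b} (\<lambda>x. (LINT y:{a<..<x}|lebesgue. g y) * S' x)"
    using F(2)[OF B] unfolding in1 set_integrable_def by simp
  show gS: "set_integrable lebesgue {a<..<b} (\<lambda>y. g y * S y)"
  proof -
    have "continuous_on {a..b} S" using d by (intro continuous_on_vector_derivative)
    then show ?thesis by (rule set_integrable_mult_continuous[OF g])
  qed
  have "(LINT x:{a<..<b}|lebesgue. (LINT y:{a<..<x}|lebesgue. g y) * S' x) = (LINT y:{a<..<b}|lebesgue. (S b - S y) * g y)"
    using F(1)[OF B] unfolding in1 in2 set_lebesgue_integral_def by simp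
  also have "\<dots> = (LINT y:{a<..<b}|lebesgue. S b * g y - g y * S y)"
    by (simp add: algebra_simps)
  also have "\<dots> = S b * (LINT y:{a<..<b}|lebesgue. g y) - (LINT y:{a<..<b}|lebesgue. g y * S y)"
    using set_integral_diff(2)[OF set_integrable_mult_right[OF g, of "S b"] gS] by simp
  finally show "(LINT x:{a<..<b}|lebesgue. (LINT y:{a<..<x}|lebesgue. g y) * S' x)
      = (LINT y:{a<..<b}|lebesgue. g y) * S b - (LINT y:{a<..<b}|lebesgue. g y * S y)" by simp
qed

section \<open>One-sided limits and primitives of Sobolev functions\<close>

lemma C1c_test_mono: "C1c_test I \<phi> \<phi>' \<Longrightarrow> I \<subseteq> I' \<Longrightarrow> C1c_test I' \<phi> \<phi>'"
  unfolding C1c_test_def by (meson order_trans)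

lemma C1c_test_outside:
  assumes "C1c_test I \<phi> \<phi>'" "x \<notin> I"
  shows "\<phi> x = 0" "\<phi>' x = 0"
proof -
  obtain C where C: "C \<subseteq> I" "compact C" "\<And>x. x \<notin> C \<Longrightarrow> \<phi> x = 0"
    and d: "(\<phi> has_vector_derivative \<phi>' x) (at x)"
    using assms(1) unfolding C1c_test_def by blast
  show "\<phi> x = 0" using C assms(2) by blast
  have "open (- C)" using compact_imp_closed[OF C(2)] by (simp add: open_Compl)
  then have "((\<lambda>_. 0) has_vector_derivative \<phi>' x) (at x)"
    using C assms(2) by (intro has_vector_derivative_transform_within_open[OF d, of "- C"]) auto
  then show "\<phi>' x = 0" using vector_derivative_unique_at has_vector_derivative_const by metis
qed

lemma L2_on_subset:
  assumes "L2_on I f" "J \<subseteq> I" "J \<in> sets lebesgue"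
  shows "L2_on J f"
  using assms set_borel_measurable_subset set_integrable_subset unfolding L2_on_def by metis

text \<open>The condition on the weak derivative in \<open>H1_on\<close>, isolated so that it can be restricted to
  subintervals with the same \<open>g\<close>.\<close>

definition weak_derivative :: "real set \<Rightarrow> (real \<Rightarrow> complex) \<Rightarrow> (real \<Rightarrow> complex) \<Rightarrow> bool" where
  "weak_derivative I f g \<longleftrightarrow> (\<forall>\<phi> \<phi>'. C1c_test I \<phi> \<phi>' \<longrightarrow>
     (LINT x:I|lebesgue. f x * \<phi>' x) = - (LINT x:I|lebesgue. g x * \<phi> x))"

lemma weak_derivative_subset:
  assumes "weak_derivative I f g" "J \<subseteq> I"
  shows "weak_derivative J f g"
  unfolding weak_derivative_def
proof (intro allI impI)
  fix \<phi> \<phi>' assume t: "C1c_test J \<phi> \<phi>'"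
  have eq: "(LINT x:J|lebesgue. u x) = (LINT x:I|lebesgue. u x)" if "\<And>x. x \<notin> J \<Longrightarrow> u x = 0" for u :: "real \<Rightarrow> complex"
    unfolding set_lebesgue_integral_def using that assms(2)
    by (intro Bochner_Integration.integral_cong) (auto simp: indicator_def)
  show "(LINT x:J|lebesgue. f x * \<phi>' x) = - (LINT x:J|lebesgue. g x * \<phi> x)"
    using assms(1) C1c_test_mono[OF t assms(2)] C1c_test_outside[OF t]
    by (simp add: eq weak_derivative_def)
qed

lemma weak_derivative_primitive:
  assumes ab: "a < b" and f: "set_integrable lebesgue {a<..<b} f" and g: "set_integrable lebesgue {a<..<b} g"
    and w: "weak_derivative {a<..<b} f g"
  obtains c where "AE x in lebesgue. x \<in> {a<..<b} \<longrightarrow> f x = c + (LINT y:{a<..<x}|lebesgue. g y)"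
proof -
  define G where "G x = (LINT y:{a<..<x}|lebesgue. g y)" for x
  have G: "set_integrable lebesgue {a<..<b} G"
  proof -
    have "set_integrable lebesgue {a<..<b} (\<lambda>x. (LINT y:{a<..<x}|lebesgue. g y) * 1)"
    proof (rule set_integral_by_parts(2)[OF ab g, of complex_of_real "\<lambda>_. 1"])
      show "(complex_of_real has_vector_derivative 1) (at x within {a..b})" for x
        using has_vector_derivative_of_real[OF DERIV_ident] by simp
    qed (rule continuous_on_const)
    then show ?thesis by (simp add: G_def [abs_def])
  qed
  have ts: "set_integrable lebesgue {a<..<b} (\<lambda>x. u x * v x)"
    if u: "set_integrable lebesgue {a<..<b} u" and v: "continuous_on UNIV v" for u v :: "real \<Rightarrow> complex"
    using u by (rule set_integrable_mult_continuous) (rule continuous_on_subset[OF v], simp)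
  have weak: "(LINT x:{a<..<b}|lebesgue. (f x - G x) * \<phi>' x) = 0" if t: "C1c_test {a<..<b} \<phi> \<phi>'" for \<phi> \<phi>'
  proof -
    have d: "(\<phi> has_vector_derivative \<phi>' x) (at x)" for x using t by (simp add: C1c_test_def)
    have c': "continuous_on UNIV \<phi>'" using t by (simp add: C1c_test_def)
    have "(LINT x:{a<..<b}|lebesgue. G x * \<phi>' x)
        = (LINT y:{a<..<b}|lebesgue. g y) * \<phi> b - (LINT y:{a<..<b}|lebesgue. g y * \<phi> y)"
      unfolding G_def
      by (rule set_integral_by_parts(1)[OF ab g])
         (auto intro: has_vector_derivative_at_within[OF d] continuous_on_subset[OF c'])
    also have "\<phi> b = 0" using C1c_test_outside[OF t, of b] by simp
    finally have "(LINT x:{a<..<b}|lebesgue. G x * \<phi>' x) = (LINT x:{a<..<b}|lebesgue. f x * \<phi>' x)"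
      using w t by (simp add: weak_derivative_def)
    moreover have "(LINT x:{a<..<b}|lebesgue. (f x - G x) * \<phi>' x)
      = (LINT x:{a<..<b}|lebesgue. f x * \<phi>' x) - (LINT x:{a<..<b}|lebesgue. G x * \<phi>' x)"
      unfolding left_diff_distrib by (intro set_integral_diff ts f G c')
    ultimately show ?thesis by simp
  qed
  obtain c where c: "AE x in lebesgue. x \<in> {a<..<b} \<longrightarrow> f x - G x = c"
    by (rule du_Bois_Reymond[OF ab set_integral_diff(1)[OF f G] weak])
  have "AE x in lebesgue. x \<in> {a<..<b} \<longrightarrow> f x = c + G x"
    using c by eventually_elim (simp add: diff_eq_eq)
  then show ?thesis unfolding G_def by (rule that)
qed

lemma H1_on_interval:
  assumes "H1_on {a<..<b} f" "a < b"
  obtains g c where "L2_on {a<..<b} g"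
    "AE x in lebesgue. x \<in> {a<..<b} \<longrightarrow> f x = c + (LINT y:{a<..<x}|lebesgue. g y)"
proof -
  obtain g where g: "L2_on {a<..<b} f" "L2_on {a<..<b} g" "weak_derivative {a<..<b} f g"
    using assms(1) unfolding H1_on_def weak_derivative_def by blast
  obtain c where "AE x in lebesgue. x \<in> {a<..<b} \<longrightarrow> f x = c + (LINT y:{a<..<x}|lebesgue. g y)"
    by (rule weak_derivative_primitive[OF assms(2) g(1,2)[THEN set_integrable_L2_interval] g(3)])
  with g(2) show ?thesis by (rule that)
qed

lemma not_AE_False_interval:
  assumes "a < b" "AE x in lebesgue. x \<notin> {a<..<b::real}"
  shows False
proof -
  obtain N where N: "negligible N" "{x. \<not> x \<notin> {a<..<b}} \<subseteq> N"
    using assms(2) unfolding eventually_ae_filter_negligible by blast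
  then have "negligible {a<..<b}" by (elim negligible_subset) auto
  then show False using assms(1) open_not_negligible[of "{a<..<b}"] by auto
qed

text \<open>Every bounded interval \<open>(a, a + n)\<close> yields a constant, and these agree because the intervals overlap.\<close>

lemma H1_on_half_line:
  assumes "H1_on {a<..} f"
  obtains g c where "L2_on {a<..} g"
    "AE x in lebesgue. x \<in> {a<..} \<longrightarrow> f x = c + (LINT y:{a<..<x}|lebesgue. g y)"
proof -
  obtain g where g: "L2_on {a<..} f" "L2_on {a<..} g" "weak_derivative {a<..} f g"
    using assms(1) unfolding H1_on_def weak_derivative_def by blast
  define G where "G x = (LINT y:{a<..<x}|lebesgue. g y)" for x
  have "\<exists>c. AE x in lebesgue. x \<in> {a<..<a + real (Suc n)} \<longrightarrow> f x = c + G x" for n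
  proof -
    have sub: "{a<..<a + real (Suc n)} \<subseteq> {a<..}" by auto
    have i: "set_integrable lebesgue {a<..<a + real (Suc n)} u" if "L2_on {a<..} u" for u
      by (intro set_integrable_L2_interval L2_on_subset[OF that sub]) auto
    have "a < a + real (Suc n)" by simp
    then obtain c where "AE x in lebesgue. x \<in> {a<..<a + real (Suc n)} \<longrightarrow> f x = c + (LINT y:{a<..<x}|lebesgue. g y)"
      by (rule weak_derivative_primitive[OF _ i[OF g(1)] i[OF g(2)] weak_derivative_subset[OF g(3) sub]])
    then show ?thesis unfolding G_def by (intro exI)
  qed
  then obtain c where c: "\<And>n. AE x in lebesgue. x \<in> {a<..<a + real (Suc n)} \<longrightarrow> f x = c n + G x" by metis
  have cn: "c n = c 0" for n
  proof (rule ccontr)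
    assume ne: "c n \<noteq> c 0"
    have "AE x in lebesgue. x \<notin> {a<..<a + 1}"
      using c[of n] c[of 0] by eventually_elim (use ne in auto)
    then show False by (rule not_AE_False_interval[rotated]) simp
  qed
  have "AE x in lebesgue. \<forall>n. x \<in> {a<..<a + real (Suc n)} \<longrightarrow> f x = c n + G x"
    unfolding AE_all_countable using c by blast
  then have "AE x in lebesgue. x \<in> {a<..} \<longrightarrow> f x = c 0 + G x"
  proof eventually_elim
    case (elim x)
    show ?case
    proof
      assume x: "x \<in> {a<..}"
      obtain n where "x - a < real n" using reals_Archimedean2 by blast
      then have "x \<in> {a<..<a + real (Suc n)}" using x by auto
      then show "f x = c 0 + G x" using elim cn by metis
    qed
  qed
  with g(2) show ?thesis unfolding G_def by (rule that)
qed

abbreviation square_integral :: "real set \<Rightarrow> (real \<Rightarrow> complex) \<Rightarrow> real" where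
  "square_integral I g \<equiv> LINT y:I|lebesgue. (norm (g y))\<^sup>2"

text \<open>The Cauchy-Schwarz inequality in additive form: \<open>2 |g| \<le> m |g|\<^sup>2 + 1 / m\<close> with \<open>m = \<surd>(v - u)\<close>.\<close>

lemma L2_on_integral_bound:
  assumes "L2_on I g" "{u<..<v} \<subseteq> I" "u < v"
  shows "(LINT y:{u<..<v}|lebesgue. norm (g y)) \<le> sqrt (v - u) * (square_integral I g + 1) / 2"
proof -
  define m where "m = sqrt (v - u)"
  have m: "m > 0" "m * m = v - u" using assms by (auto simp: m_def)
  have L: "L2_on {u<..<v} g" using assms by (auto intro: L2_on_subset)
  have i2: "set_integrable lebesgue {u<..<v} (\<lambda>y. (norm (g y))\<^sup>2)" using L by (simp add: L2_on_def)
  have ci: "set_integrable lebesgue {u<..<v} (\<lambda>y::real. 1 / m)" by (rule absolutely_integrable_on_const) simp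
  have "(LINT y:{u<..<v}|lebesgue. norm (g y)) \<le> (LINT y:{u<..<v}|lebesgue. (m * (norm (g y))\<^sup>2 + 1 / m) / 2)"
  proof (rule set_integral_mono)
    show "set_integrable lebesgue {u<..<v} (\<lambda>y. norm (g y))"
      using set_integrable_L2_interval[OF L] by (rule set_integrable_norm)
    show "set_integrable lebesgue {u<..<v} (\<lambda>y. (m * (norm (g y))\<^sup>2 + 1 / m) / 2)"
      by (intro set_integrable_divide set_integral_add(1) set_integrable_mult_right i2 ci)
    fix y
    have "0 \<le> (m * norm (g y) - 1)\<^sup>2 / m" using m by simp
    also have "\<dots> = m * (norm (g y))\<^sup>2 + 1 / m - 2 * norm (g y)"
      using m by (simp add: field_simps power2_eq_square)
    finally show "norm (g y) \<le> (m * (norm (g y))\<^sup>2 + 1 / m) / 2" by simp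
  qed
  also have "\<dots> = (m * square_integral {u<..<v} g + (LINT y:{u<..<v}|lebesgue. 1 / m)) / 2"
    by (simp add: set_integral_add set_integrable_mult_right i2 ci del: set_integrable_mult_right_iff)
  also have "(LINT y:{u<..<v}|lebesgue. 1 / m) = m"
    using assms m by (simp add: set_lebesgue_integral_def field_simps)
  also have "(m * square_integral {u<..<v} g + m) / 2 \<le> (m * square_integral I g + m) / 2"
  proof -
    have "square_integral {u<..<v} g \<le> square_integral I g"
      unfolding set_lebesgue_integral_def
      using i2 assms by (intro integral_mono) (auto simp: L2_on_def set_integrable_def indicator_def)
    then show ?thesis using m by simp
  qed
  finally show ?thesis by (simp add: m_def algebra_simps)
qed

lemma right_lim_primitive:
  assumes "a < b" "L2_on {a<..<b} g"
    and f: "AE x in lebesgue. x \<in> {a<..<b} \<longrightarrow> f x = c + (LINT y:{a<..<x}|lebesgue. g y)"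
  shows "right_lim f a = c"
proof -
  define K where "K = (square_integral {a<..<b} g + 1) / 2"
  have bd: "norm (LINT y:{a<..<x}|lebesgue. g y) \<le> sqrt (x - a) * K" if "a < x" "x < b" for x
  proof -
    have "norm (LINT y:{a<..<x}|lebesgue. g y) \<le> (LINT y:{a<..<x}|lebesgue. norm (g y))"
    proof (rule set_integral_norm_bound)
      show "set_integrable lebesgue {a<..<x} g"
        using that by (intro set_integrable_L2_interval L2_on_subset[OF assms(2)]) auto
    qed
    also have "\<dots> \<le> sqrt (x - a) * K"
    proof -
      have "{a<..<x} \<subseteq> {a<..<b}" using that by auto
      from L2_on_integral_bound[OF assms(2) this that(1)] show ?thesis by (simp add: K_def)
    qed
    finally show ?thesis .
  qed
  have ev: "\<forall>\<^sub>F x in at_right a. x \<in> {a<..<b}"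
    unfolding eventually_at_right_field using assms(1) by (intro exI[of _ b]) auto
  have "((\<lambda>x. LINT y:{a<..<x}|lebesgue. g y) \<longlongrightarrow> 0) (at_right a)"
  proof (rule Lim_null_comparison)
    show "\<forall>\<^sub>F x in at_right a. norm (LINT y:{a<..<x}|lebesgue. g y) \<le> sqrt (x - a) * K"
      using ev by eventually_elim (rule bd, auto)
    have "((\<lambda>x. sqrt (x - a) * K) \<longlongrightarrow> sqrt (a - a) * K) (at_right a)" by (intro tendsto_intros)
    then show "((\<lambda>x. sqrt (x - a) * K) \<longlongrightarrow> 0) (at_right a)" by simp
  qed
  from tendsto_add[OF tendsto_const this, of c]
  have 1: "((\<lambda>x. c + (LINT y:{a<..<x}|lebesgue. g y)) \<longlongrightarrow> c) (inf (at_right a) (ae_filter lebesgue))"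
    by (simp add: tendsto_mono[OF inf_le1])
  have "\<forall>\<^sub>F x in inf (at_right a) (ae_filter lebesgue). c + (LINT y:{a<..<x}|lebesgue. g y) = f x"
    using ev f unfolding eventually_inf by (intro exI[of _ "\<lambda>x. x \<in> {a<..<b}"] exI[of _ "\<lambda>x. x \<in> {a<..<b} \<longrightarrow> f x = c + (LINT y:{a<..<x}|lebesgue. g y)"]) auto
  from Lim_transform_eventually[OF 1 this] show ?thesis
    unfolding right_lim_def by (intro tendsto_Lim right_lim_filter_nontrivial)
qed

lemma integral_by_parts_representation:
  fixes f g S S' :: "real \<Rightarrow> complex"
  assumes ab: "a < b" and g: "set_integrable lebesgue {a<..<b} g"
    and f: "AE x in lebesgue. x \<in> {a<..<b} \<longrightarrow> f x = c + (LINT y:{a<..<x}|lebesgue. g y)"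
    and fm: "set_borel_measurable lebesgue {a<..<b} f"
    and d: "\<And>x. x \<in> {a..b} \<Longrightarrow> (S has_vector_derivative S' x) (at x within {a..b})"
    and cont: "continuous_on {a..b} S'"
  shows "(LINT x:{a<..<b}|lebesgue. f x * S' x)
      = (c + (LINT y:{a<..<b}|lebesgue. g y)) * S b - c * S a - (LINT y:{a<..<b}|lebesgue. g y * S y)"
proof -
  define G where "G x = (LINT y:{a<..<x}|lebesgue. g y)" for x
  note P = set_integral_by_parts[OF ab g d cont, folded G_def]
  have ci: "set_integrable lebesgue {a<..<b} S'"
    by (rule set_integrable_subset[OF absolutely_integrable_continuous_real[OF cont]]) auto
  have i: "set_integrable lebesgue {a<..<b} (\<lambda>x. c * S' x + G x * S' x)"
    by (intro set_integral_add(1) P set_integrable_mult_right ci)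
  have "(LINT x:{a<..<b}|lebesgue. f x * S' x) = (LINT x:{a<..<b}|lebesgue. c * S' x + G x * S' x)"
    unfolding set_lebesgue_integral_def
  proof (rule integral_cong_AE)
    have "(\<lambda>x. indicator {a<..<b} x *\<^sub>R f x * (indicator {a<..<b} x *\<^sub>R S' x)) \<in> borel_measurable lebesgue"
      by (rule borel_measurable_times[OF fm[unfolded set_borel_measurable_def]
          borel_measurable_integrable[OF ci[unfolded set_integrable_def]]])
    also have "(\<lambda>x. indicator {a<..<b} x *\<^sub>R f x * (indicator {a<..<b} x *\<^sub>R S' x)) = (\<lambda>x. indicator {a<..<b} x *\<^sub>R (f x * S' x))"
      by (auto simp: indicator_def)
    finally show "(\<lambda>x. indicator {a<..<b} x *\<^sub>R (f x * S' x)) \<in> borel_measurable lebesgue" .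
    show "(\<lambda>x. indicator {a<..<b} x *\<^sub>R (c * S' x + G x * S' x)) \<in> borel_measurable lebesgue"
      using i unfolding set_integrable_def by (rule borel_measurable_integrable)
    show "AE x in lebesgue. indicator {a<..<b} x *\<^sub>R (f x * S' x) = indicator {a<..<b} x *\<^sub>R (c * S' x + G x * S' x)"
      using f by eventually_elim (auto simp: G_def algebra_simps indicator_def)
  qed
  also have "\<dots> = c * (LINT x:{a<..<b}|lebesgue. S' x) + (LINT x:{a<..<b}|lebesgue. G x * S' x)"
    using set_integral_add(2)[OF set_integrable_mult_right[OF ci, of c] P(2)] by simp
  also have "(LINT x:{a<..<b}|lebesgue. S' x) = S b - S a"
    using ab by (intro set_integral_FTC d cont) auto
  also have "(LINT x:{a<..<b}|lebesgue. G x * S' x) = (LINT y:{a<..<b}|lebesgue. g y) * S b - (LINT y:{a<..<b}|lebesgue. g y * S y)"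
    using P(1) by (simp only: G_def)
  finally show ?thesis by (simp add: algebra_simps)
qed

section \<open>The solution formula in physical space\<close>

text \<open>Dominated convergence in the form in which the truncation is removed from the solution formula: the
  datum \<open>h\<close> supplies integrability, the kernel is merely bounded. Only positive truncation parameters
  are meaningful.\<close>

lemma set_integral_dominated_at_top:
  fixes h l :: "real \<Rightarrow> complex" and c :: "real \<Rightarrow> real \<Rightarrow> complex"
  assumes h: "set_integrable lebesgue A h"
    and m: "\<And>r. r > 0 \<Longrightarrow> set_borel_measurable lebesgue A (\<lambda>y. c r y * h y)"
    and b: "\<And>r y. r > 0 \<Longrightarrow> y \<in> A \<Longrightarrow> norm (c r y) \<le> B"
    and lim: "\<And>y. y \<in> A \<Longrightarrow> ((\<lambda>r. c r y) \<longlongrightarrow> l y) at_top"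
  shows "((\<lambda>r. LINT y:A|lebesgue. c r y * h y) \<longlongrightarrow> (LINT y:A|lebesgue. l y * h y)) at_top"
    and "set_integrable lebesgue A (\<lambda>y. l y * h y)"
proof -
  let ?s = "\<lambda>r y. if r > 0 then indicator A y *\<^sub>R (c r y * h y) else 0"
  let ?f = "\<lambda>y. indicator A y *\<^sub>R (l y * h y)"
  have sm: "?s r \<in> borel_measurable lebesgue" for r
    using m[of r] by (cases "r > 0") (simp_all add: set_borel_measurable_def)
  have w: "integrable lebesgue (\<lambda>y. B * norm (indicator A y *\<^sub>R h y))"
    by (intro integrable_mult_right integrable_norm h[unfolded set_integrable_def])
  have lims: "((\<lambda>r. ?s r y) \<longlongrightarrow> ?f y) at_top" for y
  proof (cases "y \<in> A")
    case True
    have "((\<lambda>r. c r y * h y) \<longlongrightarrow> l y * h y) at_top" by (intro tendsto_intros lim True)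
    then have "((\<lambda>r. ?s r y) \<longlongrightarrow> l y * h y) at_top"
    proof (rule Lim_transform_eventually)
      show "\<forall>\<^sub>F r in at_top. c r y * h y = ?s r y"
        using eventually_gt_at_top[of 0] by eventually_elim (use True in simp)
    qed
    then show ?thesis using True by simp
  next
    case False
    then have "(\<lambda>r. ?s r y) = (\<lambda>_. 0)" by auto
    then show ?thesis using False by (simp del: if_split)
  qed
  have bd: "norm (?s r y) \<le> B * norm (indicator A y *\<^sub>R h y)" if "r > 0" for r y
    using b[OF that, of y] that by (cases "y \<in> A") (auto simp: norm_mult mult_right_mono)
  have fm: "?f \<in> borel_measurable lebesgue"
  proof (rule borel_measurable_LIMSEQ_metric)
    show "(\<lambda>y. ?s (real n) y) \<in> borel_measurable lebesgue" for n by (rule sm)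
    show "(\<lambda>n. ?s (real n) y) \<longlonglongrightarrow> ?f y" for y
      by (rule filterlim_compose[OF lims filterlim_real_sequentially])
  qed
  have "((\<lambda>r. integral\<^sup>L lebesgue (?s r)) \<longlongrightarrow> integral\<^sup>L lebesgue ?f) at_top"
  proof (rule integral_dominated_convergence_at_top[OF fm sm w])
    show "AE y in lebesgue. ((\<lambda>r. ?s r y) \<longlongrightarrow> ?f y) at_top" using lims by simp
    show "\<forall>\<^sub>F r in at_top. AE y in lebesgue. norm (?s r y) \<le> B * norm (indicator A y *\<^sub>R h y)"
      using eventually_gt_at_top[of 0] by eventually_elim (intro AE_I2 bd)
  qed
  then show "((\<lambda>r. LINT y:A|lebesgue. c r y * h y) \<longlongrightarrow> (LINT y:A|lebesgue. l y * h y)) at_top"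
    unfolding set_lebesgue_integral_def
  proof (rule Lim_transform_eventually)
    show "\<forall>\<^sub>F r in at_top. integral\<^sup>L lebesgue (?s r) = (LINT y|lebesgue. indicator A y *\<^sub>R (c r y * h y))"
      using eventually_gt_at_top[of 0] by eventually_elim simp
  qed
  show "set_integrable lebesgue A (\<lambda>y. l y * h y)"
    unfolding set_integrable_def
  proof (rule Bochner_Integration.integrable_bound[OF w fm])
    have "norm (?f y) \<le> B * norm (indicator A y *\<^sub>R h y)" for y
    proof (rule tendsto_upperbound[OF tendsto_norm[OF lims]])
      show "\<forall>\<^sub>F r in at_top. norm (?s r y) \<le> B * norm (indicator A y *\<^sub>R h y)"
        using eventually_gt_at_top[of 0] by eventually_elim (rule bd)
    qed simp
    then show "AE y in lebesgue. norm (?f y) \<le> norm (B * norm (indicator A y *\<^sub>R h y))"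
      by (intro AE_I2) (metis abs_ge_self order_trans real_norm_def)
  qed
qed

lemma propagator_minus: "propagator t (- z) = propagator t z"
  by (simp add: propagator_def)

lemma continuous_on_propagator [continuous_intros]:
  "continuous_on S f \<Longrightarrow> continuous_on S (\<lambda>x. propagator t (f x))"
  unfolding propagator_def of_real_divide divide_inverse by (intro continuous_intros)

lemma exp_mult_exp_mult: "a + b = c \<Longrightarrow> exp a * (exp b * q) = exp c * q" for a b c q :: complex
  by (simp add: exp_add [symmetric] mult.assoc [symmetric])

abbreviation reflected_propagator :: "real \<Rightarrow> real \<Rightarrow> real \<Rightarrow> complex" where
  "reflected_propagator t x y \<equiv> propagator t (y + x) - propagator t (y - x)"

text \<open>Before the limit the order of integration is exchanged, so that the transform is replaced by the
  integral of a wave along the contour, and this converges to the propagator.\<close>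

lemma real_line_transform_tendsto:
  assumes q: "set_integrable lebesgue {0<..} qo" and t: "t > 0"
  shows "((\<lambda>r. contour_integral (real_line r)
      (\<lambda>k. wave x t k * half_line_FT qo k))
      \<longlongrightarrow> (LINT y:{0<..}|lebesgue. 2 * of_real pi * propagator t (x - y) * qo y)) at_top"
    and "set_integrable lebesgue {0<..} (\<lambda>y. 2 * of_real pi * propagator t (x - y) * qo y)"
proof -
  let ?e = "\<lambda>k y. wave (x - y) t k"
  have ec: "continuous_on UNIV (\<lambda>z. ?e (fst z) (snd z))" by (intro continuous_intros)
  have eb: "norm (?e k y) \<le> 1" if "k \<in> closed_segment (- of_real r) (of_real r)" for r k and y :: real
  proof -
    have "Im k = 0" using that by (auto simp: in_segment)
    then show ?thesis by (simp add: norm_exp_eq_Re power2_eq_square)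
  qed
  have FT: "wave x t k * half_line_FT qo k = (LINT y:{0<..}|lebesgue. ?e k y * qo y)" for k
  proof -
    have "wave x t k * (exp (- \<i> * k * of_real y) * qo y) = ?e k y * qo y" for y
      by (rule exp_mult_exp_mult) (simp add: algebra_simps)
    then show ?thesis unfolding half_line_FT_def by (simp only: set_integral_mult_right [symmetric])
  qed
  have sw: "((\<lambda>k. LINT y:{0<..}|lebesgue. ?e k y * qo y) has_contour_integral
      (LINT y:{0<..}|lebesgue. contour_integral (real_line r) (\<lambda>k. ?e k y) * qo y)) (real_line r)"
    "set_integrable lebesgue {0<..} (\<lambda>y. contour_integral (real_line r) (\<lambda>k. ?e k y) * qo y)" for r
    unfolding real_line_def
    by (rule contour_integral_set_integral_swap[where B = 1, OF q ec], erule eb)+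
  obtain B where B: "\<And>r z. norm (contour_integral (real_line r) (\<lambda>k. wave z t k)) \<le> B"
    using exp_quadratic_integral_bounded[OF t] by metis
  have b: "norm (contour_integral (real_line r) (\<lambda>k. ?e k y)) \<le> B" for r y by (rule B)
  have l: "((\<lambda>r. contour_integral (real_line r) (\<lambda>k. ?e k y)) \<longlongrightarrow> 2 * of_real pi * propagator t (x - y)) at_top" for y
    by (rule real_line_integral_tendsto[OF t])
  have m: "set_borel_measurable lebesgue {0<..} (\<lambda>y. contour_integral (real_line r) (\<lambda>k. ?e k y) * qo y)" for r
    using sw(2)[of r] unfolding set_integrable_def set_borel_measurable_def by (rule borel_measurable_integrable)
  show "set_integrable lebesgue {0<..} (\<lambda>y. 2 * of_real pi * propagator t (x - y) * qo y)"
    by (rule set_integral_dominated_at_top(2)[OF q m b l])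
  show "((\<lambda>r. contour_integral (real_line r)
      (\<lambda>k. wave x t k * half_line_FT qo k))
      \<longlongrightarrow> (LINT y:{0<..}|lebesgue. 2 * of_real pi * propagator t (x - y) * qo y)) at_top"
    unfolding FT contour_integral_unique[OF sw(1)] by (rule set_integral_dominated_at_top(1)[OF q m b l])
qed

lemma norm_exp_bdry_D:
  assumes "k \<in> closed_segment (\<i> * of_real r) 0 \<union> closed_segment 0 (of_real r)" "r \<ge> 0" "z \<ge> 0"
  shows "norm (wave z s k) \<le> 1" "norm k \<le> r"
proof -
  consider u where "0 \<le> u" "u \<le> 1" "k = \<i> * of_real (u * r)" | u where "0 \<le> u" "u \<le> 1" "k = of_real (u * r)"
  proof -
    assume 1: "\<And>u. 0 \<le> u \<Longrightarrow> u \<le> 1 \<Longrightarrow> k = \<i> * of_real (u * r) \<Longrightarrow> thesis"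
      and 2: "\<And>u. 0 \<le> u \<Longrightarrow> u \<le> 1 \<Longrightarrow> k = of_real (u * r) \<Longrightarrow> thesis"
    from assms(1) show thesis
    proof
      assume "k \<in> closed_segment (\<i> * of_real r) 0"
      then obtain u where "0 \<le> u" "u \<le> 1" "k = (1 - u) *\<^sub>R (\<i> * of_real r) + u *\<^sub>R 0" by (auto simp: in_segment)
      then show thesis by (intro 1[of "1 - u"]) (auto simp: scaleR_conv_of_real algebra_simps)
    next
      assume "k \<in> closed_segment 0 (of_real r)"
      then obtain u where "0 \<le> u" "u \<le> 1" "k = (1 - u) *\<^sub>R 0 + u *\<^sub>R of_real r" by (auto simp: in_segment)
      then show thesis by (intro 2[of u]) (auto simp: scaleR_conv_of_real)
    qed
  qed
  then have "norm (wave z s k) \<le> 1 \<and> norm k \<le> r"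
  proof cases
    case (1 u)
    have "u * r \<le> 1 * r" using 1 assms by (intro mult_right_mono) auto
    then show ?thesis using 1 assms by (simp add: norm_exp_eq_Re norm_mult power_mult_distrib abs_mult)
  next
    case (2 u)
    have "u * r \<le> 1 * r" using 2 assms by (intro mult_right_mono) auto
    then show ?thesis using 2 assms by (simp add: norm_exp_eq_Re norm_mult power2_eq_square abs_mult)
  qed
  then show "norm (wave z s k) \<le> 1" "norm k \<le> r" by auto
qed

lemma bdry_D_transform_tendsto:
  assumes q: "set_integrable lebesgue {0<..} qo" and t: "t > 0" and x: "x > 0"
  shows "((\<lambda>r. contour_integral (bdry_D r)
      (\<lambda>k. wave x t k * half_line_FT qo (- k)))
      \<longlongrightarrow> (LINT y:{0<..}|lebesgue. 2 * of_real pi * propagator t (x + y) * qo y)) at_top"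
    and "set_integrable lebesgue {0<..} (\<lambda>y. 2 * of_real pi * propagator t (x + y) * qo y)"
    and "r > 0 \<Longrightarrow> (\<lambda>k. wave x t k * half_line_FT qo (- k)) contour_integrable_on (bdry_D r)"
proof -
  let ?e = "\<lambda>k y. wave (x + y) t k"
  have ec: "continuous_on UNIV (\<lambda>z. ?e (fst z) (snd z))" by (intro continuous_intros)
  have eb: "norm (?e k y) \<le> 1" if "r > 0" "k \<in> closed_segment (\<i> * of_real r) 0 \<union> closed_segment 0 (of_real r)" "y \<in> {0<..}" for r k y
    by (rule norm_exp_bdry_D(1)[OF that(2)]) (use that x in auto)
  have FT: "wave x t k * half_line_FT qo (- k) = (LINT y:{0<..}|lebesgue. ?e k y * qo y)" for k
  proof -
    have "wave x t k * (exp (- \<i> * - k * of_real y) * qo y) = ?e k y * qo y" for y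
      by (rule exp_mult_exp_mult) (simp add: algebra_simps)
    then show ?thesis unfolding half_line_FT_def by (simp only: set_integral_mult_right [symmetric])
  qed
  have sw: "((\<lambda>k. LINT y:{0<..}|lebesgue. ?e k y * qo y) has_contour_integral
      (LINT y:{0<..}|lebesgue. contour_integral (bdry_D r) (\<lambda>k. ?e k y) * qo y)) (bdry_D r)"
    "set_integrable lebesgue {0<..} (\<lambda>y. contour_integral (bdry_D r) (\<lambda>k. ?e k y) * qo y)" if "r > 0" for r
    unfolding bdry_D_def
    by (rule contour_integral_set_integral_swap_join[where B = 1, OF q ec], erule (1) eb[OF that])+
  obtain B where B: "\<And>r z. 0 \<le> r \<Longrightarrow> 0 \<le> z \<Longrightarrow> norm (contour_integral (bdry_D r) (\<lambda>k. wave z t k)) \<le> B"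
    using exp_quadratic_integral_bounded[OF t] by metis
  have m: "set_borel_measurable lebesgue {0<..} (\<lambda>y. contour_integral (bdry_D r) (\<lambda>k. ?e k y) * qo y)" if "r > 0" for r
    using sw(2)[OF that] unfolding set_integrable_def set_borel_measurable_def by (rule borel_measurable_integrable)
  have b: "norm (contour_integral (bdry_D r) (\<lambda>k. ?e k y)) \<le> B" if "r > 0" "y \<in> {0<..}" for r y
    using that x by (intro B) auto
  have l: "((\<lambda>r. contour_integral (bdry_D r) (\<lambda>k. ?e k y)) \<longlongrightarrow> 2 * of_real pi * propagator t (x + y)) at_top" if "y \<in> {0<..}" for y
    using that x by (intro bdry_D_integral_tendsto t) auto
  have dom: "((\<lambda>r. LINT y:{0<..}|lebesgue. contour_integral (bdry_D r) (\<lambda>k. ?e k y) * qo y)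
      \<longlongrightarrow> (LINT y:{0<..}|lebesgue. 2 * of_real pi * propagator t (x + y) * qo y)) at_top"
    "set_integrable lebesgue {0<..} (\<lambda>y. 2 * of_real pi * propagator t (x + y) * qo y)"
    by (rule set_integral_dominated_at_top[OF q m b l]; assumption)+
  show "set_integrable lebesgue {0<..} (\<lambda>y. 2 * of_real pi * propagator t (x + y) * qo y)"
    by (rule dom(2))
  show "(\<lambda>k. wave x t k * half_line_FT qo (- k)) contour_integrable_on (bdry_D r)" if "r > 0"
    unfolding FT using sw(1)[OF that] by (rule has_contour_integral_integrable)
  from dom(1) show "((\<lambda>r. contour_integral (bdry_D r)
      (\<lambda>k. wave x t k * half_line_FT qo (- k)))
      \<longlongrightarrow> (LINT y:{0<..}|lebesgue. 2 * of_real pi * propagator t (x + y) * qo y)) at_top"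
    unfolding FT
  proof (rule Lim_transform_eventually)
    show "\<forall>\<^sub>F r in at_top. (LINT y:{0<..}|lebesgue. contour_integral (bdry_D r) (\<lambda>k. ?e k y) * qo y) =
        contour_integral (bdry_D r) (\<lambda>k. LINT y:{0<..}|lebesgue. ?e k y * qo y)"
      using eventually_gt_at_top[of 0] by eventually_elim (simp only: contour_integral_unique[OF sw(1)])
  qed
qed

lemma continuous_on_special_cutoff_t:
  assumes "r > 0" shows "continuous_on S (special_cutoff r x)"
  by (intro continuous_at_imp_continuous_on ballI has_vector_derivative_continuous[OF has_vector_derivative_special_cutoff_t[OF assms]])

text \<open>Exchanging the integrals is not enough here, since the integral of \<open>k exp (i k x - i k\<^sup>2 \<tau>)\<close> has no
  limit as the truncation is removed. However, up to a factor it is the time derivative of the truncated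
  special function. So the truncated expression is integrated by parts in \<open>s\<close>, which brings in the
  regularity of the datum, and only then does dominated convergence apply. The boundary term at \<open>s = t\<close>
  contains the special function at time \<open>0\<close> and vanishes in the limit.\<close>

lemma boundary_transform_tendsto:
  assumes g: "set_integrable lebesgue {0<..<t} g" and f: "set_integrable lebesgue {0<..<t} f"
    and rep: "AE s in lebesgue. s \<in> {0<..<t} \<longrightarrow> f s = c + (LINT y:{0<..<s}|lebesgue. g y)"
    and t: "t > 0" and x: "x > 0"
  shows "((\<lambda>r. contour_integral (bdry_D r)
      (\<lambda>k. wave x t k * (2 * k * time_transform f (- k\<^sup>2) t)))
      \<longlongrightarrow> - of_real (4 * pi) * (c * (Phi t x - 1 / 2) + (LINT s:{0<..<t}|lebesgue. (Phi (t - s) x - 1 / 2) * g s))) at_top"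
    and "r > 0 \<Longrightarrow> (\<lambda>k. wave x t k * (2 * k * time_transform f (- k\<^sup>2) t)) contour_integrable_on (bdry_D r)"
    and "set_integrable lebesgue {0<..<t} (\<lambda>s. (Phi (t - s) x - 1 / 2) * g s)"
proof -
  let ?e = "\<lambda>k s. 2 * k * wave x (t - s) k"
  have ec: "continuous_on UNIV (\<lambda>z. ?e (fst z) (snd z))" by (intro continuous_intros)
  have eb: "norm (?e k s) \<le> 2 * r * 1" if "r > 0" "k \<in> closed_segment (\<i> * of_real r) 0 \<union> closed_segment 0 (of_real r)" "s \<in> {0<..<t}" for r k s
  proof -
    have 1: "norm (wave x (t - s) k) \<le> 1"
      by (rule norm_exp_bdry_D(1)[OF that(2)]) (use that x in auto)
    have "norm k \<le> r" by (rule norm_exp_bdry_D(2)[OF that(2), of x]) (use that x in auto)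
    then have "norm (2 * k) \<le> 2 * r" by (simp add: norm_mult)
    then show ?thesis unfolding norm_mult[of "2 * k"] using 1 that(1) by (intro mult_mono) auto
  qed
  have FT: "wave x t k * (2 * k * time_transform f (- k\<^sup>2) t) = (LINT s:{0<..<t}|lebesgue. ?e k s * f s)" for k
  proof -
    have "wave x t k * (2 * k * (exp (- \<i> * (- k\<^sup>2) * of_real s) * f s)) = ?e k s * f s" for s
    proof -
      have "wave x t k * (exp (- \<i> * (- k\<^sup>2) * of_real s) * f s)
          = wave x (t - s) k * f s"
        by (rule exp_mult_exp_mult) (simp add: algebra_simps)
      then show ?thesis by (simp only: mult.assoc mult.left_commute)
    qed
    then show ?thesis unfolding time_transform_def by (simp only: set_integral_mult_right [symmetric])
  qed
  have sw: "((\<lambda>k. LINT s:{0<..<t}|lebesgue. ?e k s * f s) has_contour_integral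
      (LINT s:{0<..<t}|lebesgue. contour_integral (bdry_D r) (\<lambda>k. ?e k s) * f s)) (bdry_D r)" if "r > 0" for r
    unfolding bdry_D_def
    by (rule contour_integral_set_integral_swap_join(1)[where B = "2 * r * 1", OF f ec], erule (1) eb[OF that])
  show "(\<lambda>k. wave x t k * (2 * k * time_transform f (- k\<^sup>2) t)) contour_integrable_on (bdry_D r)" if "r > 0"
    unfolding FT using sw[OF that] by (rule has_contour_integral_integrable)
  have d: "((\<lambda>s. 2 * special_cutoff r x (t - s)) has_vector_derivative contour_integral (bdry_D r) (\<lambda>k. ?e k s)) (at s)" if "r > 0" for r s
  proof -
    have 1: "((\<lambda>s. t - s) has_real_derivative - 1) (at s)" by (auto intro!: derivative_eq_intros)
    from vector_diff_chain_at[OF this[unfolded has_real_derivative_iff_has_vector_derivative] has_vector_derivative_special_cutoff_t[OF that, of x "t - s"]]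
    have "((\<lambda>s. special_cutoff r x (t - s)) has_vector_derivative
       contour_integral (bdry_D r) (\<lambda>k. k * wave x (t - s) k)) (at s)"
      by (simp add: o_def)
    from has_vector_derivative_mult_right[OF this, of 2]
    show ?thesis
      by (simp add: mult.assoc contour_integral_lmul[OF contour_integrable_holomorphic_simple[OF _ open_UNIV]] holomorphic_intros)
  qed
  have dc: "continuous_on {0..t} (\<lambda>s. contour_integral (bdry_D r) (\<lambda>k. ?e k s))" if "r > 0" for r
  proof -
    have eq: "contour_integral (bdry_D r) (\<lambda>k. ?e k s) = contour_integral (linepath (\<i> * of_real r) (of_real r)) (\<lambda>k. ?e k s)" for s
      by (rule contour_integral_entire_eq) (auto intro!: holomorphic_intros)
    have "((\<lambda>s. contour_integral (linepath (\<i> * of_real r) (of_real r)) (\<lambda>k. ?e k s)) has_vector_derivative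
       contour_integral (linepath (\<i> * of_real r) (of_real r)) (\<lambda>k. ?e k s * (\<i> * k\<^sup>2))) (at s)" for s
    proof (rule has_vector_derivative_contour_integral_linepath)
      show "((\<lambda>s. ?e k s) has_vector_derivative ?e k s * (\<i> * k\<^sup>2)) (at s)" for s k
        unfolding of_real_diff
      proof (rule has_vector_derivative_real_field)
        have "((\<lambda>s. 2 * k * exp (\<i> * k * of_real x - \<i> * k\<^sup>2 * (of_real t - s))) has_field_derivative
           2 * k * exp (\<i> * k * of_real x - \<i> * k\<^sup>2 * (of_real t - s)) * (\<i> * k\<^sup>2)) (at s)" for s
          by (auto intro!: derivative_eq_intros)
        then show "((\<lambda>s. 2 * k * exp (\<i> * k * of_real x - \<i> * k\<^sup>2 * (of_real t - s))) has_field_derivative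
           2 * k * exp (\<i> * k * of_real x - \<i> * k\<^sup>2 * (of_real t - of_real s)) * (\<i> * k\<^sup>2)) (at (of_real s))" .
      qed
    qed (auto intro!: continuous_intros simp: case_prod_beta)
    then show ?thesis unfolding eq
      by (intro continuous_at_imp_continuous_on ballI) (rule has_vector_derivative_continuous)
  qed
  have fm: "set_borel_measurable lebesgue {0<..<t} f"
    using f unfolding set_integrable_def set_borel_measurable_def by (rule borel_measurable_integrable)
  have parts: "(LINT s:{0<..<t}|lebesgue. contour_integral (bdry_D r) (\<lambda>k. ?e k s) * f s)
     = (c + (LINT y:{0<..<t}|lebesgue. g y)) * (2 * special_cutoff r x 0) - c * (2 * special_cutoff r x t)
       - (LINT s:{0<..<t}|lebesgue. g s * (2 * special_cutoff r x (t - s)))" if "r > 0" for r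
    using integral_by_parts_representation[OF t g rep fm has_vector_derivative_at_within[OF d[OF that]] dc[OF that]]
    by (simp add: mult.commute)
  obtain B where B: "\<And>r s. 0 < r \<Longrightarrow> 0 < s \<Longrightarrow> s \<le> t \<Longrightarrow> norm (special_cutoff r x s) \<le> B"
    using special_cutoff_bounded_in_time[OF x t] by metis
  have m: "set_borel_measurable lebesgue {0<..<t} (\<lambda>s. 2 * special_cutoff r x (t - s) * g s)" if "r > 0" for r
  proof -
    have "continuous_on {0..t} (\<lambda>s. special_cutoff r x (t - s))"
      by (rule continuous_on_compose2[OF continuous_on_special_cutoff_t[OF that, of UNIV]]) (auto intro!: continuous_intros)
    then have "set_integrable lebesgue {0<..<t} (\<lambda>s. g s * (2 * special_cutoff r x (t - s)))"
      by (intro set_integrable_mult_continuous[OF g] continuous_intros)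
    then have "set_integrable lebesgue {0<..<t} (\<lambda>s. 2 * special_cutoff r x (t - s) * g s)"
      by (simp add: mult_ac)
    then show ?thesis unfolding set_integrable_def set_borel_measurable_def by (rule borel_measurable_integrable)
  qed
  have b: "norm (2 * special_cutoff r x (t - s)) \<le> 2 * B" if "r > 0" "s \<in> {0<..<t}" for r s
    using B[OF that(1), of "t - s"] that(2) by (simp add: norm_mult)
  have l: "((\<lambda>r. 2 * special_cutoff r x (t - s)) \<longlongrightarrow> 2 * (of_real (2 * pi) * (Phi (t - s) x - 1 / 2))) at_top" if "s \<in> {0<..<t}" for s
    using that x by (intro tendsto_intros special_cutoff_tendsto) auto
  have dom: "((\<lambda>r. LINT s:{0<..<t}|lebesgue. 2 * special_cutoff r x (t - s) * g s)
      \<longlongrightarrow> (LINT s:{0<..<t}|lebesgue. 2 * (of_real (2 * pi) * (Phi (t - s) x - 1 / 2)) * g s)) at_top"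
    "set_integrable lebesgue {0<..<t} (\<lambda>s. 2 * (of_real (2 * pi) * (Phi (t - s) x - 1 / 2)) * g s)"
    by (rule set_integral_dominated_at_top[OF g m b l]; assumption)+
  have r: "2 * (of_real (2 * pi) * (Phi (t - s) x - 1 / 2)) * g s = of_real (4 * pi) * ((Phi (t - s) x - 1 / 2) * g s)" for s
    by simp
  show "set_integrable lebesgue {0<..<t} (\<lambda>s. (Phi (t - s) x - 1 / 2) * g s)"
    using dom(2) unfolding r by (subst (asm) set_integrable_mult_right_iff) auto
  have "((\<lambda>r. (c + (LINT y:{0<..<t}|lebesgue. g y)) * (2 * special_cutoff r x 0) - c * (2 * special_cutoff r x t)
       - (LINT s:{0<..<t}|lebesgue. 2 * special_cutoff r x (t - s) * g s)) \<longlongrightarrow>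
     (c + (LINT y:{0<..<t}|lebesgue. g y)) * (2 * 0) - c * (2 * (of_real (2 * pi) * (Phi t x - 1 / 2)))
       - (LINT s:{0<..<t}|lebesgue. 2 * (of_real (2 * pi) * (Phi (t - s) x - 1 / 2)) * g s)) at_top"
    using x t by (intro tendsto_intros special_cutoff_time_0 special_cutoff_tendsto dom(1)) auto
  also have "(c + (LINT y:{0<..<t}|lebesgue. g y)) * (2 * 0) - c * (2 * (of_real (2 * pi) * (Phi t x - 1 / 2)))
       - (LINT s:{0<..<t}|lebesgue. 2 * (of_real (2 * pi) * (Phi (t - s) x - 1 / 2)) * g s)
     = - of_real (4 * pi) * (c * (Phi t x - 1 / 2) + (LINT s:{0<..<t}|lebesgue. (Phi (t - s) x - 1 / 2) * g s))"
    unfolding r set_integral_mult_right by (simp add: algebra_simps)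
  finally show "((\<lambda>r. contour_integral (bdry_D r)
      (\<lambda>k. wave x t k * (2 * k * time_transform f (- k\<^sup>2) t)))
      \<longlongrightarrow> - of_real (4 * pi) * (c * (Phi t x - 1 / 2) + (LINT s:{0<..<t}|lebesgue. (Phi (t - s) x - 1 / 2) * g s))) at_top"
    unfolding FT
  proof (rule Lim_transform_eventually)
    show "\<forall>\<^sub>F r in at_top. (c + (LINT y:{0<..<t}|lebesgue. g y)) * (2 * special_cutoff r x 0) - c * (2 * special_cutoff r x t)
       - (LINT s:{0<..<t}|lebesgue. 2 * special_cutoff r x (t - s) * g s)
       = contour_integral (bdry_D r) (\<lambda>k. LINT s:{0<..<t}|lebesgue. ?e k s * f s)"
      using eventually_gt_at_top[of 0]
    proof eventually_elim
      case (elim r)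
      show ?case unfolding contour_integral_unique[OF sw[OF elim]] parts[OF elim] by (simp add: mult.commute)
    qed
  qed
qed

lemma set_integrable_reflected_propagator:
  assumes q: "set_integrable lebesgue {0<..} qo" and t: "t > 0" and x: "x > 0"
  shows "set_integrable lebesgue {0<..} (\<lambda>y. qo y * reflected_propagator t x y)"
proof -
  have e: "2 * of_real pi * propagator t (x + y) * qo y - 2 * of_real pi * propagator t (x - y) * qo y
      = of_real (2 * pi) * (qo y * reflected_propagator t x y)" for y
    using propagator_minus[of t "x - y"] by (simp add: algebra_simps)
  have "set_integrable lebesgue {0<..} (\<lambda>y. of_real (2 * pi) * (qo y * reflected_propagator t x y))"
    using set_integral_diff(1)[OF bdry_D_transform_tendsto(2)[OF q t x] real_line_transform_tendsto(2)[OF q t, of x]] unfolding e .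
  then show ?thesis by (subst (asm) set_integrable_mult_right_iff) auto
qed

lemma solution_formula_eq:
  assumes q: "set_integrable lebesgue {0<..} qo"
    and g: "set_integrable lebesgue {0<..<t} g" and f: "set_integrable lebesgue {0<..<t} g0"
    and rep: "AE s in lebesgue. s \<in> {0<..<t} \<longrightarrow> g0 s = c + (LINT y:{0<..<s}|lebesgue. g y)"
    and t: "t > 0" and x: "x > 0"
  shows "solution_formula qo g0 x t
     = - (LINT y:{0<..}|lebesgue. qo y * reflected_propagator t x y)
       - 2 * (c * (Phi t x - 1 / 2) + (LINT s:{0<..<t}|lebesgue. (Phi (t - s) x - 1 / 2) * g s))"
proof -
  note R = real_line_transform_tendsto[OF q t, of x]
  note D = bdry_D_transform_tendsto[OF q t x]
  note G = boundary_transform_tendsto[OF g f rep t x]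
  let ?E = "\<lambda>k. wave x t k"
  let ?b = "- of_real (4 * pi) * (c * (Phi t x - 1 / 2) + (LINT s:{0<..<t}|lebesgue. (Phi (t - s) x - 1 / 2) * g s))"
  let ?I1 = "LINT y:{0<..}|lebesgue. 2 * of_real pi * propagator t (x - y) * qo y"
  let ?I2 = "LINT y:{0<..}|lebesgue. 2 * of_real pi * propagator t (x + y) * qo y"
  have 1: "improper_contour_integral real_line (\<lambda>k. ?E k * half_line_FT qo k) = ?I1"
    unfolding improper_contour_integral_def by (rule tendsto_Lim[OF _ R(1)]) simp
  have "((\<lambda>r. contour_integral (bdry_D r) (\<lambda>k. ?E k * (2 * k * time_transform g0 (- k\<^sup>2) t - half_line_FT qo (- k)))) \<longlongrightarrow> ?b - ?I2) at_top"
  proof (rule Lim_transform_eventually[OF tendsto_diff[OF G(1) D(1)]])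
    show "\<forall>\<^sub>F r in at_top. contour_integral (bdry_D r) (\<lambda>k. ?E k * (2 * k * time_transform g0 (- k\<^sup>2) t))
      - contour_integral (bdry_D r) (\<lambda>k. ?E k * half_line_FT qo (- k))
      = contour_integral (bdry_D r) (\<lambda>k. ?E k * (2 * k * time_transform g0 (- k\<^sup>2) t - half_line_FT qo (- k)))"
      using eventually_gt_at_top[of 0]
      by eventually_elim (simp only: right_diff_distrib contour_integral_diff[OF G(2) D(3)])
  qed
  then have 2: "improper_contour_integral bdry_D (\<lambda>k. ?E k * (2 * k * time_transform g0 (- k\<^sup>2) t - half_line_FT qo (- k))) = ?b - ?I2"
    unfolding improper_contour_integral_def by (intro tendsto_Lim) auto
  have e: "2 * of_real pi * propagator t (x + y) * qo y - 2 * of_real pi * propagator t (x - y) * qo y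
      = of_real (2 * pi) * (qo y * reflected_propagator t x y)" for y
    using propagator_minus[of t "x - y"] by (simp add: algebra_simps)
  have "?I2 - ?I1 = of_real (2 * pi) * (LINT y:{0<..}|lebesgue. qo y * reflected_propagator t x y)"
    using set_integral_diff(2)[OF D(2) R(2)] unfolding e set_integral_mult_right by simp
  then have "?I1 = ?I2 - of_real (2 * pi) * (LINT y:{0<..}|lebesgue. qo y * reflected_propagator t x y)"
    by (simp add: algebra_simps)
  then show "solution_formula qo g0 x t
     = - (LINT y:{0<..}|lebesgue. qo y * reflected_propagator t x y)
       - 2 * (c * (Phi t x - 1 / 2) + (LINT s:{0<..<t}|lebesgue. (Phi (t - s) x - 1 / 2) * g s))"
  proof -
    have "1 / (2 * of_real pi) * I1 + 1 / (2 * of_real pi) * (- of_real (4 * pi) * X - I2) = - I0 - 2 * X"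
      if "I1 = I2 - of_real (2 * pi) * I0" for I0 I1 I2 X :: complex
      using that by (simp add: field_simps)
    then show ?thesis unfolding solution_formula_def 1 2
      using \<open>?I1 = _\<close> by blast
  qed
qed

section \<open>Estimates near the corner\<close>

text \<open>The function \<open>S\<close> of the introduction: a primitive of the kernel that multiplies the initial datum,
  normalised so that it vanishes at infinity.\<close>

definition reflected_Phi :: "real \<Rightarrow> real \<Rightarrow> real \<Rightarrow> complex" where
  "reflected_Phi t x y = Phi t (y + x) - Phi t (y - x)"

lemma reflected_Phi_0: "reflected_Phi t x 0 = 2 * Phi t x"
  by (simp add: reflected_Phi_def Phi_minus)

lemma has_vector_derivative_reflected_Phi:
  assumes "t > 0"
  shows "(reflected_Phi t x has_vector_derivative reflected_propagator t x y) (at y within S)"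
proof -
  have 1: "((\<lambda>y. Phi t (y + x)) has_vector_derivative propagator t (y + x)) (at y within S)" for x
  proof -
    have "((\<lambda>y. y + x) has_vector_derivative 1) (at y within S)"
      by (auto intro!: derivative_eq_intros)
    from vector_diff_chain_within[OF this has_vector_derivative_Phi[OF assms]]
    show ?thesis by (simp add: o_def)
  qed
  from has_vector_derivative_diff[OF 1[of x] 1[of "- x"]] show ?thesis
    by (simp add: reflected_Phi_def [abs_def])
qed

lemma continuous_on_reflected_Phi:
  "t > 0 \<Longrightarrow> continuous_on S (reflected_Phi t x)"
  by (rule continuous_on_vector_derivative[OF has_vector_derivative_reflected_Phi])

text \<open>Beyond \<open>x\<close> both terms are within \<open>O(\<surd>t / (y - x))\<close> of the same limit, which cancels.\<close>

lemma reflected_Phi_bounds: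
  obtains C where "C > 0" "\<And>t x y. norm (reflected_Phi t x y) \<le> C"
    "\<And>t x y. 0 < t \<Longrightarrow> 0 < x \<Longrightarrow> x < y \<Longrightarrow> norm (reflected_Phi t x y) \<le> C * sqrt t / (y - x)"
proof -
  obtain C L where C: "C > 0" "\<And>t a. norm (Phi t a) \<le> C"
    "\<And>t a. 0 < t \<Longrightarrow> 0 < a \<Longrightarrow> norm (Phi t a - L) \<le> C * sqrt t / a" using Phi_bounds by metis
  show ?thesis
  proof (rule that[of "2 * C"])
    show "norm (reflected_Phi t x y) \<le> 2 * C" for t x y
      using norm_triangle_ineq4[of "Phi t (y + x)" "Phi t (y - x)"] C(2)[of t "y + x"] C(2)[of t "y - x"]
      by (simp add: reflected_Phi_def)
    fix t x y :: real assume a: "0 < t" "0 < x" "x < y"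
    have "norm (Phi t (y + x) - L) \<le> C * sqrt t / (y + x)" using a by (intro C(3)) auto
    also have "\<dots> \<le> C * sqrt t / (y - x)" using a C(1) by (intro divide_left_mono) auto
    finally have 1: "norm (Phi t (y + x) - L) \<le> C * sqrt t / (y - x)" .
    have 2: "norm (Phi t (y - x) - L) \<le> C * sqrt t / (y - x)" using a by (intro C(3)) auto
    have "reflected_Phi t x y = (Phi t (y + x) - L) - (Phi t (y - x) - L)" by (simp add: reflected_Phi_def)
    then have "norm (reflected_Phi t x y) \<le> C * sqrt t / (y - x) + C * sqrt t / (y - x)"
      using norm_triangle_ineq4[of "Phi t (y + x) - L" "Phi t (y - x) - L"] 1 2 by simp
    then show "norm (reflected_Phi t x y) \<le> 2 * C * sqrt t / (y - x)" by simp
  qed (use C in simp)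
qed

lemma inverse_square_tail:
  fixes t u x :: real
  assumes "t > 0" "u > 0"
  shows "has_bochner_integral lebesgue (\<lambda>y. indicator {x + u..} y * (t / (y - x)\<^sup>2)) (t / u)"
proof -
  let ?f = "\<lambda>y. t / (y - x)\<^sup>2"
  have n: "(\<integral>\<^sup>+y. ennreal (?f y) * indicator {x + u..} y \<partial>lborel) = 0 - (- t / (x + u - x))"
  proof (rule nn_integral_FTC_atLeast)
    show "?f \<in> borel_measurable borel" by measurable
    fix y assume "x + u \<le> y"
    then show "DERIV (\<lambda>y. - t / (y - x)) y :> ?f y" using assms
      by (auto intro!: derivative_eq_intros simp: power2_eq_square)
    show "0 \<le> ?f y" using assms by simp
  next
    show "((\<lambda>y. - t / (y - x)) \<longlongrightarrow> 0) at_top" by real_asymp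
  qed
  have "has_bochner_integral lborel (\<lambda>y. indicator {x + u..} y * ?f y) (t / u)"
  proof (rule has_bochner_integral_nn_integral)
    show "(\<lambda>y. indicator {x + u..} y * ?f y) \<in> borel_measurable lborel" by measurable
    have "(\<integral>\<^sup>+y. ennreal (indicator {x + u..} y * ?f y) \<partial>lborel) = (\<integral>\<^sup>+y. ennreal (?f y) * indicator {x + u..} y \<partial>lborel)"
      by (intro nn_integral_cong) (auto simp: indicator_def)
    then show "(\<integral>\<^sup>+y. ennreal (indicator {x + u..} y * ?f y) \<partial>lborel) = ennreal (t / u)"
      using n by simp
  qed (use assms in auto)
  then show ?thesis
    by (simp add: has_bochner_integral_iff integrable_completion integral_completion borel_measurable_integrable)
qed

text \<open>\<open>|S|\<^sup>2\<close> is dominated by a constant times the function equal to \<open>1\<close> up to \<open>x + \<surd>t\<close> and to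
  \<open>t / (y - x)\<^sup>2\<close> beyond, whose integral is \<open>x + 2 \<surd>t\<close>. The Cauchy-Schwarz inequality is used in the
  form \<open>2 |g S| \<le> m |g|\<^sup>2 + |S|\<^sup>2 / m\<close>, where \<open>m\<^sup>2 = x + \<surd>t\<close> balances the two terms.\<close>

lemma reflected_Phi_pairing:
  "\<exists>C>0. \<forall>I g t x. L2_on I g \<longrightarrow> I \<subseteq> {0<..} \<longrightarrow> I \<in> sets lebesgue \<longrightarrow> 0 < t \<longrightarrow> 0 < x \<longrightarrow>
       norm (LINT y:I|lebesgue. g y * reflected_Phi t x y) \<le> (square_integral I g + C) * sqrt (x + sqrt t)"
proof -
  obtain C where C: "C > 0" "\<And>t x y. norm (reflected_Phi t x y) \<le> C"
    "\<And>t x y. 0 < t \<Longrightarrow> 0 < x \<Longrightarrow> x < y \<Longrightarrow> norm (reflected_Phi t x y) \<le> C * sqrt t / (y - x)"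
    using reflected_Phi_bounds by metis
  show ?thesis
  proof (intro exI[of _ "C\<^sup>2"] conjI allI impI)
    show "C\<^sup>2 > 0" using C by simp
    fix I g and t x :: real
    assume g: "L2_on I g" and I: "I \<subseteq> {0<..}" "I \<in> sets lebesgue" and t: "0 < t" and x: "0 < x"
    define m where "m = sqrt (x + sqrt t)"
    have m: "m > 0" "m * m = x + sqrt t" using t x by (auto simp: m_def add_pos_pos intro!: real_sqrt_mult_self)
    let ?M = "\<lambda>y. indicator {0<..<x + sqrt t} y + indicator {x + sqrt t..} y * (t / (y - x)\<^sup>2) :: real"
    have M1: "has_bochner_integral lebesgue (\<lambda>y. indicator {0<..<x + sqrt t} y :: real) (x + sqrt t)"
      using has_bochner_integral_real_indicator[of "{0<..<x + sqrt t}" lebesgue] t x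
      by (simp add: add_pos_pos less_imp_le)
    have "has_bochner_integral lebesgue ?M (x + sqrt t + t / sqrt t)"
      using inverse_square_tail[of t "sqrt t" x] t by (intro has_bochner_integral_add M1) auto
    then have Mi: "integrable lebesgue ?M" and Mv: "integral\<^sup>L lebesgue ?M = x + sqrt t + sqrt t"
      using t by (auto simp: has_bochner_integral_iff real_div_sqrt)
    have MI: "set_integrable lebesgue I ?M"
      unfolding set_integrable_def using Mi I(2) by (rule integrable_mult_indicator[rotated])
    have MIv: "(LINT y:I|lebesgue. ?M y) \<le> 2 * (m * m)"
    proof -
      have "(LINT y:I|lebesgue. ?M y) \<le> integral\<^sup>L lebesgue ?M"
        unfolding set_lebesgue_integral_def
        using MI Mi t by (intro integral_mono) (auto simp: set_integrable_def indicator_def)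
      then show ?thesis unfolding Mv m(2) using x by simp
    qed
    have SM: "(norm (reflected_Phi t x y))\<^sup>2 \<le> C\<^sup>2 * ?M y" if "y > 0" for y
    proof (cases "y < x + sqrt t")
      case True
      have "(norm (reflected_Phi t x y))\<^sup>2 \<le> C\<^sup>2" using C(2) by (intro power_mono) auto
      then show ?thesis using True that by simp
    next
      case False
      then have "x < y" using t by (smt (verit) real_sqrt_gt_zero)
      then have "(norm (reflected_Phi t x y))\<^sup>2 \<le> (C * sqrt t / (y - x))\<^sup>2"
        using C(3)[OF t x] by (intro power_mono) auto
      also have "\<dots> = C\<^sup>2 * (t / (y - x)\<^sup>2)" using t by (simp add: power_divide power_mult_distrib)
      finally show ?thesis using False by simp
    qed
    let ?R = "\<lambda>y. (m * (norm (g y))\<^sup>2 + C\<^sup>2 / m * ?M y) / 2"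
    have g2: "set_integrable lebesgue I (\<lambda>y. (norm (g y))\<^sup>2)" and gm: "set_borel_measurable lebesgue I g"
      using g by (auto simp: L2_on_def)
    have Ri: "set_integrable lebesgue I ?R"
      by (intro set_integrable_divide set_integral_add(1) set_integrable_mult_right g2 MI)
    have bound: "norm (g y * reflected_Phi t x y) \<le> ?R y" if "y \<in> I" for y
    proof -
      have "0 \<le> (m * norm (g y) - norm (reflected_Phi t x y))\<^sup>2 / m" using m by simp
      also have "\<dots> = m * (norm (g y))\<^sup>2 + (norm (reflected_Phi t x y))\<^sup>2 / m - 2 * (norm (g y) * norm (reflected_Phi t x y))"
        using m by (simp add: field_simps power2_eq_square)
      finally have "2 * norm (g y * reflected_Phi t x y) \<le> m * (norm (g y))\<^sup>2 + (norm (reflected_Phi t x y))\<^sup>2 / m"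
        by (simp add: norm_mult)
      also have "(norm (reflected_Phi t x y))\<^sup>2 / m \<le> C\<^sup>2 * ?M y / m"
        using m that I SM by (intro divide_right_mono) auto
      finally show ?thesis by simp
    qed
    have meas: "set_borel_measurable lebesgue I (\<lambda>y. g y * reflected_Phi t x y)"
    proof -
      have "reflected_Phi t x \<in> borel_measurable borel"
        by (rule borel_measurable_continuous_onI[OF continuous_on_reflected_Phi[OF t]])
      then have "reflected_Phi t x \<in> borel_measurable lebesgue" by (simp add: measurable_completion)
      from borel_measurable_times[OF gm[unfolded set_borel_measurable_def] this]
      show ?thesis unfolding set_borel_measurable_def by simp
    qed
    have R0: "0 \<le> ?R y" for y using m t by simp
    have int: "set_integrable lebesgue I (\<lambda>y. g y * reflected_Phi t x y)"
    proof (rule set_integrable_bound[OF Ri meas], intro AE_I2 impI)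
      fix y assume "y \<in> I"
      show "norm (g y * reflected_Phi t x y) \<le> norm (?R y)"
        using bound[OF \<open>y \<in> I\<close>] abs_ge_self[of "?R y"] unfolding real_norm_def by (rule order_trans)
    qed
    have "norm (LINT y:I|lebesgue. g y * reflected_Phi t x y) \<le> (LINT y:I|lebesgue. norm (g y * reflected_Phi t x y))"
      by (rule set_integral_norm_bound[OF int])
    also have "\<dots> \<le> (LINT y:I|lebesgue. ?R y)"
      by (rule set_integral_mono[OF set_integrable_norm[OF int] Ri bound])
    also have "\<dots> = (m * square_integral I g + C\<^sup>2 / m * (LINT y:I|lebesgue. ?M y)) / 2"
      unfolding set_integral_divide_zero set_integral_add(2)[OF set_integrable_mult_right[OF g2] set_integrable_mult_right[OF MI]]
        set_integral_mult_right ..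
    also have "\<dots> \<le> (m * square_integral I g + C\<^sup>2 / m * (2 * (m * m))) / 2"
      using m by (intro divide_right_mono add_left_mono mult_left_mono MIv) auto
    also have "\<dots> \<le> (square_integral I g + C\<^sup>2) * m"
    proof -
      have "0 \<le> square_integral I g"
        unfolding set_lebesgue_integral_def by (intro Bochner_Integration.integral_nonneg) simp
      then have "0 \<le> m * square_integral I g" using m by simp
      moreover have "C\<^sup>2 / m * (2 * (m * m)) = 2 * (C\<^sup>2 * m)" using m(1) by simp
      moreover have "(square_integral I g + C\<^sup>2) * m = m * square_integral I g + C\<^sup>2 * m"
        by (simp add: distrib_right)
      moreover have "(u + v) / 2 \<le> w" if "0 \<le> u" "v = 2 * d" "w = u + d" for u v w d :: real
        using that by simp
      ultimately show ?thesis by blast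
    qed
    finally show "norm (LINT y:I|lebesgue. g y * reflected_Phi t x y) \<le> (square_integral I g + C\<^sup>2) * sqrt (x + sqrt t)"
      by (simp add: m_def)
  qed
qed

abbreviation corner :: "(real \<times> real) filter" where
  "corner \<equiv> at (0, 0) within {0<..} \<times> {0<..}"

lemma eventually_corner:
  assumes "\<delta> > 0"
  shows "\<forall>\<^sub>F z in corner. 0 < fst z \<and> fst z < \<delta> \<and> 0 < snd z \<and> snd z < \<delta>"
  unfolding eventually_at
proof (intro exI[of _ \<delta>] conjI ballI impI assms)
  fix z :: "real \<times> real" assume z: "z \<in> {0<..} \<times> {0<..}" "z \<noteq> (0, 0) \<and> dist z (0, 0) < \<delta>"
  have "\<bar>fst z\<bar> < \<delta>" "\<bar>snd z\<bar> < \<delta>"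
    using dist_fst_le[of z "(0, 0)"] dist_snd_le[of z "(0, 0)"] z(2) by (auto simp: dist_real_def)
  then show "0 < fst z" "fst z < \<delta>" "0 < snd z" "snd z < \<delta>" using z(1) by auto
qed

text \<open>The size of the remainders that the estimates produce, comparable to \<open>x\<^sup>1\<^sup>/\<^sup>2 + t\<^sup>1\<^sup>/\<^sup>4\<close>.\<close>

definition corner_scale :: "real \<times> real \<Rightarrow> complex" where
  "corner_scale z = of_real (sqrt (fst z + sqrt (snd z)))"

lemma norm_corner_scale: "0 < fst z \<Longrightarrow> 0 < snd z \<Longrightarrow> norm (corner_scale z) = sqrt (fst z + sqrt (snd z))"
  by (simp add: corner_scale_def)

lemma sqrt_le_corner_scale:
  assumes "0 < x" "0 < t" "t < 1"
  shows "sqrt t \<le> sqrt (x + sqrt t)"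
proof -
  have "sqrt t * sqrt t \<le> sqrt t * 1" using assms by (intro mult_left_mono) auto
  then have "t \<le> sqrt t" using assms by simp
  then show ?thesis using assms by simp
qed

lemma norm_boundary_terms:
  fixes p c' l i :: complex
  assumes "norm p \<le> A" "norm (- c' + i) \<le> B" "norm l \<le> E"
  shows "norm (p - c' - l + i) \<le> A + B + E"
  using norm_triangle_ineq[of p "- c' + i"] norm_triangle_ineq4[of "p + (- c' + i)" l] assms by (simp add: algebra_simps)

text \<open>Integration by parts on one piece. The boundary terms are \<open>S(b)\<close> and \<open>S(a)\<close> with constant factors;
  they are \<open>O(\<surd>t)\<close> as \<open>x\<close> stays away from \<open>a\<close> and \<open>b\<close>, except at \<open>a = 0\<close>, where the main term arises.\<close>

lemma bounded_piece:
  assumes a: "0 \<le> a" "a < b" and g: "L2_on {a<..<b} g" and f: "L2_on {a<..<b} f"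
    and rep: "AE y in lebesgue. y \<in> {a<..<b} \<longrightarrow> f y = c + (LINT u:{a<..<y}|lebesgue. g u)"
  shows "(\<lambda>z. (LINT y:{a<..<b}|lebesgue. f y * reflected_propagator (snd z) (fst z) y)
       + (if a = 0 then c * (2 * Phi (snd z) (fst z)) else 0)) \<in> O[corner](corner_scale)"
proof -
  obtain C where C: "C > 0" "\<And>t x y. 0 < t \<Longrightarrow> 0 < x \<Longrightarrow> x < y \<Longrightarrow> norm (reflected_Phi t x y) \<le> C * sqrt t / (y - x)"
    using reflected_Phi_bounds by metis
  obtain D where D: "D > 0"
    "\<forall>I g t x. L2_on I g \<longrightarrow> I \<subseteq> {0<..} \<longrightarrow> I \<in> sets lebesgue \<longrightarrow> 0 < t \<longrightarrow> 0 < x \<longrightarrow>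
       norm (LINT y:I|lebesgue. g y * reflected_Phi t x y) \<le> (square_integral I g + D) * sqrt (x + sqrt t)"
    using reflected_Phi_pairing by blast
  define G where "G = c + (LINT y:{a<..<b}|lebesgue. g y)"
  \<comment> \<open>For \<open>a = 0\<close> the term \<open>2 * C / a\<close> is \<open>0\<close>, as it should be: the boundary term at \<open>a\<close> is then the main term.\<close>
  define K where "K = norm G * (2 * C / b) + norm c * (2 * C / a) + (square_integral {a<..<b} g + D)"
  define \<delta> where "\<delta> = min 1 (if a = 0 then b / 2 else a / 2)"
  have \<delta>: "\<delta> > 0" using a by (auto simp: \<delta>_def)
  have S: "norm (reflected_Phi t x y) \<le> 2 * C / y * sqrt (x + sqrt t)"
    if "0 < x" "x < y / 2" "0 < t" "t < 1" for x y t :: real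
  proof -
    have "norm (reflected_Phi t x y) \<le> C * sqrt t / (y - x)" using that by (intro C) auto
    also have "\<dots> \<le> C * sqrt (x + sqrt t) / (y / 2)"
      using that C(1) sqrt_le_corner_scale[of x t] by (intro frac_le mult_left_mono mult_nonneg_nonneg) auto
    finally show ?thesis by (simp add: mult_ac)
  qed
  show ?thesis
  proof (rule bigoI[of _ K])
    show "\<forall>\<^sub>F z in corner. norm ((LINT y:{a<..<b}|lebesgue. f y * reflected_propagator (snd z) (fst z) y)
       + (if a = 0 then c * (2 * Phi (snd z) (fst z)) else 0)) \<le> K * norm (corner_scale z)"
      using eventually_corner[OF \<delta>]
    proof eventually_elim
      case (elim z)
      obtain x t where z: "z = (x, t)" by (cases z)
      have xt: "0 < x" "0 < t" "t < 1" "x < b / 2" "a = 0 \<or> x < a / 2"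
        using elim a by (auto simp: z \<delta>_def split: if_splits)
      let ?m = "sqrt (x + sqrt t)"
      have fm: "set_borel_measurable lebesgue {a<..<b} f" using f by (simp add: L2_on_def)
      have P: "(LINT y:{a<..<b}|lebesgue. f y * reflected_propagator t x y)
          = G * reflected_Phi t x b - c * reflected_Phi t x a - (LINT y:{a<..<b}|lebesgue. g y * reflected_Phi t x y)"
        unfolding G_def
        by (rule integral_by_parts_representation[OF a(2) set_integrable_L2_interval[OF g] rep fm
              has_vector_derivative_reflected_Phi[OF xt(2)]])
           (intro continuous_intros)
      have 1: "norm (G * reflected_Phi t x b) \<le> norm G * (2 * C / b) * ?m"
        unfolding norm_mult mult.assoc using S[of x b t] xt by (intro mult_left_mono) auto
      have 2: "norm (- c * reflected_Phi t x a + (if a = 0 then c * (2 * Phi t x) else 0)) \<le> norm c * (2 * C / a) * ?m"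
      proof (cases "a = 0")
        case False
        then have "norm (c * reflected_Phi t x a) \<le> norm c * (2 * C / a) * ?m"
          unfolding norm_mult mult.assoc using S[of x a t] xt by (intro mult_left_mono) auto
        then show ?thesis using False by simp
      qed (simp add: reflected_Phi_0)
      have 3: "norm (LINT y:{a<..<b}|lebesgue. g y * reflected_Phi t x y) \<le> (square_integral {a<..<b} g + D) * ?m"
      proof -
        have "{a<..<b} \<subseteq> {0<..}" using a by auto
        from D(2)[rule_format, OF g this _ xt(2,1)] show ?thesis by simp
      qed
      from norm_boundary_terms[OF 1 _ 3, of "c * reflected_Phi t x a"] 2
      have "norm (G * reflected_Phi t x b - c * reflected_Phi t x a - (LINT y:{a<..<b}|lebesgue. g y * reflected_Phi t x y)
         + (if a = 0 then c * (2 * Phi t x) else 0)) \<le> K * ?m"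
        by (simp add: K_def distrib_right)
      then show ?case unfolding z fst_conv snd_conv P norm_corner_scale[of z, unfolded z fst_conv snd_conv, OF xt(1,2)] .
    qed
  qed
qed

text \<open>The last piece is exhausted by the intervals \<open>(a, a + r)\<close>. The datum grows at most like \<open>\<surd>r\<close> by the
  square integrability of its derivative, while \<open>S(a + r) = O(1 / r)\<close>, so the boundary term at \<open>a + r\<close>
  disappears.\<close>

lemma half_line_piece:
  assumes a: "0 \<le> a" and g: "L2_on {a<..} g" and f: "L2_on {a<..} f" and fi: "set_integrable lebesgue {a<..} f"
    and rep: "AE y in lebesgue. y \<in> {a<..} \<longrightarrow> f y = c + (LINT u:{a<..<y}|lebesgue. g u)"
  shows "(\<lambda>z. (LINT y:{a<..}|lebesgue. f y * reflected_propagator (snd z) (fst z) y)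
       + (if a = 0 then c * (2 * Phi (snd z) (fst z)) else 0)) \<in> O[corner](corner_scale)"
proof -
  obtain C where C: "C > 0" "\<And>t x y. 0 < t \<Longrightarrow> 0 < x \<Longrightarrow> x < y \<Longrightarrow> norm (reflected_Phi t x y) \<le> C * sqrt t / (y - x)"
    using reflected_Phi_bounds by metis
  obtain D where D: "D > 0"
    "\<forall>I g t x. L2_on I g \<longrightarrow> I \<subseteq> {0<..} \<longrightarrow> I \<in> sets lebesgue \<longrightarrow> 0 < t \<longrightarrow> 0 < x \<longrightarrow>
       norm (LINT y:I|lebesgue. g y * reflected_Phi t x y) \<le> (square_integral I g + D) * sqrt (x + sqrt t)"
    using reflected_Phi_pairing by blast
  define G2 where "G2 = square_integral {a<..} g"
  define K where "K = norm c * (2 * C / a) + (G2 + D)"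
  define \<delta> where "\<delta> = min 1 (if a = 0 then 1 else a / 2)"
  have \<delta>: "\<delta> > 0" using a by (auto simp: \<delta>_def)
  show ?thesis
  proof (rule bigoI[of _ K])
    show "\<forall>\<^sub>F z in corner. norm ((LINT y:{a<..}|lebesgue. f y * reflected_propagator (snd z) (fst z) y)
       + (if a = 0 then c * (2 * Phi (snd z) (fst z)) else 0)) \<le> K * norm (corner_scale z)"
      using eventually_corner[OF \<delta>]
    proof eventually_elim
      case (elim z)
      obtain x t where z: "z = (x, t)" by (cases z)
      have xt: "0 < x" "0 < t" "t < 1" "x < 1" "a = 0 \<or> x < a / 2"
        using elim a by (auto simp: z \<delta>_def split: if_splits)
      let ?m = "sqrt (x + sqrt t)"
      let ?w = "\<lambda>y. reflected_propagator t x y"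
      let ?i = "if a = 0 then c * (2 * Phi t x) else 0"
      have Fi: "set_integrable lebesgue {a<..} (\<lambda>y. f y * ?w y)"
      proof (rule set_integrable_mult_bounded[OF fi])
        have "?w \<in> borel_measurable borel"
          by (intro borel_measurable_continuous_onI continuous_intros)
        then have "?w \<in> borel_measurable lebesgue" by (simp add: measurable_completion)
        then show "set_borel_measurable lebesgue {a<..} ?w"
          unfolding set_borel_measurable_def by (intro borel_measurable_scaleR borel_measurable_indicator) auto
        have n: "norm (propagator t u) = norm (fresnel_limit / of_real (pi * sqrt t))" for u
          unfolding propagator_def norm_mult norm_exp_i_times by simp
        show "norm (?w y) \<le> 2 * norm (fresnel_limit / of_real (pi * sqrt t))" for y
          using norm_triangle_ineq4[of "propagator t (y + x)" "propagator t (y - x)"] unfolding n by simp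
      qed
      define e where "e r = (norm c + sqrt r * ((G2 + 1) / 2)) * (C * sqrt t / (a + r - x))" for r
      have bd: "norm ((LINT y:{a<..<a + r}|lebesgue. f y * ?w y) + ?i) \<le> K * ?m + e r" if r: "r > 1" for r
      proof -
        have sub: "{a<..<a + r} \<subseteq> {a<..}" by auto
        have g': "L2_on {a<..<a + r} g" by (rule L2_on_subset[OF g sub]) simp
        have f': "L2_on {a<..<a + r} f" by (rule L2_on_subset[OF f sub]) simp
        have rep': "AE y in lebesgue. y \<in> {a<..<a + r} \<longrightarrow> f y = c + (LINT u:{a<..<y}|lebesgue. g u)"
          using rep by eventually_elim auto
        have ar: "a < a + r" using r by simp
        have fm: "set_borel_measurable lebesgue {a<..<a + r} f" using f' by (simp add: L2_on_def)
        define G where "G = (LINT y:{a<..<a + r}|lebesgue. g y)"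
        have P: "(LINT y:{a<..<a + r}|lebesgue. f y * ?w y)
          = (c + G) * reflected_Phi t x (a + r) - c * reflected_Phi t x a - (LINT y:{a<..<a + r}|lebesgue. g y * reflected_Phi t x y)"
          unfolding G_def
          by (rule integral_by_parts_representation[OF ar set_integrable_L2_interval[OF g'] rep' fm
                has_vector_derivative_reflected_Phi[OF xt(2)]])
             (intro continuous_intros)
        have "norm G \<le> (LINT y:{a<..<a + r}|lebesgue. norm (g y))"
          unfolding G_def by (rule set_integral_norm_bound[OF set_integrable_L2_interval[OF g']])
        also have "\<dots> \<le> sqrt r * ((G2 + 1) / 2)"
          using L2_on_integral_bound[OF g sub ar] by (simp add: G2_def)
        finally have "norm (c + G) \<le> norm c + sqrt r * ((G2 + 1) / 2)"
          using norm_triangle_ineq[of c G] by simp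
        moreover have "norm (reflected_Phi t x (a + r)) \<le> C * sqrt t / (a + r - x)"
          using xt r a by (intro C) auto
        ultimately have 1: "norm ((c + G) * reflected_Phi t x (a + r)) \<le> e r"
          unfolding norm_mult e_def by (intro mult_mono) (auto intro: order_trans[OF norm_ge_zero])
        have 2: "norm (- (c * reflected_Phi t x a) + ?i) \<le> norm c * (2 * C / a) * ?m"
        proof (cases "a = 0")
          case False
          have "norm (reflected_Phi t x a) \<le> C * sqrt t / (a - x)" using xt False a by (intro C) auto
          also have "\<dots> \<le> C * ?m / (a / 2)"
            using xt False a C(1) sqrt_le_corner_scale[of x t] by (intro frac_le mult_left_mono mult_nonneg_nonneg) auto
          finally have "norm c * norm (reflected_Phi t x a) \<le> norm c * (C * ?m / (a / 2))"
            by (intro mult_left_mono) auto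
          then show ?thesis using False by (simp add: norm_mult mult_ac)
        qed (simp add: reflected_Phi_0)
        have 3: "norm (LINT y:{a<..<a + r}|lebesgue. g y * reflected_Phi t x y) \<le> (G2 + D) * ?m"
        proof -
          have "norm (LINT y:{a<..<a + r}|lebesgue. g y * reflected_Phi t x y) \<le> (square_integral {a<..<a + r} g + D) * ?m"
          proof -
            have "{a<..<a + r} \<subseteq> {0<..}" using a by auto
            from D(2)[rule_format, OF g' this _ xt(2,1)] show ?thesis by simp
          qed
          also have "\<dots> \<le> (G2 + D) * ?m"
          proof (intro mult_right_mono add_right_mono)
            show "square_integral {a<..<a + r} g \<le> G2"
              unfolding G2_def set_lebesgue_integral_def
              using g g' sub by (intro integral_mono) (auto simp: L2_on_def set_integrable_def indicator_def)
          qed (use xt in auto)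
          finally show ?thesis .
        qed
        from norm_boundary_terms[OF 1 2 3] show ?thesis unfolding P by (simp add: K_def distrib_right)
      qed
      have lim: "((\<lambda>r. LINT y:{a<..<a + r}|lebesgue. f y * ?w y) \<longlongrightarrow> (LINT y:{a<..}|lebesgue. f y * ?w y)) at_top"
      proof -
        have i: "indicator {a<..<a + r} y *\<^sub>R F = indicator {a<..} y *\<^sub>R (indicator {..<a + r} y * F)" for r y and F :: complex
          by (auto simp: indicator_def)
        have "((\<lambda>r. LINT y:{a<..}|lebesgue. indicator {..<a + r} y * (f y * ?w y)) \<longlongrightarrow> (LINT y:{a<..}|lebesgue. 1 * (f y * ?w y))) at_top"
        proof (rule set_integral_dominated_at_top(1)[OF Fi, of _ 1])
          show "set_borel_measurable lebesgue {a<..} (\<lambda>y. indicator {..<a + r} y * (f y * ?w y))" for r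
          proof -
            have "set_integrable lebesgue {a<..<a + r} (\<lambda>y. f y * ?w y)"
              by (rule set_integrable_subset[OF Fi]) auto
            then show ?thesis unfolding set_integrable_def set_borel_measurable_def i by (rule borel_measurable_integrable)
          qed
          show "((\<lambda>r. indicator {..<a + r} y) \<longlongrightarrow> (1::complex)) at_top" for y
          proof (rule tendsto_eventually)
            show "\<forall>\<^sub>F r in at_top. indicator {..<a + r} y = (1::complex)"
              using eventually_gt_at_top[of "y - a"] by eventually_elim simp
          qed
        qed (auto simp: indicator_def)
        then show ?thesis unfolding set_lebesgue_integral_def i by simp
      qed
      have elim0: "(e \<longlongrightarrow> 0) at_top"
        unfolding e_def by real_asymp
      have "norm ((LINT y:{a<..}|lebesgue. f y * ?w y) + ?i) \<le> K * ?m + 0"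
      proof (rule tendsto_le[OF _ tendsto_add[OF tendsto_const elim0] tendsto_norm[OF tendsto_add[OF lim tendsto_const]]])
        show "\<forall>\<^sub>F r in at_top. norm ((LINT y:{a<..<a + r}|lebesgue. f y * ?w y) + ?i) \<le> K * ?m + e r"
          using eventually_gt_at_top[of 1] by eventually_elim (rule bd)
      qed simp
      then show ?case unfolding z fst_conv snd_conv norm_corner_scale[of z, unfolded z fst_conv snd_conv, OF xt(1,2)] by simp
    qed
  qed
qed


lemma set_integral_split_at:
  fixes F :: "real \<Rightarrow> complex"
  assumes F: "set_integrable lebesgue (A \<union> {b} \<union> B) F" and AB: "A \<inter> B = {}" "b \<notin> B"
    and A: "A \<in> sets lebesgue" and B: "B \<in> sets lebesgue"
  shows "(LINT y:A \<union> {b} \<union> B|lebesgue. F y) = (LINT y:A|lebesgue. F y) + (LINT y:B|lebesgue. F y)"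
proof -
  have iA: "set_integrable lebesgue A F" and iB: "set_integrable lebesgue B F"
    by (rule set_integrable_subset[OF F]; use A B in auto)+
  have "(LINT y:A \<union> {b} \<union> B|lebesgue. F y) = (LINT y:A \<union> B|lebesgue. F y)"
    by (rule set_integral_discrete_difference[of "{b}"]) auto
  also have "\<dots> = (LINT y:A|lebesgue. F y) + (LINT y:B|lebesgue. F y)"
    by (rule set_integral_Un[OF AB(1) iA iB])
  finally show ?thesis .
qed

lemma initial_datum_contribution:
  fixes xs :: "nat \<Rightarrow> real"
  assumes L2: "L2_on {0<..} qo" and L1: "set_integrable lebesgue {0<..} qo"
    and x0: "xs 0 = 0" and mono: "\<And>i. i < M \<Longrightarrow> xs i < xs (Suc i)"
    and pieces: "\<And>i. i < M \<Longrightarrow> H1_on {xs i<..<xs (Suc i)} qo" and last: "H1_on {xs M<..} qo"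
  shows "(\<lambda>z. (LINT y:{0<..}|lebesgue. qo y * reflected_propagator (snd z) (fst z) y)
       + right_lim qo 0 * (2 * Phi (snd z) (fst z))) \<in> O[corner](corner_scale)"
proof -
  let ?F = "\<lambda>z y. qo y * reflected_propagator (snd z) (fst z) y"
  let ?main = "\<lambda>z. right_lim qo 0 * (2 * Phi (snd z) (fst z))"
  have nonneg: "0 \<le> xs i \<and> (0 < i \<longrightarrow> 0 < xs i)" if "i \<le> M" for i
    using that
  proof (induction i)
    case (Suc i)
    then show ?case using mono[of i] by simp
  qed (simp add: x0)
  have near: "\<forall>\<^sub>F z in corner. set_integrable lebesgue {0<..} (?F z)"
    using eventually_corner[OF zero_less_one]
    by eventually_elim (rule set_integrable_reflected_propagator[OF L1], auto)
  have piece: "(\<lambda>z. (LINT y:{xs i<..<xs (Suc i)}|lebesgue. ?F z y) + (if i = 0 then ?main z else 0)) \<in> O[corner](corner_scale)"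
    if i: "i < M" for i
  proof -
    obtain g c where g: "L2_on {xs i<..<xs (Suc i)} g"
      and rep: "AE y in lebesgue. y \<in> {xs i<..<xs (Suc i)} \<longrightarrow> qo y = c + (LINT u:{xs i<..<y}|lebesgue. g u)"
      by (rule H1_on_interval[OF pieces[OF i] mono[OF i]])
    have n: "0 \<le> xs i" using nonneg[of i] i by simp
    have q: "L2_on {xs i<..<xs (Suc i)} qo"
      by (rule L2_on_subset[OF L2]) (use n in auto)
    have z: "xs i = 0 \<longleftrightarrow> i = 0" using nonneg[of i] i x0 by (cases "i = 0") auto
    have c: "c = right_lim qo 0" if "i = 0"
      using right_lim_primitive[OF mono[OF i] g rep] that x0 by simp
    have "(\<lambda>z. (LINT y:{xs i<..<xs (Suc i)}|lebesgue. ?F z y) + (if xs i = 0 then c * (2 * Phi (snd z) (fst z)) else 0)) \<in> O[corner](corner_scale)"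
      by (rule bounded_piece[OF n mono[OF i] g q rep])
    then show ?thesis using c by (cases "i = 0") (simp_all add: z x0)
  qed
  have first: "(\<lambda>z. (LINT y:{0<..<xs (Suc i)}|lebesgue. ?F z y) + ?main z) \<in> O[corner](corner_scale)" if "i < M" for i
    using that
  proof (induction i)
    case 0
    then show ?case using piece[of 0] x0 by simp
  next
    case (Suc i)
    have ord: "0 < xs (Suc i)" "xs (Suc i) < xs (Suc (Suc i))"
      using nonneg[of "Suc i"] mono[of "Suc i"] Suc.prems by auto
    have U: "{0<..<xs (Suc (Suc i))} = {0<..<xs (Suc i)} \<union> {xs (Suc i)} \<union> {xs (Suc i)<..<xs (Suc (Suc i))}"
      using ord by auto
    have "(\<lambda>z. ((LINT y:{0<..<xs (Suc i)}|lebesgue. ?F z y) + ?main z) + (LINT y:{xs (Suc i)<..<xs (Suc (Suc i))}|lebesgue. ?F z y)) \<in> O[corner](corner_scale)"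
    proof (rule sum_in_bigo(1))
      show "(\<lambda>z. (LINT y:{0<..<xs (Suc i)}|lebesgue. ?F z y) + ?main z) \<in> O[corner](corner_scale)"
        using Suc by simp
      show "(\<lambda>z. LINT y:{xs (Suc i)<..<xs (Suc (Suc i))}|lebesgue. ?F z y) \<in> O[corner](corner_scale)"
        using piece[OF Suc.prems] by simp
    qed
    moreover have "\<forall>\<^sub>F z in corner. ((LINT y:{0<..<xs (Suc i)}|lebesgue. ?F z y) + ?main z) + (LINT y:{xs (Suc i)<..<xs (Suc (Suc i))}|lebesgue. ?F z y)
        = (LINT y:{0<..<xs (Suc (Suc i))}|lebesgue. ?F z y) + ?main z"
      using near
    proof eventually_elim
      case (elim z)
      have "set_integrable lebesgue {0<..<xs (Suc (Suc i))} (?F z)"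
        by (rule set_integrable_subset[OF elim]) auto
      then show ?case unfolding U by (subst set_integral_split_at) auto
    qed
    ultimately show ?case by (subst (asm) landau_o.big.in_cong)
  qed
  obtain g c where g: "L2_on {xs M<..} g"
    and rep: "AE y in lebesgue. y \<in> {xs M<..} \<longrightarrow> qo y = c + (LINT u:{xs M<..<y}|lebesgue. g u)"
    by (rule H1_on_half_line[OF last])
  have n: "0 \<le> xs M" using nonneg[of M] by simp
  have sub: "{xs M<..} \<subseteq> {0<..}" using n by auto
  have "L2_on {xs M<..} qo" by (rule L2_on_subset[OF L2 sub]) simp
  from half_line_piece[OF n g this set_integrable_subset[OF L1 _ sub] rep]
  have tail: "(\<lambda>z. (LINT y:{xs M<..}|lebesgue. ?F z y) + (if xs M = 0 then c * (2 * Phi (snd z) (fst z)) else 0)) \<in> O[corner](corner_scale)"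
    by simp
  show ?thesis
  proof (cases M)
    case 0
    have "AE y in lebesgue. y \<in> {xs M<..<xs M + 1} \<longrightarrow> qo y = c + (LINT u:{xs M<..<y}|lebesgue. g u)"
      using rep by eventually_elim auto
    moreover have "L2_on {xs M<..<xs M + 1} g" by (rule L2_on_subset[OF g]) auto
    ultimately have "right_lim qo (xs M) = c" by (intro right_lim_primitive[of _ "xs M + 1"]) auto
    then show ?thesis using tail 0 x0 by simp
  next
    case (Suc m)
    have pos: "0 < xs M" using nonneg[of M] Suc by simp
    have U: "{0<..} = {0<..<xs M} \<union> {xs M} \<union> {xs M<..}" using pos by auto
    have "(\<lambda>z. ((LINT y:{0<..<xs M}|lebesgue. ?F z y) + ?main z) + (LINT y:{xs M<..}|lebesgue. ?F z y)) \<in> O[corner](corner_scale)"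
    proof (rule sum_in_bigo(1))
      show "(\<lambda>z. (LINT y:{0<..<xs M}|lebesgue. ?F z y) + ?main z) \<in> O[corner](corner_scale)"
        using first[of m] Suc by simp
      show "(\<lambda>z. LINT y:{xs M<..}|lebesgue. ?F z y) \<in> O[corner](corner_scale)"
        using tail pos by simp
    qed
    moreover have "\<forall>\<^sub>F z in corner. ((LINT y:{0<..<xs M}|lebesgue. ?F z y) + ?main z) + (LINT y:{xs M<..}|lebesgue. ?F z y)
        = (LINT y:{0<..}|lebesgue. ?F z y) + ?main z"
      using near
    proof eventually_elim
      case (elim z)
      have "(LINT y:{0<..}|lebesgue. ?F z y) = (LINT y:{0<..<xs M}|lebesgue. ?F z y) + (LINT y:{xs M<..}|lebesgue. ?F z y)"
        using elim unfolding U by (rule set_integral_split_at) auto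
      then show ?case by simp
    qed
    ultimately show ?thesis by (subst (asm) landau_o.big.in_cong)
  qed
qed

lemma boundary_datum_contribution:
  assumes b: "b > 0" and g: "L2_on {0<..<b} g"
  shows "(\<lambda>z. LINT s:{0<..<snd z}|lebesgue. (Phi (snd z - s) (fst z) - 1 / 2) * g s) \<in> O[corner](corner_scale)"
proof -
  obtain C where C: "C > 0" "\<And>t a. norm (Phi t a) \<le> C"
    using Phi_bounds by metis
  define G2 where "G2 = square_integral {0<..<b} g"
  show ?thesis
  proof (rule bigoI[of _ "(C + 1 / 2) * ((G2 + 1) / 2)"])
    have "min 1 b > 0" using b by simp
    from eventually_corner[OF this]
    show "\<forall>\<^sub>F z in corner. norm (LINT s:{0<..<snd z}|lebesgue. (Phi (snd z - s) (fst z) - 1 / 2) * g s)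
        \<le> (C + 1 / 2) * ((G2 + 1) / 2) * norm (corner_scale z)"
    proof eventually_elim
      case (elim z)
      obtain x t where z: "z = (x, t)" by (cases z)
      have xt: "0 < x" "0 < t" "t < 1" "t < b" using elim by (auto simp: z)
      have sub: "{0<..<t} \<subseteq> {0<..<b}" using xt by auto
      have g': "L2_on {0<..<t} g" by (rule L2_on_subset[OF g sub]) simp
      note gi = set_integrable_L2_interval[OF g']
      have rep: "AE s in lebesgue. s \<in> {0<..<t} \<longrightarrow> (LINT y:{0<..<s}|lebesgue. g y) = 0 + (LINT y:{0<..<s}|lebesgue. g y)" by simp
      have "set_integrable lebesgue {0<..<t} (\<lambda>s. (LINT y:{0<..<s}|lebesgue. g y) * 1)"
      proof (rule set_integral_by_parts(2)[OF xt(2) gi, of complex_of_real "\<lambda>_. 1"])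
        show "(complex_of_real has_vector_derivative 1) (at x within {0..t})" for x
          using has_vector_derivative_of_real[OF DERIV_ident] by simp
      qed (rule continuous_on_const)
      then have i: "set_integrable lebesgue {0<..<t} (\<lambda>s. (Phi (t - s) x - 1 / 2) * g s)"
        using boundary_transform_tendsto(3)[OF gi _ rep xt(2,1)] by simp
      have bd: "norm ((Phi (t - s) x - 1 / 2) * g s) \<le> (C + 1 / 2) * norm (g s)" for s
        unfolding norm_mult
        using norm_triangle_ineq4[of "Phi (t - s) x" "1 / 2"] C(2)[of "t - s" x]
        by (intro mult_right_mono) auto
      have "norm (LINT s:{0<..<t}|lebesgue. (Phi (t - s) x - 1 / 2) * g s) \<le> (LINT s:{0<..<t}|lebesgue. norm ((Phi (t - s) x - 1 / 2) * g s))"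
        by (rule set_integral_norm_bound[OF i])
      also have "\<dots> \<le> (LINT s:{0<..<t}|lebesgue. (C + 1 / 2) * norm (g s))"
        by (rule set_integral_mono[OF set_integrable_norm[OF i] set_integrable_mult_right[OF set_integrable_norm[OF gi]] bd])
      also have "\<dots> = (C + 1 / 2) * (LINT s:{0<..<t}|lebesgue. norm (g s))" by (rule set_integral_mult_right)
      also have "\<dots> \<le> (C + 1 / 2) * (sqrt t * ((G2 + 1) / 2))"
        using L2_on_integral_bound[OF g sub xt(2)] C(1) by (intro mult_left_mono) (auto simp: G2_def)
      also have "\<dots> \<le> (C + 1 / 2) * (sqrt (x + sqrt t) * ((G2 + 1) / 2))"
      proof -
        have "0 \<le> G2" unfolding G2_def set_lebesgue_integral_def by (intro Bochner_Integration.integral_nonneg) simp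
        then show ?thesis using sqrt_le_corner_scale[OF xt(1,2,3)] C(1) by (intro mult_left_mono mult_right_mono) auto
      qed
      finally show ?case unfolding z fst_conv snd_conv norm_corner_scale[of z, unfolded z fst_conv snd_conv, OF xt(1,2)]
        by (simp add: mult_ac)
    qed
  qed
qed

lemma corner_scale_bigo:
  "corner_scale \<in> O[corner](\<lambda>(x, t). complex_of_real (\<bar>x\<bar> powr (1/2) + \<bar>t\<bar> powr (1/4)))"
proof (rule bigoI[of _ 1])
  show "\<forall>\<^sub>F z in corner. norm (corner_scale z) \<le> 1 * norm (case z of (x, t) \<Rightarrow> complex_of_real (\<bar>x\<bar> powr (1/2) + \<bar>t\<bar> powr (1/4)))"
    using eventually_corner[OF zero_less_one]
  proof eventually_elim
    case (elim z)
    obtain x t where z: "z = (x, t)" by (cases z)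
    have xt: "0 < x" "0 < t" using elim by (auto simp: z)
    have "sqrt (x + sqrt t) \<le> sqrt x + sqrt (sqrt t)"
      using xt by (intro sqrt_add_le_add_sqrt) auto
    also have "sqrt x = x powr (1/2)" using xt by (simp add: powr_half_sqrt)
    also have "sqrt (sqrt t) = t powr (1/4)"
      using xt by (simp add: powr_half_sqrt[symmetric] powr_powr)
    finally have "sqrt (x + sqrt t) \<le> x powr (1/2) + t powr (1/4)" .
    moreover have "norm (complex_of_real (\<bar>x\<bar> powr (1/2) + \<bar>t\<bar> powr (1/4))) = x powr (1/2) + t powr (1/4)"
      unfolding norm_of_real using xt by simp
    ultimately show ?case
      unfolding z prod.case norm_corner_scale[of z, unfolded z fst_conv snd_conv, OF xt] by simp
  qed
qed

lemma set_integrable_of_weighted: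
  assumes l: "l \<ge> 0" and m: "set_borel_measurable lebesgue A f"
    and w: "set_integrable lebesgue A (\<lambda>x. (1 + \<bar>x\<bar>) powr l *\<^sub>R f x)"
  shows "set_integrable lebesgue A (f :: real \<Rightarrow> complex)"
proof (rule set_integrable_bound[OF w m], intro AE_I2 impI)
  fix x :: real
  have "1 * norm (f x) \<le> (1 + \<bar>x\<bar>) powr l * norm (f x)"
    using l by (intro mult_right_mono ge_one_powr_ge_zero) auto
  then show "norm (f x) \<le> norm ((1 + \<bar>x\<bar>) powr l *\<^sub>R f x)" by simp
qed

theorem mainTheorem1:
  fixes qo g0 :: "real \<Rightarrow> complex" and q :: "real \<Rightarrow> real \<Rightarrow> complex" and T R l :: real
  assumes "T > 0" and "R > 0" and "l \<ge> 0"
    and "admissible_initial l qo"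
    and "admissible_boundary T g0"
    and "L2_solution T qo g0 q"
    and "\<And>x t. 0 < x \<Longrightarrow> 0 < t \<Longrightarrow> t \<le> T \<Longrightarrow> q x t = solution_formula qo g0 x t"
  shows "(\<lambda>(x, t). q x t - q_loc R qo g0 x t)
    \<in> O[at (0, 0) within {0<..} \<times> {0<..}](\<lambda>(x, t). complex_of_real (\<bar>x\<bar> powr (1/2) + \<bar>t\<bar> powr (1/4)))"
proof -
  obtain M xs where L2: "L2_on {0<..} qo"
    and w: "set_integrable lebesgue {0<..} (\<lambda>x. (1 + \<bar>x\<bar>) powr l *\<^sub>R qo x)"
    and xs: "xs 0 = 0" "\<And>i. i < M \<Longrightarrow> xs i < xs (Suc i)"
      "\<And>i. i < M \<Longrightarrow> H1_on {xs i<..<xs (Suc i)} qo" "H1_on {xs M<..} qo"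
    using assms(4) unfolding admissible_initial_def by blast
  have L1: "set_integrable lebesgue {0<..} qo"
    using set_integrable_of_weighted[OF assms(3) _ w] L2 by (simp add: L2_on_def)
  have A: "(\<lambda>z. (LINT y:{0<..}|lebesgue. qo y * reflected_propagator (snd z) (fst z) y)
       + right_lim qo 0 * (2 * Phi (snd z) (fst z))) \<in> O[corner](corner_scale)"
    by (rule initial_datum_contribution[OF L2 L1 xs])
  obtain K ts where ts: "ts 0 = 0" "\<And>i. i \<le> K \<Longrightarrow> ts i < ts (Suc i)" "\<And>i. i \<le> K \<Longrightarrow> H1_on {ts i<..<ts (Suc i)} g0"
    using assms(5) unfolding admissible_boundary_def by blast
  define b where "b = ts 1"
  have b: "b > 0" "H1_on {0<..<b} g0" using ts(1) ts(2)[of 0] ts(3)[of 0] by (auto simp: b_def)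
  obtain g c where g: "L2_on {0<..<b} g"
    and rep: "AE s in lebesgue. s \<in> {0<..<b} \<longrightarrow> g0 s = c + (LINT y:{0<..<s}|lebesgue. g y)"
    by (rule H1_on_interval[OF b(2,1)])
  have c: "right_lim g0 0 = c" by (rule right_lim_primitive[OF b(1) g rep])
  note B = boundary_datum_contribution[OF b(1) g]
  let ?A = "\<lambda>z. (LINT y:{0<..}|lebesgue. qo y * reflected_propagator (snd z) (fst z) y)
       + right_lim qo 0 * (2 * Phi (snd z) (fst z))"
  let ?B = "\<lambda>z. LINT s:{0<..<snd z}|lebesgue. (Phi (snd z - s) (fst z) - 1 / 2) * g s"
  have "(\<lambda>z. - ?A z - 2 * ?B z) \<in> O[corner](corner_scale)"
  proof (rule sum_in_bigo(2))
    show "(\<lambda>z. - ?A z) \<in> O[corner](corner_scale)" by (rule landau_o.big.uminus_in_iff[THEN iffD2, OF A])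
    show "(\<lambda>z. 2 * ?B z) \<in> O[corner](corner_scale)" using B by simp
  qed
  moreover have "\<forall>\<^sub>F z in corner. - ?A z - 2 * ?B z = (case z of (x, t) \<Rightarrow> q x t - q_loc R qo g0 x t)"
  proof -
    have "min T b > 0" using assms(1) b by simp
    from eventually_corner[OF this] show ?thesis
    proof eventually_elim
      case (elim z)
      obtain x t where z: "z = (x, t)" by (cases z)
      have xt: "0 < x" "0 < t" "t \<le> T" "t < b" using elim by (auto simp: z)
      have sub: "{0<..<t} \<subseteq> {0<..<b}" using xt by auto
      have "L2_on {0<..<t} g" by (rule L2_on_subset[OF g sub]) simp
      note gi = set_integrable_L2_interval[OF this]
      have "L2_on {0<..<b} g0" using b(2) by (simp add: H1_on_def)
      then have "L2_on {0<..<t} g0" by (rule L2_on_subset[OF _ sub]) simp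
      note g0i = set_integrable_L2_interval[OF this]
      have rep': "AE s in lebesgue. s \<in> {0<..<t} \<longrightarrow> g0 s = c + (LINT y:{0<..<s}|lebesgue. g y)"
        using rep by eventually_elim (use xt in auto)
      have sol: "q x t = - (LINT y:{0<..}|lebesgue. qo y * reflected_propagator t x y)
         - 2 * (c * (Phi t x - 1 / 2) + (LINT s:{0<..<t}|lebesgue. (Phi (t - s) x - 1 / 2) * g s))"
        unfolding assms(7)[OF xt(1,2,3)] by (rule solution_formula_eq[OF L1 gi g0i rep' xt(2,1)])
      have loc: "q_loc R qo g0 x t = - 2 * c * (Phi t x - 1 / 2) + 2 * right_lim qo 0 * Phi t x"
        using I_special_eq[OF assms(2) xt(2), of x] xt by (simp add: q_loc_def c)
      have "- (X + r * (2 * P)) - 2 * Y = (- X - 2 * (c * (P - 1 / 2) + Y)) - (- 2 * c * (P - 1 / 2) + 2 * r * P)"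
        for X Y P r :: complex
        by (simp add: algebra_simps)
      then show ?case unfolding z fst_conv snd_conv prod.case sol loc .
    qed
  qed
  ultimately have "(\<lambda>(x, t). q x t - q_loc R qo g0 x t) \<in> O[corner](corner_scale)"
    by (subst (asm) landau_o.big.in_cong)
  then show ?thesis using corner_scale_bigo by (rule landau_o.big.trans)
qed

end
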